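(* Let $1<q'<\infty$, and let $1<r'<t'<p'<\infty$ or $1=r'<t'\le p'<\infty$. Then the Hardy-Littlewood maximal operator $\mathcal M$ is bounded on the block space $\mathcal H_{p',q'}^{t',r'}(\mathbb R^n)$.
   Context: Hardy-Littlewood maximal operator: $\mathcal Mf(x)=\sup_{B\ni x}\frac1{|B|}\int_B|f(y)|\,dy$, supremum over all balls $B\subset\mathbb R^n$ containing $x$. Primes denote conjugate exponents ($1/p+1/p'=1$). Lorentz norm: with $d_f(s)=|\{x:|f(x)|>s\}|$ and $f^*(u)=\inf\{s>0:d_f(s)\le u\}$, $\|f\|_{L^{p,q}}=\left(\int_0^\infty(u^{1/p}f^*(u))^q\frac{du}{u}\right)^{1/q}$ for $q<\infty$. Dyadic cubes: $Q_{j,m}=\prod_{i=1}^n[2^{-j}m_i,2^{-j}(m_i+1))$, $j\in\mathbb Z$, $m\in\mathbb Z^n$. Block space: a measurable function $b$ is a $(p',q',t')$-block supported on a cube $Q$ if $b$ is supported on $Q$ and $\|b\|_{L^{p',q'}}\le|Q|^{1/p'-1/t'}$. $\mathcal H_{p',q'}^{t',r'}(\mathbb R^n)$ is the set of measurable $f$ that can be written as $f=\sum_{(j,k)\in\mathbb Z^{1+n}}\lambda_{j,k}b_{j,k}$ (convergence in $L^1_{\mathrm{loc}}$) with $\lambda\in\ell^{r'}(\mathbb Z^{1+n})$ and each $b_{j,k}$ a $(p',q',t')$-block supported on $Q_{j,k}$; $\|f\|_{\mathcal H_{p',q'}^{t',r'}(\mathbb R^n)}=\inf\|\lambda\|_{\ell^{r'}}$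 over all such representations. *)

theory Defs
  imports "HOL-Analysis.Analysis"
begin

text \<open>
  \<open>\<real>\<^sup>n\<close> is \<^typ>\<open>real ^ 'n\<close> with Lebesgue measure, functions are complex-valued, and the
  index set \<open>\<int>\<^sup>1\<^sup>+\<^sup>n\<close> is \<^typ>\<open>int \<times> (int ^ 'n)\<close>.  The exponents called
  \<open>p, q, t, r\<close> below are the ones that the block space literature writes \<open>p', q', t', r'\<close>.
\<close>

definition HL_maximal :: "(real ^ 'n \<Rightarrow> complex) \<Rightarrow> real ^ 'n \<Rightarrow> ennreal" where
  "HL_maximal f x =
     (SUP (c, \<rho>) \<in> {(c, \<rho>). 0 < \<rho> \<and> x \<in> ball c \<rho>}.
        (\<integral>\<^sup>+ y \<in> ball c \<rho>. ennreal (norm (f y)) \<partial>lebesgue) / emeasure lebesgue (ball c \<rho>))"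

text \<open>Powers of extended nonnegative reals; used for positive exponents only.\<close>

definition ennpowr :: "ennreal \<Rightarrow> real \<Rightarrow> ennreal" where
  "ennpowr x a = (if x = \<infinity> then \<infinity> else ennreal (enn2real x powr a))"

definition distr_fun :: "(real ^ 'n \<Rightarrow> complex) \<Rightarrow> real \<Rightarrow> ennreal" where
  "distr_fun f s = emeasure lebesgue {x. s < norm (f x)}"

text \<open>The infimum is taken in \<^typ>\<open>ennreal\<close>, so that of the empty set is \<open>\<infinity>\<close>.\<close>

definition decr_rearr :: "(real ^ 'n \<Rightarrow> complex) \<Rightarrow> real \<Rightarrow> ennreal" where
  "decr_rearr f u = Inf {ennreal s | s. 0 < s \<and> distr_fun f s \<le> ennreal u}"

definition lorentz_norm :: "real \<Rightarrow> real \<Rightarrow> (real ^ 'n \<Rightarrow> complex) \<Rightarrow> ennreal" where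
  "lorentz_norm p q f =
     ennpowr (\<integral>\<^sup>+ u \<in> {0<..}. ennpowr (ennreal (u powr (1 / p)) * decr_rearr f u) q / ennreal u
                \<partial>lborel) (1 / q)"

definition dyadic_cube :: "int \<times> (int ^ 'n) \<Rightarrow> (real ^ 'n) set" where
  "dyadic_cube = (\<lambda>(j, m).
     {x. \<forall>i. 2 powi (- j) * of_int (m $ i) \<le> x $ i \<and> x $ i < 2 powi (- j) * (of_int (m $ i) + 1)})"

definition is_block ::
  "real \<Rightarrow> real \<Rightarrow> real \<Rightarrow> (real ^ 'n) set \<Rightarrow> (real ^ 'n \<Rightarrow> complex) \<Rightarrow> bool" where
  "is_block p q t Q b \<longleftrightarrow>
     b \<in> borel_measurable lebesgue \<and> (\<forall>x. x \<notin> Q \<longrightarrow> b x = 0) \<and>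
     lorentz_norm p q b \<le> ennreal (measure lebesgue Q powr (1 / p - 1 / t))"

definition in_lp :: "real \<Rightarrow> ('i \<Rightarrow> complex) \<Rightarrow> bool" where
  "in_lp r c \<longleftrightarrow> (\<lambda>i. norm (c i) powr r) summable_on UNIV"

definition lp_norm :: "real \<Rightarrow> ('i \<Rightarrow> complex) \<Rightarrow> real" where
  "lp_norm r c = (\<Sum>\<^sub>\<infinity>i. norm (c i) powr r) powr (1 / r)"

text \<open>Sums converge along the net of finite subsets of the index set.\<close>

definition sums_L1loc ::
  "('i \<Rightarrow> real ^ 'n \<Rightarrow> complex) \<Rightarrow> (real ^ 'n \<Rightarrow> complex) \<Rightarrow> bool" where
  "sums_L1loc g f \<longleftrightarrow>
     (\<forall>K. compact K \<longrightarrow>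
        ((\<lambda>F. \<integral>\<^sup>+ x \<in> K. ennreal (norm (f x - (\<Sum>i\<in>F. g i x))) \<partial>lebesgue) \<longlongrightarrow> 0)
          (finite_subsets_at_top UNIV))"

definition block_repr ::
  "real \<Rightarrow> real \<Rightarrow> real \<Rightarrow> real \<Rightarrow> (real ^ 'n \<Rightarrow> complex) \<Rightarrow>
   (int \<times> (int ^ 'n) \<Rightarrow> complex) \<Rightarrow> (int \<times> (int ^ 'n) \<Rightarrow> real ^ 'n \<Rightarrow> complex) \<Rightarrow> bool" where
  "block_repr p q t r f c b \<longleftrightarrow>
     in_lp r c \<and> (\<forall>i. is_block p q t (dyadic_cube i) (b i)) \<and>
     sums_L1loc (\<lambda>i x. c i * b i x) f"

definition block_space ::
  "real \<Rightarrow> real \<Rightarrow> real \<Rightarrow> real \<Rightarrow> (real ^ 'n \<Rightarrow> complex) set" where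
  "block_space p q t r =
     {f \<in> borel_measurable lebesgue. \<exists>c b. block_repr p q t r f c b}"

text \<open>Meaningful for members of \<^const>\<open>block_space\<close> only: otherwise the infimum is over the
  empty set.\<close>

definition block_norm ::
  "real \<Rightarrow> real \<Rightarrow> real \<Rightarrow> real \<Rightarrow> (real ^ 'n \<Rightarrow> complex) \<Rightarrow> real" where
  "block_norm p q t r f = Inf {lp_norm r c | c. \<exists>b. block_repr p q t r f c b}"

text \<open>An operator with values in \<open>[0, \<infinity>]\<close> is bounded if its values are finite almost everywhere
  and, read as complex-valued functions, lie in the space with a uniform norm bound.\<close>

definition bounded_on_block_space ::
  "real \<Rightarrow> real \<Rightarrow> real \<Rightarrow> real \<Rightarrow>
   ((real ^ 'n \<Rightarrow> complex) \<Rightarrow> real ^ 'n \<Rightarrow> ennreal) \<Rightarrow> bool" where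
  "bounded_on_block_space p q t r T \<longleftrightarrow>
     (\<exists>C. \<forall>f \<in> block_space p q t r.
        (AE x in lebesgue. T f x < \<infinity>) \<and>
        (\<lambda>x. complex_of_real (enn2real (T f x))) \<in> block_space p q t r \<and>
        block_norm p q t r (\<lambda>x. complex_of_real (enn2real (T f x))) \<le> C * block_norm p q t r f)"

end

(*
  It suffices to dominate M f by a sum of nonnegative functions H R supported on the dyadic cubes R
  whose Lorentz quasinorms are controlled by an l^r sequence: multiplying each H R by
  M f / (sum of the H R) then gives a decomposition of M f itself.

  If f is the sum of w_Q b_Q, then M f is at most the sum of |w_Q| M b_Q.  On the neighbours of Q, M b_Q
  is handled by the boundedness of M on L^{p,q} (p, q > 1).  On the neighbours R of the l-th ancestor of
  Q, away from those of the (l-1)-st, M b_Q is at most a multiple of ||b_Q||_1 / |R|, that is of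
  2^{-l n (1 - 1/t)} |R|^{-1/t}, which is that factor times a block on R.  The coefficient of R is
  therefore the sum of 2^{-l n (1 - 1/t)} |w_Q| over l and over the roughly 2^{l n} cubes Q of
  generation l below R; by Jensen's inequality with weights 2^{-l (n + e)}, e = n (1/r - 1/t), this
  is bounded on l^r, because r < t.

  For L^{p,q}, the weak (1,1) bound (Vitali covering) applied to the part of F above F*(u) gives
  (M F)*(u) <= C sum_k 2^{-k} F*(2^{-k-1} u), and a discrete Hardy inequality, again from weighted
  Jensen, finishes since p > 1.
*)
theory Submission
  imports Defs
begin

section \<open>Powers and countable sums of extended nonnegative reals\<close>

text \<open>The Lorentz functional is only a quasinorm, so it must never meet an infinite sum. This
  dictates the shape of \<open>H R\<close>: the near part has at most 3^n terms, so the
  quasi-triangle inequality costs a fixed constant, while the infinitely many far contributions are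
  constants on \<open>R\<close> and are added as numbers, in \<open>spread_coeff\<close>, before any
  norm is taken.

  The choice e = n (1/r - 1/t) closes both halves of a Schur-type test. The weight 2^{-l (n + e)}
  pays for the cubes Q below R. The factor left over is 2^{l n / r}; its r-th power 2^{l n} cuts the
  weight back to 2^{-l e}, which is all that the sum over R requires, with at most 3^n cubes per
  generation.

  The alternative r = 1 or t < p enters elsewhere, in the L^1_loc convergence of the new series. A
  unit cube has ancestors of every size, and its k-th ancestor contributes at most a multiple of
  2^{-k n (1/t - 1/p)} times its coefficient. Either this decays, or the coefficients themselves are
  summable.\<close>

lemma ennpowr_0 [simp]: "ennpowr 0 a = 0"
  by (simp add: ennpowr_def)

lemma ennpowr_top [simp]: "ennpowr top a = top"
  by (simp add: ennpowr_def)

lemma ennpowr_ennreal: "0 \<le> x \<Longrightarrow> ennpowr (ennreal x) a = ennreal (x powr a)"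
  by (simp add: ennpowr_def)

lemma ennpowr_1 [simp]: "ennpowr x 1 = x"
  by (cases x) (auto simp: ennpowr_ennreal)

lemma ennpowr_mono:
  assumes "x \<le> y" "0 \<le> a"
  shows "ennpowr x a \<le> ennpowr y a"
proof (cases y)
  case (real b)
  then obtain c where "x = ennreal c" "0 \<le> c"
    using assms by (cases x) (auto simp: top_unique)
  then show ?thesis
    using real assms by (auto simp: ennpowr_ennreal intro!: ennreal_leI powr_mono2)
qed simp

lemma ennpowr_mult: "ennpowr (x * y) a = ennpowr x a * ennpowr y a"
proof (cases "x = 0 \<or> y = 0")
  case False
  show ?thesis
  proof (cases x)
    case x: (real a)
    show ?thesis
    proof (cases y)
      case (real b)
      with x show ?thesis
        by (simp add: ennpowr_ennreal ennreal_mult [symmetric] powr_mult)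
    next
      case top
      with x False show ?thesis
        by (auto simp: ennpowr_ennreal ennreal_mult_top)
    qed
  next
    case top
    then have "ennpowr y a \<noteq> 0"
      using False by (cases y) (auto simp: ennpowr_ennreal)
    then show ?thesis
      using top False by (simp add: ennreal_top_mult)
  qed
qed auto

lemma ennpowr_ennpowr: "ennpowr (ennpowr x a) b = ennpowr x (a * b)"
  by (cases x) (auto simp: ennpowr_ennreal powr_powr)

lemma ennpowr_root_le:
  assumes "0 < a" "ennpowr x a \<le> y"
  shows "x \<le> ennpowr y (1 / a)"
  using ennpowr_mono [OF assms(2), of "1 / a"] assms(1) by (simp add: ennpowr_ennpowr)

lemma measurable_ennpowr [measurable]:
  assumes [measurable]: "f \<in> borel_measurable M"
  shows "(\<lambda>x. ennpowr (f x) a) \<in> borel_measurable M"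
  unfolding ennpowr_def by measurable

lemma ennpowr_eq_top_iff: "ennpowr x a = top \<longleftrightarrow> x = top"
  by (simp add: ennpowr_def)

text \<open>Bounding the sum by twice the maximum gives a constant valid for convex and concave
  powers alike; it is applied with both \<open>q\<close> and \<open>1 / q\<close>.\<close>

lemma ennpowr_add_le:
  assumes "0 \<le> a"
  shows "ennpowr (x + y) a \<le> ennreal (2 powr a) * (ennpowr x a + ennpowr y a)"
proof -
  have "x + y \<le> 2 * max x y"
    by (metis add_mono max.cobounded1 max.cobounded2 mult_2)
  then have "ennpowr (x + y) a \<le> ennpowr (ennreal 2 * max x y) a"
    using assms by (intro ennpowr_mono) auto
  also have "\<dots> = ennreal (2 powr a) * ennpowr (max x y) a"
    by (simp add: ennpowr_mult ennpowr_ennreal del: ennreal_numeral)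
  also have "\<dots> \<le> ennreal (2 powr a) * (ennpowr x a + ennpowr y a)"
    by (intro mult_left_mono) (auto simp: max_def)
  finally show ?thesis .
qed

text \<open>Convexity: y^r lies above its tangent at \<open>m\<close>. The terms are arranged
  without subtraction so that the inequality carries over to \<open>ennreal\<close>. The proof is
  Young's inequality for y^r and m^r with weights 1/r and 1 - 1/r.\<close>

lemma powr_tangent_le:
  fixes y m r :: real
  assumes "0 \<le> y" "0 < m" "1 \<le> r"
  shows "r * m powr (r - 1) * y \<le> y powr r + (r - 1) * m powr r"
proof (cases "y = 0")
  case False
  with assms have "(y powr r) powr (1/r) * (m powr r) powr (1 - 1/r)
      \<le> (1/r) * y powr r + (1 - 1/r) * m powr r"
    by (intro Youngs_inequality_0) (auto simp: field_simps)
  then have "y * m powr (r - 1) \<le> (1/r) * y powr r + (1 - 1/r) * m powr r"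
    using assms False by (simp add: powr_powr right_diff_distrib)
  then have "r * (y * m powr (r - 1)) \<le> r * ((1/r) * y powr r + (1 - 1/r) * m powr r)"
    using assms by (intro mult_left_mono) auto
  then show ?thesis
    using assms by (simp add: algebra_simps)
qed (use assms in auto)

text \<open>Jensen's inequality for the measure with density \<open>v\<close>: the tangent
  inequality is integrated and the point of tangency is then optimised. Only an upper bound
  \<open>V\<close> for the mass enters, which is what the weight estimates below supply.\<close>

lemma nn_integral_Jensen_powr:
  fixes v f :: "'a \<Rightarrow> ennreal"
  assumes [measurable]: "v \<in> borel_measurable M" "f \<in> borel_measurable M"
    and r: "1 \<le> r" and V: "0 < V" "(\<integral>\<^sup>+x. v x \<partial>M) \<le> ennreal V"
  shows "ennpowr (\<integral>\<^sup>+x. v x * f x \<partial>M) r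
    \<le> ennreal (V powr (r - 1)) * (\<integral>\<^sup>+x. v x * ennpowr (f x) r \<partial>M)"
proof -
  define S where "S = (\<integral>\<^sup>+x. v x * f x \<partial>M)"
  define T where "T = (\<integral>\<^sup>+x. v x * ennpowr (f x) r \<partial>M)"
  have tan: "ennreal (r * m powr (r - 1)) * S \<le> T + ennreal ((r - 1) * m powr r * V)" if "0 < m" for m
  proof -
    have "ennreal (r * m powr (r - 1)) * y \<le> ennpowr y r + ennreal ((r - 1) * m powr r)" for y
    proof (cases y)
      case (real z)
      then have "ennreal (r * m powr (r - 1) * z) \<le> ennreal (z powr r + (r - 1) * m powr r)"
        using that r by (intro ennreal_leI powr_tangent_le) auto
      then show ?thesis
        using real r by (simp add: ennpowr_ennreal ennreal_mult ennreal_plus)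
    qed auto
    then have "v x * (ennreal (r * m powr (r - 1)) * f x)
        \<le> v x * (ennpowr (f x) r + ennreal ((r - 1) * m powr r))" for x
      by (intro mult_left_mono) auto
    then have "(\<integral>\<^sup>+x. ennreal (r * m powr (r - 1)) * (v x * f x) \<partial>M)
        \<le> (\<integral>\<^sup>+x. v x * ennpowr (f x) r + ennreal ((r - 1) * m powr r) * v x \<partial>M)"
      by (intro nn_integral_mono) (simp add: distrib_left ac_simps)
    then have "ennreal (r * m powr (r - 1)) * S \<le> T + ennreal ((r - 1) * m powr r) * (\<integral>\<^sup>+x. v x \<partial>M)"
      by (simp add: S_def T_def nn_integral_cmult nn_integral_add)
    also have "\<dots> \<le> T + ennreal ((r - 1) * m powr r) * ennreal V"
      by (intro add_left_mono mult_left_mono V) auto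
    finally show ?thesis
      using r V by (simp add: ennreal_mult)
  qed
  show ?thesis
  proof (cases T)
    case (real t)
    \<comment> \<open>The optimal tangent point depends on S, so S must first be known to be finite;
      the tangent at 1 gives this.\<close>
    have "S < top"
    proof -
      have "ennreal r * S < top"
        using tan [of 1] real by (simp add: order.strict_trans1)
      then show ?thesis using r by (auto simp: ennreal_mult_less_top)
    qed
    then obtain s where s: "S = ennreal s" "0 \<le> s"
      by (cases S) auto
    have "s powr r \<le> V powr (r - 1) * t"
    proof (cases "s = 0")
      case False
      \<comment> \<open>With this stand-in for the mean, m^(r-1) s = m^r V, and the tangent
        inequality collapses to m^r V \<le> t.\<close>
      define m where "m = s / V"
      have m: "0 < m" using False s V by (simp add: m_def)
      have "ennreal (r * m powr (r - 1) * s) \<le> ennreal (t + (r - 1) * m powr r * V)"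
        using tan [OF m] real s r V by (simp add: ennreal_mult ennreal_plus)
      then have "r * m powr (r - 1) * s \<le> t + (r - 1) * m powr r * V"
        using real r V m by (subst (asm) ennreal_le_iff) auto
      moreover have "m powr (r - 1) * s = m powr r * V"
        using m V s by (simp add: powr_diff m_def)
      ultimately have "m powr r * V \<le> t"
        by (simp add: algebra_simps)
      then have "V powr (r - 1) * (m powr r * V) \<le> V powr (r - 1) * t"
        by (intro mult_left_mono) auto
      moreover have "V powr (r - 1) * (m powr r * V) = s powr r"
        using s V False by (simp add: m_def powr_diff powr_divide)
      ultimately show ?thesis by simp
    qed (use real in auto)
    then show ?thesis
      using s real by (simp add: S_def [symmetric] T_def [symmetric] ennpowr_ennreal ennreal_mult'[symmetric] ennreal_leI)
  next
    case top
    then show ?thesis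
      using V by (simp add: T_def [symmetric] ennreal_mult_top)
  qed
qed

section \<open>Countable sums as integrals and along the net of finite subsets\<close>

lemma nn_integral_count_space_sum_le:
  fixes f :: "'i \<Rightarrow> ennreal"
  assumes "finite A"
  shows "(\<Sum>i\<in>A. f i) \<le> (\<integral>\<^sup>+i. f i \<partial>count_space UNIV)"
proof -
  have "(\<Sum>i\<in>A. f i) = (\<integral>\<^sup>+i. f i \<partial>count_space A)"
    using assms by (simp add: nn_integral_count_space_finite)
  also have "\<dots> = (\<integral>\<^sup>+i. f i * indicator A i \<partial>count_space UNIV)"
    by (subst nn_integral_count_space_indicator) auto
  also have "\<dots> \<le> (\<integral>\<^sup>+i. f i \<partial>count_space UNIV)"
    by (intro nn_integral_mono) (auto split: split_indicator)
  finally show ?thesis .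
qed

text \<open>The bridge between \<open>nn_integral\<close> over \<open>count_space\<close>, where
  Tonelli and monotone convergence are available, and the net of finite subsets by which the
  definitions sum.\<close>

lemma nn_integral_count_space_SUP:
  fixes f :: "'i::countable \<Rightarrow> ennreal"
  shows "(\<integral>\<^sup>+i. f i \<partial>count_space UNIV) = (SUP A\<in>{A. finite A}. \<Sum>i\<in>A. f i)"
proof (rule antisym)
  \<comment> \<open>Monotone convergence wants a sequence, while the finite sets form only a
    directed family; initial segments of an enumeration provide one.\<close>
  define A where "A n = {i :: 'i. to_nat i \<le> n}" for n
  have fin: "finite (A n)" for n
    unfolding A_def by (rule finite_subset [OF _ finite_vimageI [OF finite_atMost [of n] inj_to_nat]]) auto
  have "(\<integral>\<^sup>+i. f i \<partial>count_space UNIV) = (\<integral>\<^sup>+i. (SUP n. f i * indicator (A n) i) \<partial>count_space UNIV)"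
  proof (intro nn_integral_cong antisym)
    fix i
    have "f i = f i * indicator (A (to_nat i)) i" by (simp add: A_def)
    also have "\<dots> \<le> (SUP n. f i * indicator (A n) i)" by (rule SUP_upper) simp
    finally show "f i \<le> (SUP n. f i * indicator (A n) i)" .
    show "(SUP n. f i * indicator (A n) i) \<le> f i"
      by (intro SUP_least) (auto split: split_indicator)
  qed
  also have "\<dots> = (SUP n. \<integral>\<^sup>+i. f i * indicator (A n) i \<partial>count_space UNIV)"
    by (intro nn_integral_monotone_convergence_SUP)
       (auto simp: incseq_def le_fun_def A_def split: split_indicator)
  also have "\<dots> = (SUP n. \<Sum>i\<in>A n. f i)"
  proof (intro SUP_cong refl)
    fix n
    have "(\<integral>\<^sup>+i. f i * indicator (A n) i \<partial>count_space UNIV) = (\<integral>\<^sup>+i. f i \<partial>count_space (A n))"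
      by (subst nn_integral_count_space_indicator) auto
    then show "(\<integral>\<^sup>+i. f i * indicator (A n) i \<partial>count_space UNIV) = (\<Sum>i\<in>A n. f i)"
      using fin by (simp add: nn_integral_count_space_finite)
  qed
  also have "\<dots> \<le> (SUP A\<in>{A. finite A}. \<Sum>i\<in>A. f i)"
    using fin by (intro SUP_least SUP_upper) auto
  finally show "(\<integral>\<^sup>+i. f i \<partial>count_space UNIV) \<le> (SUP A\<in>{A. finite A}. \<Sum>i\<in>A. f i)" .
  show "(SUP A\<in>{A. finite A}. \<Sum>i\<in>A. f i) \<le> (\<integral>\<^sup>+i. f i \<partial>count_space UNIV)"
    by (intro SUP_least nn_integral_count_space_sum_le) auto
qed

lemma ennreal_infsum_eq_nn_integral:
  fixes f :: "'i::countable \<Rightarrow> real"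
  assumes "f summable_on UNIV" "\<And>i. 0 \<le> f i"
  shows "ennreal (infsum f UNIV) = (\<integral>\<^sup>+i. ennreal (f i) \<partial>count_space UNIV)"
  using assms by (subst infsum_nonneg_is_SUPREMUM_ennreal)
    (auto simp: nn_integral_count_space_SUP intro!: SUP_cong)

lemma summable_on_of_nn_integral:
  fixes f :: "'i::countable \<Rightarrow> real"
  assumes "(\<integral>\<^sup>+i. ennreal (f i) \<partial>count_space UNIV) < top" "\<And>i. 0 \<le> f i"
  shows "f summable_on UNIV"
proof -
  obtain B where B: "(\<integral>\<^sup>+i. ennreal (f i) \<partial>count_space UNIV) = ennreal B" "0 \<le> B"
    using assms(1) by (metis ennreal_cases less_irrefl)
  have "sum f F \<le> B" if "finite F" for F
  proof -
    have "ennreal (sum f F) \<le> ennreal B"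
      using nn_integral_count_space_sum_le [OF that, of f] assms(2) B by simp
    then show ?thesis using B by simp
  qed
  then show ?thesis
    using assms(2) by (intro nonneg_bdd_above_summable_on) (auto simp: bdd_above_def)
qed

text \<open>The tail is the total minus a finite partial sum. This supplies the unconditional
  L^1_loc convergence of the new block series.\<close>

lemma nn_integral_count_space_tail_tendsto_0:
  fixes f :: "'i::countable \<Rightarrow> ennreal"
  assumes "(\<integral>\<^sup>+i. f i \<partial>count_space UNIV) < top"
  shows "((\<lambda>A. \<integral>\<^sup>+i. f i * indicator (- A) i \<partial>count_space UNIV) \<longlongrightarrow> 0) (finite_subsets_at_top UNIV)"
proof -
  let ?S = "\<integral>\<^sup>+i. f i \<partial>count_space UNIV"
  have eq: "(\<integral>\<^sup>+i. f i * indicator (- A) i \<partial>count_space UNIV) = ?S - (\<Sum>i\<in>A. f i)" if A: "finite A" for A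
  proof -
    have "(\<integral>\<^sup>+i. f i * indicator A i \<partial>count_space UNIV) = (\<Sum>i\<in>A. f i)"
      using A by (subst nn_integral_count_space_indicator [symmetric]) (auto simp: nn_integral_count_space_finite)
    moreover have "?S = (\<integral>\<^sup>+i. f i * indicator A i + f i * indicator (- A) i \<partial>count_space UNIV)"
      by (intro nn_integral_cong) (auto split: split_indicator)
    ultimately have "?S = (\<Sum>i\<in>A. f i) + (\<integral>\<^sup>+i. f i * indicator (- A) i \<partial>count_space UNIV)"
      by (simp add: nn_integral_add)
    moreover have "(\<Sum>i\<in>A. f i) \<noteq> top"
      using nn_integral_count_space_sum_le [OF A, of f] assms by (auto simp: top_unique)
    ultimately show ?thesis by (metis ennreal_add_diff_cancel_left)
  qed
  have "(f has_sum ?S) UNIV"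
    using nonneg_has_sum_complete [of UNIV f] by (simp add: nn_integral_count_space_SUP)
  then have "((\<lambda>A. \<Sum>i\<in>A. f i) \<longlongrightarrow> ?S) (finite_subsets_at_top UNIV)"
    by (simp add: has_sum_def)
  then have "((\<lambda>A. ?S - (\<Sum>i\<in>A. f i)) \<longlongrightarrow> ?S - ?S) (finite_subsets_at_top UNIV)"
    using assms by (intro tendsto_diff_ennreal_general tendsto_const) auto
  then have "((\<lambda>A. ?S - (\<Sum>i\<in>A. f i)) \<longlongrightarrow> 0) (finite_subsets_at_top UNIV)"
    using assms by simp
  moreover have "\<forall>\<^sub>F A in finite_subsets_at_top UNIV. finite (A :: 'i set)"
    by (rule eventually_finite_subsets_at_top_weakI)
  ultimately show ?thesis
    by (elim Lim_transform_eventually eventually_mono) (simp add: eq)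
qed

section \<open>Decreasing rearrangements and Lorentz functionals\<close>

text \<open>\<open>decr_rearr\<close> for functions with values in [0, \<infinity>], so that maximal
  functions and infinite sums need no prior finiteness; \<open>lorentz_norm_eq\<close> makes the
  connection.\<close>

definition rearr :: "'a measure \<Rightarrow> ('a \<Rightarrow> ennreal) \<Rightarrow> real \<Rightarrow> ennreal" where
  "rearr M F u = Inf {ennreal s | s. 0 < s \<and> emeasure M {x \<in> space M. ennreal s < F x} \<le> ennreal u}"

text \<open>The q-th power of the Lorentz quasinorm: without the outer root it can be added,
  rescaled and exchanged with sums. \<open>lorentz\<close> restores the root.\<close>

definition lorentz_int :: "'a measure \<Rightarrow> real \<Rightarrow> real \<Rightarrow> ('a \<Rightarrow> ennreal) \<Rightarrow> ennreal" where
  "lorentz_int M p q F =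
     (\<integral>\<^sup>+ u \<in> {0<..}. ennpowr (ennreal (u powr (1 / p)) * rearr M F u) q / ennreal u \<partial>lborel)"

lemma ennreal_between_real:
  assumes "(a::ennreal) < b"
  obtains s where "0 < s" "a < ennreal s" "ennreal s < b"
proof -
  obtain c where c: "a < c" "c < b" using assms dense by blast
  then obtain s where "c = ennreal s" "0 \<le> s" by (cases c) auto
  with c show ?thesis
    by (intro that [of s]) (auto simp: order_le_less)
qed

text \<open>The definition admits positive real levels only; approaching \<open>a\<close> from above
  also covers a = 0, the case by which rearrangements are shown to vanish.\<close>

lemma rearr_leI:
  assumes [measurable]: "F \<in> borel_measurable M"
    and a: "emeasure M {x \<in> space M. a < F x} \<le> ennreal u"
  shows "rearr M F u \<le> a"
proof (rule dense_ge)
  fix b assume "a < b"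
  then obtain s where s: "0 < s" "a < ennreal s" "ennreal s < b" by (rule ennreal_between_real)
  have "emeasure M {x \<in> space M. ennreal s < F x} \<le> emeasure M {x \<in> space M. a < F x}"
    using s by (intro emeasure_mono) auto
  then have "rearr M F u \<le> ennreal s"
    unfolding rearr_def using s a by (intro Inf_lower) auto
  with s show "rearr M F u \<le> b" by simp
qed

text \<open>The infimum is attained: the sets above the levels a + 1/(n+1) increase to the set above
  a, and each has measure at most \<open>u\<close>.\<close>

lemma emeasure_gt_rearr_le:
  assumes [measurable]: "F \<in> borel_measurable M"
  shows "emeasure M {x \<in> space M. rearr M F u < F x} \<le> ennreal u"
proof (cases "rearr M F u")
  case (real a)
  define A where "A n = {x \<in> space M. ennreal (a + 1 / Suc n) < F x}" for n
  have [measurable]: "A n \<in> sets M" for n unfolding A_def by measurable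
  have le: "emeasure M (A n) \<le> ennreal u" for n
  proof -
    have "rearr M F u < ennreal (a + 1 / Suc n)"
      using real by (simp add: ennreal_less_iff)
    then obtain s where s: "ennreal s < ennreal (a + 1 / Suc n)" "0 < s"
        "emeasure M {x \<in> space M. ennreal s < F x} \<le> ennreal u"
      unfolding rearr_def by (auto simp: Inf_less_iff)
    have "emeasure M (A n) \<le> emeasure M {x \<in> space M. ennreal s < F x}"
      using s unfolding A_def by (intro emeasure_mono) auto
    with s show ?thesis by simp
  qed
  have "incseq A"
    unfolding A_def incseq_Suc_iff
  proof (intro allI subsetI, clarsimp)
    fix n x assume "ennreal (a + 1 / (1 + real n)) < F x"
    moreover have "ennreal (a + 1 / (2 + real n)) \<le> ennreal (a + 1 / (1 + real n))"
      by (intro ennreal_leI) (auto simp: field_simps)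
    ultimately show "ennreal (a + 1 / (2 + real n)) < F x" by simp
  qed
  then have "(SUP n. emeasure M (A n)) = emeasure M (\<Union>n. A n)"
    by (intro SUP_emeasure_incseq) auto
  moreover have "{x \<in> space M. rearr M F u < F x} \<subseteq> (\<Union>n. A n)"
  proof safe
    fix x assume x: "x \<in> space M" "rearr M F u < F x"
    then obtain s where s: "0 < s" "rearr M F u < ennreal s" "ennreal s < F x"
      by (meson ennreal_between_real)
    then have "a < s" using real by (simp add: ennreal_less_iff)
    then obtain n where "inverse (real (Suc n)) < s - a"
      using reals_Archimedean [of "s - a"] by auto
    then have "ennreal (a + 1 / Suc n) \<le> ennreal s"
      by (intro ennreal_leI) (simp add: inverse_eq_divide)
    with s have "ennreal (a + 1 / Suc n) < F x" by (rule_tac order.strict_trans1)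
    with x have "x \<in> A n" unfolding A_def by auto
    then show "x \<in> (\<Union>n. A n)" by blast
  qed
  ultimately have "emeasure M {x \<in> space M. rearr M F u < F x} \<le> (SUP n. emeasure M (A n))"
    by (simp add: emeasure_mono)
  also have "\<dots> \<le> ennreal u" using le by (intro SUP_least)
  finally show ?thesis .
qed simp

lemma rearr_mono:
  assumes "\<And>x. x \<in> space M \<Longrightarrow> F x \<le> G x"
    and [measurable]: "F \<in> borel_measurable M" "G \<in> borel_measurable M"
  shows "rearr M F u \<le> rearr M G u"
proof (rule rearr_leI)
  have "emeasure M {x \<in> space M. rearr M G u < F x} \<le> emeasure M {x \<in> space M. rearr M G u < G x}"
    using assms(1) by (intro emeasure_mono) (auto intro: less_le_trans)
  also have "\<dots> \<le> ennreal u" by (rule emeasure_gt_rearr_le) simp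
  finally show "emeasure M {x \<in> space M. rearr M G u < F x} \<le> ennreal u" .
qed simp

lemma rearr_antimono: "u \<le> v \<Longrightarrow> rearr M F v \<le> rearr M F u"
  unfolding rearr_def by (intro Inf_superset_mono) (blast intro: order_trans [OF _ ennreal_leI])

text \<open>If \<open>F x + G x\<close> exceeds the sum of two thresholds, one summand exceeds its
  own, and the two exceptional measures add up to at most u + v.\<close>

lemma rearr_add:
  assumes [measurable]: "F \<in> borel_measurable M" "G \<in> borel_measurable M"
    and "0 \<le> u" "0 \<le> v"
  shows "rearr M (\<lambda>x. F x + G x) (u + v) \<le> rearr M F u + rearr M G v"
proof (rule rearr_leI)
  have "emeasure M {x \<in> space M. rearr M F u + rearr M G v < F x + G x}
      \<le> emeasure M ({x \<in> space M. rearr M F u < F x} \<union> {x \<in> space M. rearr M G v < G x})"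
    by (intro emeasure_mono) (auto simp: not_le [symmetric] intro: add_mono)
  also have "\<dots> \<le> emeasure M {x \<in> space M. rearr M F u < F x} + emeasure M {x \<in> space M. rearr M G v < G x}"
    by (intro emeasure_subadditive) auto
  also have "\<dots> \<le> ennreal u + ennreal v"
    by (intro add_mono emeasure_gt_rearr_le) auto
  finally show "emeasure M {x \<in> space M. rearr M F u + rearr M G v < F x + G x} \<le> ennreal (u + v)"
    using assms by (simp add: ennreal_plus)
qed simp

lemma rearr_cmult_le:
  assumes [measurable]: "F \<in> borel_measurable M"
  shows "rearr M (\<lambda>x. c * F x) u \<le> c * rearr M F u"
proof (rule rearr_leI)
  have "emeasure M {x \<in> space M. c * rearr M F u < c * F x} \<le> emeasure M {x \<in> space M. rearr M F u < F x}"
    by (intro emeasure_mono) (auto simp: not_le [symmetric] intro: mult_left_mono)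
  then show "emeasure M {x \<in> space M. c * rearr M F u < c * F x} \<le> ennreal u"
    using emeasure_gt_rearr_le [of F M u] by simp
qed simp

text \<open>Such a set is empty, everything, or a half-line. It makes the antitone function
  \<open>rearr M F\<close> measurable.\<close>

lemma down_closed_sets_borel:
  fixes D :: "real set"
  assumes "\<And>u v. u \<le> v \<Longrightarrow> v \<in> D \<Longrightarrow> u \<in> D"
  shows "D \<in> sets borel"
proof (cases "D = {} \<or> \<not> bdd_above D")
  case True
  then have "D = {} \<or> D = UNIV"
    using assms by (auto simp: bdd_above_def) (metis linear)
  then show ?thesis by auto
next
  case False
  have "D = {..<Sup D} \<or> D = {..Sup D}"
  proof (cases "Sup D \<in> D")
    case True
    with False assms have "D = {..Sup D}" by (auto intro: cSup_upper)
    then show ?thesis ..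
  next
    case notin: False
    have "x \<in> D" if "x < Sup D" for x
      using less_cSupD [OF _ that] False assms by (meson less_imp_le)
    moreover have "x < Sup D" if "x \<in> D" for x
      using that notin False by (metis cSup_upper order_le_less)
    ultimately have "D = {..<Sup D}" by auto
    then show ?thesis ..
  qed
  then show ?thesis by (metis borel_open borel_closed open_lessThan closed_atMost)
qed

lemma rearr_measurable [measurable]: "rearr M F \<in> borel_measurable borel"
proof (rule borel_measurableI_greater)
  fix y
  have "{u. y < rearr M F u} \<in> sets borel"
    by (rule down_closed_sets_borel) (auto intro: less_le_trans rearr_antimono)
  then show "{u \<in> space borel. y < rearr M F u} \<in> sets borel" by simp
qed

text \<open>A layer decomposition at the levels F*(u 2^{-k}): the part of \<open>F\<close> between
  levels k and k + 1 is at most the upper level, on a set of measure at most u 2^{-k}.\<close>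

lemma nn_integral_gt_rearr_le:
  assumes [measurable]: "F \<in> borel_measurable M" and u: "0 < u"
  shows "(\<integral>\<^sup>+x. F x * indicator {x \<in> space M. rearr M F u < F x} x \<partial>M)
    \<le> (\<integral>\<^sup>+k. ennreal (u * (1/2) ^ k) * rearr M F (u * (1/2) ^ Suc k) \<partial>count_space UNIV)"
proof -
  define a where "a k = rearr M F (u * (1/2) ^ k)" for k
  define A where "A k = {x \<in> space M. a k < F x}" for k
  have [measurable]: "A k \<in> sets M" for k unfolding A_def by measurable
  have A_le: "emeasure M (A k) \<le> ennreal (u * (1/2) ^ k)" for k
    unfolding A_def a_def by (rule emeasure_gt_rearr_le) simp
  \<comment> \<open>Points above every level lie in no layer; their measure is at most u 2^{-k} for
    each k.\<close>
  have "(\<Inter>k. A k) \<in> null_sets M"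
  proof (intro null_setsI)
    have "emeasure M (\<Inter>k. A k) \<le> ennreal (u * (1/2) ^ k)" for k
      by (rule order_trans [OF emeasure_mono A_le [of k]]) auto
    moreover have "(\<lambda>k. ennreal (u * (1/2) ^ k)) \<longlonglongrightarrow> ennreal (u * 0)"
      by (intro tendsto_ennrealI tendsto_mult_left LIMSEQ_power_zero) auto
    ultimately show "emeasure M (\<Inter>k. A k) = 0"
      using LIMSEQ_le_const by fastforce
  qed measurable
  then have "AE x in M. x \<notin> (\<Inter>k. A k)" by (rule AE_not_in)
  then have "AE x in M. F x * indicator (A 0) x \<le> (\<integral>\<^sup>+k. a (Suc k) * indicator (A k) x \<partial>count_space UNIV)"
  proof (rule AE_mp, intro AE_I2 impI)
    fix x assume x: "x \<in> space M" "x \<notin> (\<Inter>k. A k)"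
    show "F x * indicator (A 0) x \<le> (\<integral>\<^sup>+k. a (Suc k) * indicator (A k) x \<partial>count_space UNIV)"
    proof (cases "x \<in> A 0")
      case True
      from x obtain k0 where "x \<notin> A k0" by auto
      \<comment> \<open>The first level not exceeded is Suc l, so \<open>x\<close> is in
        \<open>A l\<close> and \<open>F x\<close> is at most \<open>a (Suc l)\<close>: one term of
        the sum already dominates.\<close>
      define k where "k = (LEAST k. x \<notin> A k)"
      have k: "x \<notin> A k" "\<And>j. j < k \<Longrightarrow> x \<in> A j"
        unfolding k_def using LeastI [of "\<lambda>k. x \<notin> A k"] \<open>x \<notin> A k0\<close> not_less_Least by blast+
      with True obtain l where l: "k = Suc l" by (cases k) auto
      have "F x \<le> a (Suc l) * indicator (A l) x"
        using k l x by (auto simp: A_def not_less)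
      also have "\<dots> \<le> (\<integral>\<^sup>+k. a (Suc k) * indicator (A k) x \<partial>count_space UNIV)"
        by (rule nn_integral_ge_point [OF UNIV_I])
      finally show ?thesis using True by simp
    qed simp
  qed
  then have "(\<integral>\<^sup>+x. F x * indicator (A 0) x \<partial>M)
      \<le> (\<integral>\<^sup>+x. \<integral>\<^sup>+k. a (Suc k) * indicator (A k) x \<partial>count_space UNIV \<partial>M)"
    by (rule nn_integral_mono_AE)
  also have "\<dots> = (\<integral>\<^sup>+k. \<integral>\<^sup>+x. a (Suc k) * indicator (A k) x \<partial>M \<partial>count_space UNIV)"
    by (rule nn_integral_count_space_nn_integral) auto
  also have "\<dots> = (\<integral>\<^sup>+k. a (Suc k) * emeasure M (A k) \<partial>count_space UNIV)"
    by (simp add: nn_integral_cmult_indicator)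
  also have "\<dots> \<le> (\<integral>\<^sup>+k. a (Suc k) * ennreal (u * (1/2) ^ k) \<partial>count_space UNIV)"
    by (intro nn_integral_mono mult_left_mono A_le) auto
  finally show ?thesis
    by (simp add: a_def A_def mult.commute)
qed

lemma lorentz_int_mono:
  assumes "\<And>x. x \<in> space M \<Longrightarrow> F x \<le> G x" "0 \<le> q"
    and [measurable]: "F \<in> borel_measurable M" "G \<in> borel_measurable M"
  shows "lorentz_int M p q F \<le> lorentz_int M p q G"
  unfolding lorentz_int_def
  using assms by (intro nn_integral_mono mult_right_mono divide_right_mono_ennreal ennpowr_mono mult_left_mono rearr_mono) auto

lemma ennreal_divide_eq_mult: "0 < u \<Longrightarrow> x / ennreal u = x * ennreal (1 / u)"
  by (simp add: divide_ennreal_def inverse_ennreal divide_inverse)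

text \<open>The measure du/u is invariant under dilation, so only the weight u^(q/p) contributes a
  factor.\<close>

lemma lorentz_int_dilation:
  assumes \<theta>: "0 < \<theta>" and "0 < p" "0 \<le> q"
  shows "(\<integral>\<^sup>+ u \<in> {0<..}. ennpowr (ennreal (u powr (1 / p)) * rearr M F (\<theta> * u)) q / ennreal u \<partial>lborel)
    = ennreal (\<theta> powr (- (q / p))) * lorentz_int M p q F"
proof -
  define D where "D = (\<integral>\<^sup>+ u \<in> {0<..}. ennpowr (ennreal (u powr (1 / p)) * rearr M F (\<theta> * u)) q / ennreal u \<partial>lborel)"
  have "lorentz_int M p q F = ennreal \<theta> * (\<integral>\<^sup>+ u. ennpowr (ennreal ((\<theta> * u) powr (1 / p)) * rearr M F (\<theta> * u)) q / ennreal (\<theta> * u) * indicator {0<..} (\<theta> * u) \<partial>lborel)"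
    unfolding lorentz_int_def using \<theta>
    by (subst nn_integral_real_affine [where c = \<theta> and t = 0]) auto
  also have "\<dots> = ennreal \<theta> * (\<integral>\<^sup>+ u. ennreal (\<theta> powr (q / p) / \<theta>) * (ennpowr (ennreal (u powr (1 / p)) * rearr M F (\<theta> * u)) q / ennreal u * indicator {0<..} u) \<partial>lborel)"
  proof (rule arg_cong [OF nn_integral_cong])
    fix u :: real
    show "ennpowr (ennreal ((\<theta> * u) powr (1 / p)) * rearr M F (\<theta> * u)) q / ennreal (\<theta> * u) * indicator {0<..} (\<theta> * u)
      = ennreal (\<theta> powr (q / p) / \<theta>) * (ennpowr (ennreal (u powr (1 / p)) * rearr M F (\<theta> * u)) q / ennreal u * indicator {0<..} u)"
    proof (cases "0 < u")
      case True
      then have "ennpowr (ennreal ((\<theta> * u) powr (1 / p)) * rearr M F (\<theta> * u)) q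
          = ennreal (\<theta> powr (q / p)) * ennpowr (ennreal (u powr (1 / p)) * rearr M F (\<theta> * u)) q"
        using \<theta> by (simp add: powr_mult ennreal_mult ennpowr_mult ennpowr_ennreal powr_powr mult.assoc)
      moreover have "ennreal (1 / (\<theta> * u)) = ennreal (1 / \<theta>) * ennreal (1 / u)"
        using True \<theta> by (simp add: ennreal_mult [symmetric])
      moreover have "ennreal (\<theta> powr (q / p) / \<theta>) = ennreal (\<theta> powr (q / p)) * ennreal (1 / \<theta>)"
        using \<theta> by (simp add: ennreal_mult [symmetric])
      moreover have "0 < \<theta> * u" using True \<theta> by simp
      ultimately show ?thesis
        using True by (simp only: ennreal_divide_eq_mult) (simp add: mult_ac)
    qed (use \<theta> in \<open>simp add: zero_less_mult_iff\<close>)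
  qed
  also have "\<dots> = ennreal (\<theta> powr (q / p)) * D"
  proof -
    have "ennreal \<theta> * ennreal (\<theta> powr (q / p) / \<theta>) = ennreal (\<theta> powr (q / p))"
      using \<theta> by (simp add: ennreal_mult [symmetric])
    then show ?thesis
      unfolding D_def by (subst nn_integral_cmult) (auto simp: mult.assoc [symmetric])
  qed
  finally have "ennreal (\<theta> powr (- (q / p))) * lorentz_int M p q F
      = ennreal (\<theta> powr (- (q / p)) * \<theta> powr (q / p)) * D"
    by (subst ennreal_mult) (auto simp: mult.assoc)
  then show ?thesis
    using \<theta> by (simp add: D_def powr_minus)
qed

text \<open>Splitting u into two halves in \<open>rearr_add\<close> gives the constants: 2^q from
  the power of a sum, 2^(q/p) from the dilation by 1/2.\<close>

lemma lorentz_int_add_le: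
  assumes [measurable]: "F \<in> borel_measurable M" "G \<in> borel_measurable M"
    and "0 < p" "0 \<le> q"
  shows "lorentz_int M p q (\<lambda>x. F x + G x)
    \<le> ennreal (2 powr q * 2 powr (q / p)) * (lorentz_int M p q F + lorentz_int M p q G)"
proof -
  let ?k = "\<lambda>F u. ennpowr (ennreal (u powr (1 / p)) * rearr M F ((1/2) * u)) q / ennreal u * indicator {0<..} u"
  have "lorentz_int M p q (\<lambda>x. F x + G x) \<le> (\<integral>\<^sup>+u. ennreal (2 powr q) * (?k F u + ?k G u) \<partial>lborel)"
    unfolding lorentz_int_def
  proof (intro nn_integral_mono)
    fix u :: real
    show "ennpowr (ennreal (u powr (1 / p)) * rearr M (\<lambda>x. F x + G x) u) q / ennreal u * indicator {0<..} u
      \<le> ennreal (2 powr q) * (?k F u + ?k G u)"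
    proof (cases "0 < u")
      case True
      have "rearr M (\<lambda>x. F x + G x) u \<le> rearr M F ((1/2) * u) + rearr M G ((1/2) * u)"
        using rearr_add [of F M G "(1/2) * u" "(1/2) * u"] True by simp
      then have "ennpowr (ennreal (u powr (1 / p)) * rearr M (\<lambda>x. F x + G x) u) q
          \<le> ennpowr (ennreal (u powr (1 / p)) * rearr M F ((1/2) * u) + ennreal (u powr (1 / p)) * rearr M G ((1/2) * u)) q"
        using assms by (intro ennpowr_mono) (auto simp: distrib_left [symmetric] intro: mult_left_mono)
      also have "\<dots> \<le> ennreal (2 powr q) * (ennpowr (ennreal (u powr (1 / p)) * rearr M F ((1/2) * u)) q
           + ennpowr (ennreal (u powr (1 / p)) * rearr M G ((1/2) * u)) q)"
        using assms by (intro ennpowr_add_le) auto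
      finally have "ennpowr (ennreal (u powr (1 / p)) * rearr M (\<lambda>x. F x + G x) u) q / ennreal u
        \<le> ennreal (2 powr q) * (ennpowr (ennreal (u powr (1 / p)) * rearr M F ((1/2) * u)) q
           + ennpowr (ennreal (u powr (1 / p)) * rearr M G ((1/2) * u)) q) / ennreal u"
        by (rule divide_right_mono_ennreal)
      then show ?thesis
        using True by (simp add: ennreal_divide_eq_mult distrib_right mult.assoc)
    qed simp
  qed
  also have "\<dots> = ennreal (2 powr q) * ((\<integral>\<^sup>+u. ?k F u \<partial>lborel) + (\<integral>\<^sup>+u. ?k G u \<partial>lborel))"
    by (simp add: nn_integral_cmult nn_integral_add)
  also have "\<dots> = ennreal (2 powr q) * (ennreal (2 powr (q / p)) * lorentz_int M p q F + ennreal (2 powr (q / p)) * lorentz_int M p q G)"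
    using assms by (subst (1 2) lorentz_int_dilation) (auto simp: powr_minus powr_divide)
  also have "\<dots> = ennreal (2 powr q * 2 powr (q / p)) * (lorentz_int M p q F + lorentz_int M p q G)"
    by (subst ennreal_mult) (auto simp: distrib_left mult.assoc)
  finally show ?thesis .
qed

lemma lorentz_int_cmult_le:
  assumes [measurable]: "F \<in> borel_measurable M" and "0 \<le> q" 
  shows "lorentz_int M p q (\<lambda>x. c * F x) \<le> ennpowr c q * lorentz_int M p q F"
proof -
  have "lorentz_int M p q (\<lambda>x. c * F x) \<le>
    (\<integral>\<^sup>+ u. ennpowr c q * (ennpowr (ennreal (u powr (1 / p)) * rearr M F u) q / ennreal u * indicator {0<..} u) \<partial>lborel)"
    unfolding lorentz_int_def
  proof (intro nn_integral_mono)
    fix u :: real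
    have "ennpowr (ennreal (u powr (1 / p)) * rearr M (\<lambda>x. c * F x) u) q
        \<le> ennpowr (c * (ennreal (u powr (1 / p)) * rearr M F u)) q"
      using assms by (subst mult.left_commute) (intro ennpowr_mono mult_left_mono rearr_cmult_le, auto)
    then have "ennpowr (ennreal (u powr (1 / p)) * rearr M (\<lambda>x. c * F x) u) q / ennreal u
        \<le> ennpowr c q * ennpowr (ennreal (u powr (1 / p)) * rearr M F u) q / ennreal u"
      by (intro divide_right_mono_ennreal) (simp add: ennpowr_mult [symmetric])
    then show "ennpowr (ennreal (u powr (1 / p)) * rearr M (\<lambda>x. c * F x) u) q / ennreal u * indicator {0<..} u
        \<le> ennpowr c q * (ennpowr (ennreal (u powr (1 / p)) * rearr M F u) q / ennreal u * indicator {0<..} u)"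
      by (auto split: split_indicator simp: ennreal_times_divide)
  qed
  also have "\<dots> = ennpowr c q * lorentz_int M p q F"
    unfolding lorentz_int_def by (rule nn_integral_cmult) simp
  finally show ?thesis .
qed

section \<open>Comparison of the Lorentz functional with weak norms, integrals and
  indicators\<close>

lemma nn_integral_geometric:
  assumes "0 \<le> c" "c < 1"
  shows "(\<integral>\<^sup>+k. ennreal (c ^ k) \<partial>count_space UNIV) = ennreal (1 / (1 - c))"
  using assms geometric_sums [of c]
  by (subst nn_integral_count_space_nat) (intro suminf_ennreal_eq, auto)

text \<open>The embedding of L^{p,q} into weak L^p: since F* is decreasing, the integral over (u/2,
  u] alone controls F*(u).\<close>

lemma rearr_le_lorentz_int:
  assumes "0 < u" "0 < p" "0 < q"
  shows "rearr M F u
    \<le> ennreal (2 powr (1 / p + 1 / q) * u powr (- (1 / p))) * ennpowr (lorentz_int M p q F) (1 / q)"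
proof -
  \<comment> \<open>A lower bound for the numerator of the integrand on (u/2, u]. The length u/2
    against the denominator, at most u, leaves X/2, whence the constant 2^(1/q); the u/2 inside the
    power gives 2^(1/p).\<close>
  define X where "X = ennpowr (ennreal ((u / 2) powr (1 / p)) * rearr M F u) q"
  have "(\<integral>\<^sup>+v. (X / ennreal u) * indicator {u/2<..u} v \<partial>lborel) \<le> lorentz_int M p q F"
    unfolding lorentz_int_def
  proof (intro nn_integral_mono)
    fix v :: real
    show "X / ennreal u * indicator {u / 2<..u} v
      \<le> ennpowr (ennreal (v powr (1 / p)) * rearr M F v) q / ennreal v * indicator {0<..} v"
    proof (cases "v \<in> {u/2<..u}")
      case True
      then have "X \<le> ennpowr (ennreal (v powr (1 / p)) * rearr M F v) q"
        unfolding X_def using assms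
        by (intro ennpowr_mono mult_mono rearr_antimono ennreal_leI powr_mono2) auto
      then have "X / ennreal u \<le> ennpowr (ennreal (v powr (1 / p)) * rearr M F v) q / ennreal v"
        unfolding divide_ennreal_def using True assms
        by (intro mult_mono) (auto simp: inverse_ennreal intro!: ennreal_leI)
      then show ?thesis using True assms by simp
    qed simp
  qed
  then have "X / ennreal u * ennreal (u / 2) \<le> lorentz_int M p q F"
    using assms by (simp add: nn_integral_cmult_indicator)
  moreover have "X / ennreal u * ennreal (u / 2) = X * ennreal (1 / 2)"
    using assms by (simp add: ennreal_divide_eq_mult mult.assoc ennreal_mult [symmetric])
  ultimately have "X * ennreal (1/2) * ennreal 2 \<le> lorentz_int M p q F * ennreal 2"
    by (metis mult_right_mono zero_le)
  moreover have "X * ennreal (1/2) * ennreal 2 = X"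
    by (simp add: mult.assoc ennreal_mult [symmetric] del: ennreal_numeral ennreal_half)
  ultimately have "X \<le> lorentz_int M p q F * ennreal 2" by simp
  then have "ennreal ((u / 2) powr (1 / p)) * rearr M F u \<le> ennpowr (lorentz_int M p q F * ennreal 2) (1 / q)"
    using assms unfolding X_def by (intro ennpowr_root_le) auto
  then have "ennreal ((u / 2) powr (- (1 / p))) * (ennreal ((u / 2) powr (1 / p)) * rearr M F u)
      \<le> ennreal ((u / 2) powr (- (1 / p))) * (ennreal (2 powr (1 / q)) * ennpowr (lorentz_int M p q F) (1 / q))"
    by (intro mult_left_mono) (auto simp: ennpowr_mult ennpowr_ennreal mult.commute simp del: ennreal_numeral)
  moreover have "ennreal ((u / 2) powr (- (1 / p))) * (ennreal ((u / 2) powr (1 / p)) * rearr M F u) = rearr M F u"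
    using assms by (simp add: mult.assoc [symmetric] ennreal_mult [symmetric] powr_add [symmetric])
  moreover have "ennreal ((u / 2) powr (- (1 / p))) * (ennreal (2 powr (1 / q)) * ennpowr (lorentz_int M p q F) (1 / q))
     = ennreal (2 powr (1 / p + 1 / q) * u powr (- (1 / p))) * ennpowr (lorentz_int M p q F) (1 / q)"
  proof -
    have "(u / 2) powr (- (1 / p)) * 2 powr (1 / q) = 2 powr (1 / p + 1 / q) * u powr (- (1 / p))"
      using assms by (simp add: powr_add powr_divide powr_minus inverse_eq_divide)
    then show ?thesis by (simp add: mult.assoc [symmetric] ennreal_mult [symmetric])
  qed
  ultimately show ?thesis by simp
qed

text \<open>A substitute for Hoelder's inequality that avoids duality: in the layer decomposition of
  \<open>F\<close> restricted to \<open>A\<close>, the weak bound turns the terms into a geometric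
  series with ratio 2^{-(1 - 1/p)}, less than 1 because p > 1.\<close>

lemma nn_integral_le_lorentz_int:
  assumes p: "1 < p" and q: "0 < q"
  obtains C where "0 < C"
    "\<And>(F :: 'a \<Rightarrow> ennreal) A a. F \<in> borel_measurable M \<Longrightarrow> A \<in> sets M \<Longrightarrow> 0 < a \<Longrightarrow> emeasure M A \<le> ennreal a \<Longrightarrow>
      (\<integral>\<^sup>+x. F x * indicator A x \<partial>M)
        \<le> ennreal (C * a powr (1 - 1 / p)) * ennpowr (lorentz_int M p q F) (1 / q)"
proof -
  define B where "B = 2 powr (1 / p + 1 / q)"
  define c where "c = (1/2::real) powr (1 - 1 / p)"
  define C where "C = B * 2 powr (1 / p) * (1 / (1 - c))"
  have c: "0 < c" "c < 1"
    using p powr_less_mono2 [of "1 - 1 / p" "1/2" 1] by (auto simp: c_def)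
  have B: "0 < B" by (simp add: B_def)
  show thesis
  proof (rule that)
    show "0 < C" using c B by (simp add: C_def)
    fix F :: "'a \<Rightarrow> ennreal" and A a
    assume [measurable]: "F \<in> borel_measurable M" "A \<in> sets M" and a: "0 < a" "emeasure M A \<le> ennreal a"
    let ?G = "\<lambda>x. F x * indicator A x"
    let ?L = "ennpowr (lorentz_int M p q F) (1 / q)"
    \<comment> \<open>The support of \<open>?G\<close> has measure at most \<open>a\<close>, so the
      truncation at level \<open>rearr M ?G a\<close> discards nothing.\<close>
    have "rearr M ?G a \<le> 0"
    proof (rule rearr_leI)
      have "emeasure M {x \<in> space M. 0 < F x * indicator A x} \<le> emeasure M A"
        by (intro emeasure_mono) (auto split: split_indicator_asm)
      then show "emeasure M {x \<in> space M. 0 < F x * indicator A x} \<le> ennreal a"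
        using a by simp
    qed simp
    then have "(\<integral>\<^sup>+x. ?G x \<partial>M) = (\<integral>\<^sup>+x. ?G x * indicator {x \<in> space M. rearr M ?G a < ?G x} x \<partial>M)"
      by (intro nn_integral_cong) (auto split: split_indicator simp: zero_less_iff_neq_zero)
    also have "\<dots> \<le> (\<integral>\<^sup>+k. ennreal (a * (1/2) ^ k) * rearr M ?G (a * (1/2) ^ Suc k) \<partial>count_space UNIV)"
      by (rule nn_integral_gt_rearr_le) (use a in auto)
    also have "\<dots> \<le> (\<integral>\<^sup>+k. ennreal (B * 2 powr (1 / p) * a powr (1 - 1 / p)) * ?L * ennreal (c ^ k) \<partial>count_space UNIV)"
    proof (intro nn_integral_mono)
      fix k
      have "rearr M ?G (a * (1/2) ^ Suc k) \<le> rearr M F (a * (1/2) ^ Suc k)"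
        by (intro rearr_mono) (auto split: split_indicator)
      also have "\<dots> \<le> ennreal (B * (a * (1/2) ^ Suc k) powr (- (1 / p))) * ?L"
        unfolding B_def using a p q by (intro rearr_le_lorentz_int) auto
      finally have "ennreal (a * (1/2) ^ k) * rearr M ?G (a * (1/2) ^ Suc k)
          \<le> ennreal (a * (1/2) ^ k) * (ennreal (B * (a * (1/2) ^ Suc k) powr (- (1 / p))) * ?L)"
        by (rule mult_left_mono) simp
      also have "\<dots> = ennreal (a * (1/2) ^ k * (B * (a * (1/2) ^ Suc k) powr (- (1 / p)))) * ?L"
        using a B by (subst ennreal_mult) (auto simp: mult.assoc)
      \<comment> \<open>The measure 2^{-k} times the height 2^{k/p} is \<open>c ^ k\<close>; the
        shift from k to Suc k accounts for the extra 2^(1/p).\<close>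
      also have "a * (1/2) ^ k * (B * (a * (1/2) ^ Suc k) powr (- (1 / p)))
          = B * 2 powr (1 / p) * a powr (1 - 1 / p) * c ^ k"
      proof -
        define h where "h = (1/2::real) ^ k"
        have h: "0 < h" by (simp add: h_def)
        have "c ^ k = h powr (1 - 1 / p)"
          unfolding c_def h_def by (simp add: powr_realpow [symmetric] powr_powr mult.commute)
        moreover have "(a * (1/2) ^ Suc k) powr (- (1 / p)) = a powr (- (1 / p)) * 2 powr (1 / p) * h powr (- (1 / p))"
          using a h by (simp add: h_def powr_mult powr_divide powr_minus inverse_eq_divide)
        moreover have "a * a powr (- (1 / p)) = a powr (1 - 1 / p)" "h * h powr (- (1 / p)) = h powr (1 - 1 / p)"
          using a h by (simp_all add: powr_diff powr_minus inverse_eq_divide)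
        moreover have "a * h * (B * (a powr (- (1 / p)) * 2 powr (1 / p) * h powr (- (1 / p))))
            = B * 2 powr (1 / p) * (a * a powr (- (1 / p))) * (h * h powr (- (1 / p)))"
          by (simp only: mult_ac)
        ultimately show ?thesis
          unfolding h_def [symmetric] by (simp only:)
      qed
      finally show "ennreal (a * (1/2) ^ k) * rearr M ?G (a * (1/2) ^ Suc k)
          \<le> ennreal (B * 2 powr (1 / p) * a powr (1 - 1 / p)) * ?L * ennreal (c ^ k)"
        using a B c by (subst (asm) ennreal_mult) (auto simp: mult_ac)
    qed
    also have "\<dots> = ennreal (B * 2 powr (1 / p) * a powr (1 - 1 / p)) * ?L * ennreal (1 / (1 - c))"
      using c by (subst nn_integral_cmult) (auto simp: nn_integral_geometric)
    also have "\<dots> = ennreal (B * 2 powr (1 / p) * a powr (1 - 1 / p)) * ennreal (1 / (1 - c)) * ?L"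
      by (simp only: mult_ac)
    also have "ennreal (B * 2 powr (1 / p) * a powr (1 - 1 / p)) * ennreal (1 / (1 - c)) = ennreal (C * a powr (1 - 1 / p))"
      using c B by (subst ennreal_mult [symmetric]) (auto simp: C_def mult_ac)
    finally show "(\<integral>\<^sup>+x. ?G x \<partial>M) \<le> ennreal (C * a powr (1 - 1 / p)) * ?L" .
  qed
qed

text \<open>The rearrangement is at most \<open>c\<close> and vanishes from \<open>a\<close> on, so
  the bound is c^q times the integral of u^(q/p - 1) over [0, a].\<close>

lemma lorentz_int_le_indicator:
  assumes [measurable]: "F \<in> borel_measurable M" "A \<in> sets M"
    and F: "\<And>x. x \<in> space M \<Longrightarrow> F x \<le> c * indicator A x"
    and a: "0 < a" "emeasure M A \<le> ennreal a" and pq: "0 < p" "0 < q"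
  shows "lorentz_int M p q F \<le> ennpowr c q * ennreal (p / q * a powr (q / p))"
proof -
  have c: "rearr M F u \<le> c" if "0 < u" for u
  proof (rule rearr_leI)
    have "{x \<in> space M. c < F x} = {}"
      using F by (force split: split_indicator_asm simp: not_less [symmetric])
    then show "emeasure M {x \<in> space M. c < F x} \<le> ennreal u" by (simp only: emeasure_empty zero_le)
  qed simp
  have 0: "rearr M F u = 0" if "a \<le> u" for u
  proof -
    have "rearr M F u \<le> 0"
    proof (rule rearr_leI)
      have "emeasure M {x \<in> space M. 0 < F x} \<le> emeasure M A"
        using F by (intro emeasure_mono) (force split: split_indicator_asm)+
      also have "\<dots> \<le> ennreal u" using a that by (auto intro: order_trans ennreal_leI)
      finally show "emeasure M {x \<in> space M. 0 < F x} \<le> ennreal u" .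
    qed simp
    then show ?thesis by simp
  qed
  have "lorentz_int M p q F \<le> (\<integral>\<^sup>+u. ennpowr c q * (ennreal (u powr (q / p - 1)) * indicator {0..a} u) \<partial>lborel)"
    unfolding lorentz_int_def
  proof (intro nn_integral_mono)
    fix u :: real
    show "ennpowr (ennreal (u powr (1 / p)) * rearr M F u) q / ennreal u * indicator {0<..} u
      \<le> ennpowr c q * (ennreal (u powr (q / p - 1)) * indicator {0..a} u)"
    proof (cases "0 < u \<and> u < a")
      case True
      have "ennpowr (ennreal (u powr (1 / p)) * rearr M F u) q \<le> ennpowr (ennreal (u powr (1 / p)) * c) q"
        using c True pq by (intro ennpowr_mono mult_left_mono) auto
      also have "\<dots> = ennreal (u powr (q / p)) * ennpowr c q"
        using pq by (simp add: ennpowr_mult ennpowr_ennreal powr_powr)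
      finally have "ennpowr (ennreal (u powr (1 / p)) * rearr M F u) q * ennreal (1 / u) \<le> ennreal (u powr (q / p)) * ennpowr c q * ennreal (1 / u)"
        by (intro mult_right_mono) auto
      also have "\<dots> = ennpowr c q * (ennreal (u powr (q / p)) * ennreal (1 / u))"
        by (simp only: mult_ac)
      also have "ennreal (u powr (q / p)) * ennreal (1 / u) = ennreal (u powr (q / p - 1))"
        using True by (simp add: ennreal_mult [symmetric] powr_diff)
      finally show ?thesis using True by (simp add: ennreal_divide_eq_mult)
    next
      case False
      then show ?thesis using 0 [of u] by (auto split: split_indicator)
    qed
  qed
  also have "\<dots> = ennpowr c q * (\<integral>\<^sup>+u. ennreal (u powr (q / p - 1)) * indicator {0..a} u \<partial>lborel)"
    by (rule nn_integral_cmult) simp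
  also have "(\<integral>\<^sup>+u. ennreal (u powr (q / p - 1)) * indicator {0..a} u \<partial>lborel) = ennreal (a powr (q / p - 1 + 1) / (q / p - 1 + 1))"
    using a pq by (intro nn_integral_has_integral_lebesgue' has_integral_powr_from_0) auto
  finally show ?thesis using pq by (simp add: mult.commute)
qed

section \<open>The maximal function on Lorentz spaces\<close>

text \<open>The same operator on [0, \<infinity>]-valued functions, so that it applies to
  truncations and scaled blocks without passing through complex values.\<close>

definition maximal :: "(real ^ 'n \<Rightarrow> ennreal) \<Rightarrow> real ^ 'n \<Rightarrow> ennreal" where
  "maximal F x =
     (SUP (c, \<rho>) \<in> {(c, \<rho>). 0 < \<rho> \<and> x \<in> ball c \<rho>}.
        (\<integral>\<^sup>+ y \<in> ball c \<rho>. F y \<partial>lebesgue) / emeasure lebesgue (ball c \<rho>))"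

lemma HL_maximal_eq: "HL_maximal f = maximal (\<lambda>y. ennreal (norm (f y)))"
  by (simp add: HL_maximal_def maximal_def fun_eq_iff)

definition ball_vol :: "'n::finite itself \<Rightarrow> real" where
  "ball_vol _ = unit_ball_vol (real CARD('n))"

lemma ball_vol_pos: "0 < ball_vol TYPE('n::finite)"
  by (simp add: ball_vol_def)

lemma emeasure_lborel_ball:
  "0 \<le> \<rho> \<Longrightarrow> emeasure lborel (ball (c :: real ^ 'n) \<rho>) = ennreal (ball_vol TYPE('n) * \<rho> ^ CARD('n))"
  using emeasure_ball [of \<rho> c] by (simp add: ball_vol_def)

lemma emeasure_lebesgue_ball_pos:
  "0 < \<rho> \<Longrightarrow> 0 < emeasure lebesgue (ball (c :: real ^ 'n) \<rho>)"
  using ball_vol_pos [where 'n = 'n] by (simp add: emeasure_lborel_ball)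

lemma emeasure_lebesgue_ball_finite:
  "emeasure lebesgue (ball (c :: real ^ 'n) \<rho>) < top"
  using emeasure_bounded_finite [of "ball c \<rho>"] by simp

lemma maximal_ge:
  "0 < \<rho> \<Longrightarrow> x \<in> ball c \<rho> \<Longrightarrow>
    (\<integral>\<^sup>+ y \<in> ball c \<rho>. F y \<partial>lebesgue) / emeasure lebesgue (ball c \<rho>) \<le> maximal F x"
  unfolding maximal_def by (rule SUP_upper2 [of "(c, \<rho>)"]) auto

lemma maximal_leI:
  assumes "\<And>c \<rho>. 0 < \<rho> \<Longrightarrow> x \<in> ball c \<rho> \<Longrightarrow>
    (\<integral>\<^sup>+ y \<in> ball c \<rho>. F y \<partial>lebesgue) / emeasure lebesgue (ball c \<rho>) \<le> b"
  shows "maximal F x \<le> b"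
  unfolding maximal_def using assms by (intro SUP_least) auto

lemma less_maximal_iff:
  "s < maximal F x \<longleftrightarrow> (\<exists>c \<rho>. 0 < \<rho> \<and> x \<in> ball c \<rho> \<and>
    s < (\<integral>\<^sup>+ y \<in> ball c \<rho>. F y \<partial>lebesgue) / emeasure lebesgue (ball c \<rho>))"
  unfolding maximal_def less_SUP_iff by auto

text \<open>Because the operator is uncentred, a ball whose average exceeds \<open>s\<close> lies
  entirely in the superlevel set, which is thus a union of balls.\<close>

lemma open_less_maximal: "open {x. s < maximal F x}"
proof -
  have "{x. s < maximal F x} = (\<Union>(c, \<rho>) \<in> {(c, \<rho>). 0 < \<rho> \<and>
      s < (\<integral>\<^sup>+ y \<in> ball c \<rho>. F y \<partial>lebesgue) / emeasure lebesgue (ball c \<rho>)}. ball c \<rho>)"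
    unfolding less_maximal_iff by blast
  then show ?thesis by (auto intro!: open_UN)
qed

lemma borel_measurable_maximal: "maximal F \<in> borel_measurable borel"
  by (rule borel_measurableI_greater) (simp add: open_less_maximal)

lemma measurable_maximal [measurable]: "maximal F \<in> borel_measurable lebesgue"
  by (rule measurable_completion) (simp add: borel_measurable_maximal)

section \<open>Weak type (1,1) and its consequence for rearrangements\<close>

lemma maximal_add_const_le:
  fixes F G :: "real ^ 'n \<Rightarrow> ennreal"
  assumes [measurable]: "G \<in> borel_measurable lebesgue" and FG: "\<And>x. F x \<le> G x + a"
  shows "maximal F x \<le> maximal G x + a"
proof (rule maximal_leI)
  fix c :: "real ^ 'n" and \<rho> :: real assume \<rho>: "0 < \<rho>" "x \<in> ball c \<rho>"
  have [measurable]: "ball c \<rho> \<in> sets lebesgue" by simp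
  have pos: "emeasure lebesgue (ball c \<rho>) \<noteq> 0" "emeasure lebesgue (ball c \<rho>) \<noteq> top"
    using emeasure_lebesgue_ball_pos [of \<rho> c] emeasure_lebesgue_ball_finite [of c \<rho>] \<rho> by auto
  have "(\<integral>\<^sup>+ y \<in> ball c \<rho>. F y \<partial>lebesgue) \<le> (\<integral>\<^sup>+ y. G y * indicator (ball c \<rho>) y + a * indicator (ball c \<rho>) y \<partial>lebesgue)"
    using FG by (intro nn_integral_mono) (auto split: split_indicator)
  also have "\<dots> = (\<integral>\<^sup>+ y \<in> ball c \<rho>. G y \<partial>lebesgue) + a * emeasure lebesgue (ball c \<rho>)"
    by (subst nn_integral_add) (auto simp: nn_integral_cmult_indicator simp del: emeasure_completion)
  finally have "(\<integral>\<^sup>+ y \<in> ball c \<rho>. F y \<partial>lebesgue) / emeasure lebesgue (ball c \<rho>)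
      \<le> ((\<integral>\<^sup>+ y \<in> ball c \<rho>. G y \<partial>lebesgue) + a * emeasure lebesgue (ball c \<rho>)) / emeasure lebesgue (ball c \<rho>)"
    by (rule divide_right_mono_ennreal)
  also have "\<dots> = (\<integral>\<^sup>+ y \<in> ball c \<rho>. G y \<partial>lebesgue) / emeasure lebesgue (ball c \<rho>) + a"
    using pos by (simp add: add_divide_distrib_ennreal ennreal_mult_divide_eq)
  also have "\<dots> \<le> maximal G x + a"
    using \<rho> by (intro add_right_mono maximal_ge)
  finally show "(\<integral>\<^sup>+ y \<in> ball c \<rho>. F y \<partial>lebesgue) / emeasure lebesgue (ball c \<rho>) \<le> maximal G x + a" .
qed

text \<open>The factor 5^n is the volume cost of the fivefold enlargement in the Vitali covering
  lemma. When \<open>F\<close> is not integrable the right side is infinite.\<close>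

lemma maximal_weak_type:
  fixes F :: "real ^ 'n \<Rightarrow> ennreal"
  assumes [measurable]: "F \<in> borel_measurable lebesgue" and s: "0 < s"
  shows "ennreal s * emeasure lebesgue {x. ennreal s < maximal F x}
    \<le> ennreal (5 ^ CARD('n)) * (\<integral>\<^sup>+x. F x \<partial>lebesgue)"
proof (cases "\<integral>\<^sup>+x. F x \<partial>lebesgue")
  case (real T)
  let ?n = "CARD('n)" and ?v = "ball_vol TYPE('n)"
  define K where "K = {(c :: real ^ 'n, \<rho>). 0 < \<rho> \<and>
    ennreal s < (\<integral>\<^sup>+ y \<in> ball c \<rho>. F y \<partial>lebesgue) / emeasure lebesgue (ball c \<rho>)}"
  have v: "0 < ?v" by (rule ball_vol_pos)
  have K: "ennreal (s * (?v * \<rho> ^ ?n)) \<le> (\<integral>\<^sup>+ y \<in> ball c \<rho>. F y \<partial>lebesgue)"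
    if "(c, \<rho>) \<in> K" for c \<rho>
  proof -
    have \<rho>: "0 < \<rho>" using that by (simp add: K_def)
    have "ennreal s * emeasure lebesgue (ball c \<rho>)
        \<le> (\<integral>\<^sup>+ y \<in> ball c \<rho>. F y \<partial>lebesgue) / emeasure lebesgue (ball c \<rho>) * emeasure lebesgue (ball c \<rho>)"
      using that by (intro mult_right_mono) (auto simp: K_def)
    also have "\<dots> = (\<integral>\<^sup>+ y \<in> ball c \<rho>. F y \<partial>lebesgue)"
      using emeasure_lebesgue_ball_pos [OF \<rho>, of c] emeasure_lebesgue_ball_finite [of c \<rho>]
      by (simp add: ennreal_divide_times ennreal_mult_divide_eq)
    finally show ?thesis using s v \<rho> by (simp add: emeasure_lborel_ball ennreal_mult)
  qed
  \<comment> \<open>The covering lemma needs bounded radii: a radius above 1 satisfies \<rho> \<le>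
    \<rho>^n, and the average condition bounds \<rho>^n by T / (s v).\<close>
  define B where "B = max 1 (T / (s * ?v))"
  have B: "\<rho> \<le> B" if "(c, \<rho>) \<in> K" for c \<rho>
  proof (cases "\<rho> \<le> 1")
    case False
    have "ennreal (s * (?v * \<rho> ^ ?n)) \<le> ennreal T"
      unfolding real(2) [symmetric]
      by (rule order_trans [OF K [OF that] nn_integral_mono]) (auto split: split_indicator)
    then have "s * (?v * \<rho> ^ ?n) \<le> T" using real by simp
    then have "\<rho> ^ ?n \<le> T / (s * ?v)" using s v by (simp add: field_simps)
    moreover have "\<rho> ^ 1 \<le> \<rho> ^ ?n" using False by (intro power_increasing) (auto simp: Suc_le_eq)
    ultimately show ?thesis by (simp add: B_def)
  qed (simp add: B_def)
  have "{x. ennreal s < maximal F x} \<subseteq> (\<Union>i\<in>K. ball (fst i) (snd i))"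
    by (fastforce simp: less_maximal_iff K_def)
  moreover have "\<And>i. i \<in> K \<Longrightarrow> 0 < snd i \<and> snd i \<le> B"
    using B by (auto simp: K_def)
  ultimately obtain C where C: "countable C" "C \<subseteq> K"
      "pairwise (\<lambda>i j. disjnt (ball (fst i) (snd i)) (ball (fst j) (snd j))) C"
      "{x. ennreal s < maximal F x} \<subseteq> (\<Union>i\<in>C. ball (fst i) (5 * snd i))"
    by (rule Vitali_covering_lemma_balls)
  have "emeasure lebesgue {x. ennreal s < maximal F x}
      \<le> (\<integral>\<^sup>+x. \<integral>\<^sup>+i. indicator (ball (fst i) (5 * snd i)) x \<partial>count_space C \<partial>lebesgue)"
  proof (subst nn_integral_indicator [symmetric])
    have "{x \<in> space lebesgue. ennreal s < maximal F x} \<in> sets lebesgue" by measurable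
    then show "{x. ennreal s < maximal F x} \<in> sets lebesgue" by simp
    show "(\<integral>\<^sup>+x. indicator {x. ennreal s < maximal F x} x \<partial>lebesgue)
      \<le> (\<integral>\<^sup>+x. \<integral>\<^sup>+i. indicator (ball (fst i) (5 * snd i)) x \<partial>count_space C \<partial>lebesgue)"
    proof (intro nn_integral_mono)
      fix x
      show "indicator {x. ennreal s < maximal F x} x \<le> (\<integral>\<^sup>+i. indicator (ball (fst i) (5 * snd i)) x \<partial>count_space C)"
      proof (cases "ennreal s < maximal F x")
        case True
        then obtain i where i: "i \<in> C" "x \<in> ball (fst i) (5 * snd i)" using C(4) by blast
        then have "indicator (ball (fst i) (5 * snd i)) x \<le> (\<integral>\<^sup>+i. (indicator (ball (fst i) (5 * snd i)) x :: ennreal) \<partial>count_space C)"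
          by (intro nn_integral_ge_point)
        then show ?thesis using True i by simp
      qed simp
    qed
  qed
  also have "\<dots> = (\<integral>\<^sup>+i. emeasure lebesgue (ball (fst i) (5 * snd i)) \<partial>count_space C)"
  proof (subst nn_integral_count_space_nn_integral)
    show "(\<lambda>x. indicator (ball (fst i) (5 * snd i)) x) \<in> borel_measurable lebesgue" for i :: "(real ^ 'n) \<times> real"
      by (intro borel_measurable_indicator) simp
  qed (use C(1) in auto)
  finally have "ennreal s * emeasure lebesgue {x. ennreal s < maximal F x}
      \<le> ennreal s * (\<integral>\<^sup>+i. emeasure lebesgue (ball (fst i) (5 * snd i)) \<partial>count_space C)"
    by (rule mult_left_mono) simp
  also have "\<dots> = (\<integral>\<^sup>+i. ennreal s * emeasure lebesgue (ball (fst i) (5 * snd i)) \<partial>count_space C)"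
    by (rule nn_integral_cmult [symmetric]) simp
  also have "\<dots> \<le> (\<integral>\<^sup>+i. ennreal (5 ^ ?n) * (\<integral>\<^sup>+ y \<in> ball (fst i) (snd i). F y \<partial>lebesgue) \<partial>count_space C)"
  proof (intro nn_integral_mono)
    fix i assume "i \<in> space (count_space C)"
    then have i: "(fst i, snd i) \<in> K" using C(2) by auto
    then have "0 < snd i" by (simp add: K_def split_beta)
    then have "ennreal s * emeasure lebesgue (ball (fst i) (5 * snd i)) = ennreal (5 ^ ?n) * ennreal (s * (?v * snd i ^ ?n))"
    proof -
      have "s * (?v * (5 * snd i) ^ ?n) = 5 ^ ?n * (s * (?v * snd i ^ ?n))"
        by (simp add: power_mult_distrib)
      then show ?thesis
        using s v \<open>0 < snd i\<close> by (simp add: emeasure_lborel_ball flip: ennreal_mult)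
    qed
    also have "\<dots> \<le> ennreal (5 ^ ?n) * (\<integral>\<^sup>+ y \<in> ball (fst i) (snd i). F y \<partial>lebesgue)"
      using K [OF i] by (rule mult_left_mono) simp
    finally show "ennreal s * emeasure lebesgue (ball (fst i) (5 * snd i))
      \<le> ennreal (5 ^ ?n) * (\<integral>\<^sup>+ y \<in> ball (fst i) (snd i). F y \<partial>lebesgue)" .
  qed
  also have "\<dots> = ennreal (5 ^ ?n) * (\<integral>\<^sup>+i. (\<integral>\<^sup>+ y \<in> ball (fst i) (snd i). F y \<partial>lebesgue) \<partial>count_space C)"
    by (rule nn_integral_cmult) simp
  finally have le: "ennreal s * emeasure lebesgue {x. ennreal s < maximal F x}
      \<le> ennreal (5 ^ ?n) * (\<integral>\<^sup>+i. (\<integral>\<^sup>+ y \<in> ball (fst i) (snd i). F y \<partial>lebesgue) \<partial>count_space C)" .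
  \<comment> \<open>Disjointness of the selected balls enters here: their integrals are masses for
    the measure with density \<open>F\<close> and add up to at most the total mass.\<close>
  have "(\<integral>\<^sup>+i. (\<integral>\<^sup>+ y \<in> ball (fst i) (snd i). F y \<partial>lebesgue) \<partial>count_space C)
      = (\<integral>\<^sup>+i. emeasure (density lebesgue F) (ball (fst i) (snd i)) \<partial>count_space C)"
    by (intro nn_integral_cong) (simp add: emeasure_density)
  also have "\<dots> = emeasure (density lebesgue F) (\<Union>i\<in>C. ball (fst i) (snd i))"
  proof (rule emeasure_UN_countable [symmetric])
    show "disjoint_family_on (\<lambda>i. ball (fst i) (snd i)) C"
      using C(3) by (simp add: disjoint_family_on_def pairwise_def disjnt_def)
  qed (use C(1) in auto)
  also have "\<dots> \<le> emeasure (density lebesgue F) (space (density lebesgue F))"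
    by (rule emeasure_space)
  also have "\<dots> = (\<integral>\<^sup>+x. F x \<partial>lebesgue)"
    by (subst emeasure_density) auto
  finally have "(\<integral>\<^sup>+i. (\<integral>\<^sup>+ y \<in> ball (fst i) (snd i). F y \<partial>lebesgue) \<partial>count_space C)
      \<le> (\<integral>\<^sup>+x. F x \<partial>lebesgue)" .
  then show ?thesis
    by (rule order_trans [OF le mult_left_mono]) (rule zero_le)
next
  case top
  have "ennreal (5 ^ CARD('n)) * top = top"
    by (rule ennreal_top_mult_left) simp
  then show ?thesis
    unfolding top by (simp only: top_greatest)
qed

text \<open>\<open>F\<close> is at most its part \<open>G\<close> above F*(u) plus the constant
  F*(u). The constant passes through averages unchanged and gives the summand 1; weak type for
  \<open>G\<close> gives 5^n.\<close>

lemma rearr_maximal_le: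
  fixes F :: "real ^ 'n \<Rightarrow> ennreal"
  assumes [measurable]: "F \<in> borel_measurable lebesgue" and u: "0 < u"
  shows "rearr lebesgue (maximal F) u \<le> ennreal (5 ^ CARD('n) + 1) *
    (\<integral>\<^sup>+k. ennreal ((1/2) ^ k) * rearr lebesgue F (u * (1/2) ^ Suc k) \<partial>count_space UNIV)"
proof -
  define N where "N = (5::real) ^ CARD('n)"
  have N: "0 < N" unfolding N_def by (rule zero_less_power) simp
  define S where "S = (\<integral>\<^sup>+k. ennreal ((1/2) ^ k) * rearr lebesgue F (u * (1/2) ^ Suc k) \<partial>count_space UNIV)"
  define a where "a = rearr lebesgue F u"
  define G where "G x = F x * indicator {x. a < F x} x" for x
  have [measurable]: "G \<in> borel_measurable lebesgue" unfolding G_def by measurable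
  have aS: "a \<le> S"
  proof -
    have "a \<le> rearr lebesgue F (u * (1/2) ^ Suc 0)"
      unfolding a_def using u by (intro rearr_antimono) auto
    also have "\<dots> = ennreal ((1/2) ^ 0) * rearr lebesgue F (u * (1/2) ^ Suc 0)" by simp
    also have "\<dots> \<le> S" unfolding S_def by (rule nn_integral_ge_point [OF UNIV_I])
    finally show ?thesis .
  qed
  have le: "maximal F x \<le> maximal G x + a" for x
    by (rule maximal_add_const_le) (auto simp: G_def split: split_indicator)
  have "(\<integral>\<^sup>+x. G x \<partial>lebesgue) \<le> (\<integral>\<^sup>+k. ennreal (u * (1/2) ^ k) * rearr lebesgue F (u * (1/2) ^ Suc k) \<partial>count_space UNIV)"
    using nn_integral_gt_rearr_le [of F lebesgue u] u by (simp add: G_def a_def)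
  also have "\<dots> = (\<integral>\<^sup>+k. ennreal u * (ennreal ((1/2) ^ k) * rearr lebesgue F (u * (1/2) ^ Suc k)) \<partial>count_space UNIV)"
    using u by (simp add: ennreal_mult mult.assoc)
  also have "\<dots> = ennreal u * S"
    unfolding S_def by (rule nn_integral_cmult) simp
  finally have G: "(\<integral>\<^sup>+x. G x \<partial>lebesgue) \<le> ennreal u * S" .
  have "rearr lebesgue (maximal F) u \<le> ennreal N * S + a"
  proof (rule rearr_leI)
    have sub: "{x. ennreal N * S + a < maximal F x} \<subseteq> {x. ennreal N * S < maximal G x}"
    proof (intro Collect_mono impI)
      fix x assume "ennreal N * S + a < maximal F x"
      then have "ennreal N * S + a < maximal G x + a"
        using le [of x] by (rule less_le_trans)
      then show "ennreal N * S < maximal G x"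
        by (metis add_right_mono leD leI)
    qed
    have "emeasure lebesgue {x. ennreal N * S < maximal G x} \<le> ennreal u"
    proof (cases "ennreal N * S")
      case (real d)
      \<comment> \<open>The height d = N S is chosen to make weak type exact: the integral of
        \<open>G\<close> is at most u S, so N times it is d u, and d cancels.\<close>
      have T: "ennreal d * emeasure lebesgue {x. ennreal d < maximal G x} \<le> ennreal d * ennreal u" if "0 < d"
      proof -
        have "ennreal d * emeasure lebesgue {x. ennreal d < maximal G x} \<le> ennreal N * (\<integral>\<^sup>+x. G x \<partial>lebesgue)"
          unfolding N_def using that by (intro maximal_weak_type) auto
        also have "\<dots> \<le> ennreal N * (ennreal u * S)" by (intro mult_left_mono G) simp
        also have "\<dots> = (ennreal N * S) * ennreal u" by (simp only: mult_ac)
        also have "\<dots> = ennreal d * ennreal u" using real by simp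
        finally show ?thesis .
      qed
      show ?thesis
      proof (cases "d = 0")
        case True
        \<comment> \<open>At height 0 there is nothing to cancel; instead \<open>G\<close> has
          integral 0, so all its averages vanish.\<close>
        then have "S = 0" using real N by simp
        then have "(\<integral>\<^sup>+x. G x \<partial>lebesgue) = 0" using G by simp
        moreover have "(\<integral>\<^sup>+ y \<in> ball c \<rho>. G y \<partial>lebesgue) \<le> (\<integral>\<^sup>+x. G x \<partial>lebesgue)" for c \<rho>
          by (intro nn_integral_mono) (auto split: split_indicator)
        ultimately have "(\<integral>\<^sup>+ y \<in> ball c \<rho>. G y \<partial>lebesgue) = 0" for c \<rho>
          by simp
        then have "maximal G x \<le> 0" for x by (intro maximal_leI) simp
        then show ?thesis by simp
      next
        case False
        with T real show ?thesis by (simp add: ennreal_mult_le_mult_iff)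
      qed
    qed simp
    moreover have "{x \<in> space lebesgue. ennreal N * S < maximal G x} \<in> sets lebesgue"
      by measurable
    ultimately show "emeasure lebesgue {x \<in> space lebesgue. ennreal N * S + a < maximal F x} \<le> ennreal u"
      using emeasure_mono [OF sub, of lebesgue] by simp
  qed simp
  also have "\<dots> \<le> ennreal N * S + S" using aS by (rule add_left_mono)
  also have "\<dots> = ennreal (N + 1) * S"
  proof -
    have "ennreal (N + 1) = ennreal N + 1"
      using N by (subst ennreal_plus) auto
    then show ?thesis by (simp only: distrib_right mult_1_left)
  qed
  finally show ?thesis by (simp only: S_def N_def)
qed

text \<open>A discrete Hardy inequality. Writing 2^{-k} = c^k d^k reserves \<open>c ^ k\<close>,
  summable because p > 1, as Jensen weights, and leaves \<open>d ^ k\<close> to offset the dilation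
  of the k-th rearrangement.\<close>

lemma lorentz_int_maximal_le:
  assumes p: "1 < p" and q: "1 \<le> q"
  obtains C where "0 < C"
    "\<And>F :: real ^ 'n \<Rightarrow> ennreal. F \<in> borel_measurable lebesgue \<Longrightarrow>
      lorentz_int lebesgue p q (maximal F) \<le> ennreal C * lorentz_int lebesgue p q F"
proof -
  define A where "A = 5 ^ CARD('n) + (1::real)"
  define c where "c = (1/2::real) powr (1 - 1 / p)"
  define d where "d = (1/2::real) powr (1 / p)"
  define V where "V = 1 / (1 - c)"
  have c: "0 < c" "c < 1"
    using p powr_less_mono2 [of "1 - 1 / p" "1/2" 1] by (auto simp: c_def)
  have V: "0 < V" using c by (simp add: V_def)
  have A: "0 < A" by (simp add: A_def add_pos_pos)
  have d: "0 < d" by (simp add: d_def)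
  have cd: "c * d = 1/2" using p by (simp add: c_def d_def powr_add [symmetric])
  define C where "C = A powr q * V powr (q - 1) * 2 powr (q / p) * V"
  show thesis
  proof (rule that)
    show "0 < C" using A V by (simp add: C_def)
    fix F :: "real ^ 'n \<Rightarrow> ennreal"
    assume [measurable]: "F \<in> borel_measurable lebesgue"
    let ?I = "lorentz_int lebesgue p q F"
    define Y where "Y k u = ennpowr (ennreal (u powr (1 / p)) * rearr lebesgue F ((1/2) ^ Suc k * u)) q / ennreal u * indicator {0<..} u" for k and u :: real
    have [measurable]: "Y k \<in> borel_measurable borel" for k unfolding Y_def by measurable
    have Y: "(\<integral>\<^sup>+u. Y k u \<partial>lborel) = ennreal (((1/2) ^ Suc k) powr (- (q / p))) * ?I" for k
      unfolding Y_def using p q by (intro lorentz_int_dilation) auto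
    have "lorentz_int lebesgue p q (maximal F)
        \<le> (\<integral>\<^sup>+u. (\<integral>\<^sup>+k. ennreal (A powr q * V powr (q - 1)) * (ennreal (c ^ k * (d ^ k) powr q) * Y k u) \<partial>count_space UNIV) \<partial>lborel)"
      unfolding lorentz_int_def
    proof (intro nn_integral_mono)
      fix u :: real
      show "ennpowr (ennreal (u powr (1 / p)) * rearr lebesgue (maximal F) u) q / ennreal u * indicator {0<..} u
        \<le> (\<integral>\<^sup>+k. ennreal (A powr q * V powr (q - 1)) * (ennreal (c ^ k * (d ^ k) powr q) * Y k u) \<partial>count_space UNIV)"
      proof (cases "0 < u")
        case u: True
        define x where "x k = ennreal (u powr (1 / p)) * rearr lebesgue F ((1/2) ^ Suc k * u)" for k
        have "ennreal (u powr (1 / p)) * rearr lebesgue (maximal F) u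
            \<le> ennreal (u powr (1 / p)) * (ennreal A * (\<integral>\<^sup>+k. ennreal ((1/2) ^ k) * rearr lebesgue F (u * (1/2) ^ Suc k) \<partial>count_space UNIV))"
          unfolding A_def using u by (intro mult_left_mono rearr_maximal_le) auto
        also have "\<dots> = ennreal A * (\<integral>\<^sup>+k. ennreal (u powr (1 / p)) * (ennreal ((1/2) ^ k) * rearr lebesgue F (u * (1/2) ^ Suc k)) \<partial>count_space UNIV)"
          by (subst nn_integral_cmult) (auto simp: mult_ac)
        also have "(\<integral>\<^sup>+k. ennreal (u powr (1 / p)) * (ennreal ((1/2) ^ k) * rearr lebesgue F (u * (1/2) ^ Suc k)) \<partial>count_space UNIV)
            = (\<integral>\<^sup>+k. ennreal (c ^ k) * (ennreal (d ^ k) * x k) \<partial>count_space UNIV)"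
        proof (rule nn_integral_cong)
          fix k
          have "ennreal ((1/2) ^ k) = ennreal (c ^ k) * ennreal (d ^ k)"
            using c d by (simp add: ennreal_mult [symmetric] power_mult_distrib [symmetric] cd)
          then show "ennreal (u powr (1 / p)) * (ennreal ((1/2) ^ k) * rearr lebesgue F (u * (1/2) ^ Suc k))
              = ennreal (c ^ k) * (ennreal (d ^ k) * x k)"
            unfolding x_def by (simp only: mult_ac)
        qed
        finally have "ennpowr (ennreal (u powr (1 / p)) * rearr lebesgue (maximal F) u) q
            \<le> ennpowr (ennreal A * (\<integral>\<^sup>+k. ennreal (c ^ k) * (ennreal (d ^ k) * x k) \<partial>count_space UNIV)) q"
          using q by (intro ennpowr_mono) auto
        also have "\<dots> = ennreal (A powr q) * ennpowr (\<integral>\<^sup>+k. ennreal (c ^ k) * (ennreal (d ^ k) * x k) \<partial>count_space UNIV) q"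
          using A by (simp add: ennpowr_mult ennpowr_ennreal)
        also have "\<dots> \<le> ennreal (A powr q) * (ennreal (V powr (q - 1)) * (\<integral>\<^sup>+k. ennreal (c ^ k) * ennpowr (ennreal (d ^ k) * x k) q \<partial>count_space UNIV))"
          using q V c by (intro mult_left_mono nn_integral_Jensen_powr) (auto simp: nn_integral_geometric V_def)
        also have "\<dots> = (\<integral>\<^sup>+k. ennreal (A powr q * V powr (q - 1)) * (ennreal (c ^ k * (d ^ k) powr q) * ennpowr (x k) q) \<partial>count_space UNIV)"
        proof -
          have "ennreal (c ^ k) * ennpowr (ennreal (d ^ k) * x k) q = ennreal (c ^ k * (d ^ k) powr q) * ennpowr (x k) q" for k
            using c d by (simp add: ennpowr_mult ennpowr_ennreal ennreal_mult mult.assoc)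
          moreover have "ennreal (A powr q * V powr (q - 1)) = ennreal (A powr q) * ennreal (V powr (q - 1))"
            by (rule ennreal_mult) auto
          ultimately show ?thesis
            by (subst nn_integral_cmult) (simp_all add: mult.assoc)
        qed
        finally have "ennpowr (ennreal (u powr (1 / p)) * rearr lebesgue (maximal F) u) q / ennreal u
            \<le> (\<integral>\<^sup>+k. ennreal (A powr q * V powr (q - 1)) * (ennreal (c ^ k * (d ^ k) powr q) * ennpowr (x k) q) \<partial>count_space UNIV) / ennreal u"
          by (rule divide_right_mono_ennreal)
        also have "\<dots> = (\<integral>\<^sup>+k. ennreal (A powr q * V powr (q - 1)) * (ennreal (c ^ k * (d ^ k) powr q) * ennpowr (x k) q) / ennreal u \<partial>count_space UNIV)"
          by (rule nn_integral_divide [symmetric]) simp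
        finally show ?thesis
          using u by (simp add: Y_def x_def divide_ennreal_def mult.assoc)
      qed simp
    qed
    also have "\<dots> = (\<integral>\<^sup>+k. (\<integral>\<^sup>+u. ennreal (A powr q * V powr (q - 1)) * (ennreal (c ^ k * (d ^ k) powr q) * Y k u) \<partial>lborel) \<partial>count_space UNIV)"
      by (rule nn_integral_count_space_nn_integral) auto
    also have "\<dots> = (\<integral>\<^sup>+k. ennreal (A powr q * V powr (q - 1) * 2 powr (q / p)) * ?I * ennreal (c ^ k) \<partial>count_space UNIV)"
    proof (rule nn_integral_cong)
      fix k
      \<comment> \<open>The dilation loss 2^{(k+1) q/p} is cancelled by d^{k q} up to the factor of
        the index shift; only the geometric series in \<open>c\<close> remains.\<close>
      have "(d ^ k) powr q * ((1/2) ^ Suc k) powr (- (q / p)) = 2 powr (q / p)"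
      proof -
        have "(d ^ k) powr q = ((1/2) ^ k) powr (q / p)"
          by (simp add: d_def powr_realpow [symmetric] powr_powr mult_ac)
        moreover have "((1/2::real) ^ Suc k) powr (- (q / p)) = 2 powr (q / p) * inverse (((1/2) ^ k) powr (q / p))"
          by (simp add: powr_mult powr_minus powr_divide inverse_eq_divide)
        ultimately show ?thesis by simp
      qed
      then have e: "c ^ k * (d ^ k) powr q * ((1/2) ^ Suc k) powr (- (q / p)) = c ^ k * 2 powr (q / p)"
        by (simp add: mult.assoc)
      have "(\<integral>\<^sup>+u. ennreal (A powr q * V powr (q - 1)) * (ennreal (c ^ k * (d ^ k) powr q) * Y k u) \<partial>lborel)
        = ennreal (A powr q * V powr (q - 1)) * (ennreal (c ^ k * (d ^ k) powr q) * (ennreal (((1/2) ^ Suc k) powr (- (q / p))) * ?I))"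
        by (simp add: nn_integral_cmult Y del: power_Suc)
      also have "\<dots> = ennreal (A powr q * V powr (q - 1)) * (ennreal (c ^ k * (d ^ k) powr q * ((1/2) ^ Suc k) powr (- (q / p))) * ?I)"
        using c by (subst (2) ennreal_mult) (auto simp: mult.assoc)
      also have "\<dots> = ennreal (A powr q * V powr (q - 1)) * (ennreal (2 powr (q / p)) * ennreal (c ^ k) * ?I)"
        unfolding e using c by (simp add: ennreal_mult mult_ac)
      also have "\<dots> = ennreal (A powr q * V powr (q - 1) * 2 powr (q / p)) * ?I * ennreal (c ^ k)"
      proof -
        have m: "ennreal (A powr q * V powr (q - 1) * 2 powr (q / p)) = ennreal (A powr q * V powr (q - 1)) * ennreal (2 powr (q / p))"
          by (rule ennreal_mult) auto
        show ?thesis unfolding m by (simp only: mult_ac)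
      qed
      finally show "(\<integral>\<^sup>+u. ennreal (A powr q * V powr (q - 1)) * (ennreal (c ^ k * (d ^ k) powr q) * Y k u) \<partial>lborel)
        = ennreal (A powr q * V powr (q - 1) * 2 powr (q / p)) * ?I * ennreal (c ^ k)" .
    qed
    also have "\<dots> = ennreal (A powr q * V powr (q - 1) * 2 powr (q / p)) * ?I * ennreal V"
      using c by (subst nn_integral_cmult) (auto simp: nn_integral_geometric V_def)
    also have "\<dots> = ennreal (A powr q * V powr (q - 1) * 2 powr (q / p)) * ennreal V * ?I"
      by (simp only: mult_ac)
    also have "\<dots> = ennreal C * ?I"
      unfolding C_def using A V by (subst ennreal_mult [symmetric]) auto
    finally show "lorentz_int lebesgue p q (maximal F) \<le> ennreal C * ?I" .
  qed
qed

section \<open>Dyadic cubes\<close>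

text \<open>Reduces the geometry of dyadic cubes to floors, so that ancestors and adjacency become
  integer arithmetic.\<close>

lemma mem_dyadic_cube_iff:
  "x \<in> dyadic_cube (j, m) \<longleftrightarrow> (\<forall>i. \<lfloor>2 powr real_of_int j * x $ i\<rfloor> = m $ i)"
proof -
  have "2 powi (- j) * of_int k \<le> y \<and> y < 2 powi (- j) * (of_int k + 1)
      \<longleftrightarrow> \<lfloor>2 powr real_of_int j * y\<rfloor> = k" for y :: real and k
  proof -
    define c :: real where "c = 2 powr real_of_int j"
    have c: "0 < c" by (simp add: c_def)
    have *: "(2::real) powi (- j) = 1 / c"
      by (simp add: c_def powr_real_of_int' power_int_minus inverse_eq_divide)
    then show ?thesis
      unfolding * c_def [symmetric] using c by (simp add: floor_eq_iff field_simps)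
  qed
  then show ?thesis by (simp add: dyadic_cube_def)
qed

definition cube_at :: "int \<Rightarrow> real ^ 'n \<Rightarrow> int \<times> (int ^ 'n)" where
  "cube_at j x = (j, \<chi> i. \<lfloor>2 powr real_of_int j * x $ i\<rfloor>)"

lemma mem_dyadic_cube_cube_at: "x \<in> dyadic_cube R \<longleftrightarrow> R = cube_at (fst R) x"
  by (cases R) (auto simp: mem_dyadic_cube_iff cube_at_def vec_eq_iff)

definition cube_vol :: "int \<times> (int ^ 'n) \<Rightarrow> real" where
  "cube_vol Q = 2 powr (- (real_of_int (fst Q) * real CARD('n)))"

lemma cube_vol_pos: "0 < cube_vol Q"
  by (simp add: cube_vol_def)

text \<open>The half-open cube is squeezed between an open and a closed box of equal volume.\<close>

lemma emeasure_lborel_dyadic_cube: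
  "emeasure lborel (dyadic_cube Q) = ennreal (cube_vol (Q :: int \<times> (int ^ 'n)))"
  and dyadic_cube_borel: "dyadic_cube Q \<in> sets borel"
proof -
  obtain j and m :: "int ^ 'n" where Q: "Q = (j, m)" by (cases Q)
  define s :: real where "s = 2 powi (- j)"
  have s: "0 < s" by (simp add: s_def)
  define a b :: "real ^ 'n" where "a = (\<chi> i. s * of_int (m $ i))" and "b = (\<chi> i. s * (of_int (m $ i) + 1))"
  have eq: "dyadic_cube Q = {x. \<forall>i. a $ i \<le> x $ i \<and> x $ i < b $ i}"
    by (simp add: Q dyadic_cube_def s_def a_def b_def)
  have "(\<lambda>x :: real ^ 'n. x $ i) \<in> borel_measurable borel" for i
    by (intro borel_measurable_continuous_onI continuous_intros)
  note [measurable] = this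
  have "{x. \<forall>i. a $ i \<le> x $ i \<and> x $ i < b $ i} = (\<Inter>i. {x \<in> space borel. a $ i \<le> x $ i \<and> x $ i < b $ i})"
    by auto
  also have "\<dots> \<in> sets borel"
    by (intro sets.finite_INT) (auto, measurable)
  finally show meas: "dyadic_cube Q \<in> sets borel" by (simp add: eq)
  have sub: "box a b \<subseteq> dyadic_cube Q" "dyadic_cube Q \<subseteq> cbox a b"
    by (auto simp: eq mem_box_cart less_imp_le)
  have ab: "a \<bullet> k \<le> b \<bullet> k" if "k \<in> Basis" for k
    using that s by (auto simp: Basis_vec_def inner_axis a_def b_def)
  have "emeasure lborel (box a b) = emeasure lborel (cbox a b)"
    using ab by simp
  moreover have "emeasure lborel (box a b) \<le> emeasure lborel (dyadic_cube Q)"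
      "emeasure lborel (dyadic_cube Q) \<le> emeasure lborel (cbox a b)"
    using sub meas by (auto intro!: emeasure_mono)
  moreover have "emeasure lborel (cbox a b) = ennreal (s ^ CARD('n))"
  proof -
    have "cbox a b \<noteq> {}"
      using s by (auto simp: box_ne_empty Basis_vec_def inner_axis a_def b_def)
    then have "measure lborel (cbox a b) = (\<Prod>i\<in>UNIV. b $ i - a $ i)"
      by (rule content_cbox_cart)
    also have "\<dots> = s ^ CARD('n)" by (simp add: a_def b_def algebra_simps)
    finally show ?thesis
      by (metis emeasure_eq_ennreal_measure emeasure_lborel_cbox_finite less_irrefl infinity_ennreal_def)
  qed
  moreover have "s ^ CARD('n) = cube_vol Q"
  proof -
    have "s = 2 powr real_of_int (- j)"
      unfolding s_def by (rule powr_real_of_int' [symmetric]) auto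
    then show ?thesis by (simp add: Q cube_vol_def powr_powr flip: powr_realpow)
  qed
  ultimately show "emeasure lborel (dyadic_cube Q) = ennreal (cube_vol Q)" by simp
qed

lemma dyadic_cube_sets [measurable]: "dyadic_cube Q \<in> sets lebesgue"
  using dyadic_cube_borel [of Q] by simp

lemma measure_dyadic_cube: "measure lebesgue (dyadic_cube Q) = cube_vol Q"
  using cube_vol_pos [of Q] emeasure_lborel_dyadic_cube [of Q] dyadic_cube_borel [of Q]
  by (simp add: measure_def)

section \<open>Ancestors, adjacency and counting\<close>

text \<open>\<open>R\<close> is adjacent (or equal) to the \<open>l\<close>-th dyadic ancestor of \<open>Q\<close>.\<close>

definition near_ancestor :: "nat \<Rightarrow> int \<times> (int ^ 'n) \<Rightarrow> int \<times> (int ^ 'n) \<Rightarrow> bool" where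
  "near_ancestor l Q R \<longleftrightarrow>
     fst R = fst Q - int l \<and> (\<forall>i. \<bar>snd Q $ i div 2 ^ l - snd R $ i\<bar> \<le> 1)"

lemma card_int_vec_box:
  fixes A :: "'n::finite \<Rightarrow> int set"
  assumes "\<And>i. finite (A i)"
  shows "finite {m :: int ^ 'n. \<forall>i. m $ i \<in> A i}" (is "finite ?S")
    and "card {m :: int ^ 'n. \<forall>i. m $ i \<in> A i} \<le> (\<Prod>i\<in>UNIV. card (A i))"
proof -
  have sub: "?S \<subseteq> vec_lambda ` (PiE UNIV A)"
  proof
    fix m assume "m \<in> ?S"
    then have "m = vec_lambda (\<lambda>i. m $ i)" "(\<lambda>i. m $ i) \<in> PiE UNIV A" by auto
    then show "m \<in> vec_lambda ` (PiE UNIV A)" by blast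
  qed
  have fin: "finite (PiE UNIV A)" by (intro finite_PiE assms) auto
  show "finite ?S" by (rule finite_subset [OF sub finite_imageI [OF fin]])
  have "card ?S \<le> card (vec_lambda ` (PiE UNIV A))" by (intro card_mono finite_imageI fin sub)
  also have "\<dots> \<le> card (PiE UNIV A)" by (rule card_image_le [OF fin])
  also have "\<dots> = (\<Prod>i\<in>UNIV. card (A i))" by (rule card_PiE) simp
  finally show "card ?S \<le> (\<Prod>i\<in>UNIV. card (A i))" .
qed

text \<open>Each coordinate of \<open>Q\<close> ranges over three consecutive blocks of 2^l
  integers, one for each admissible quotient.\<close>

lemma finite_near_ancestor:
  fixes R :: "int \<times> (int ^ 'n)"
  shows "finite {Q. near_ancestor l Q R}"
    and card_near_ancestor: "card {Q. near_ancestor l Q R} \<le> (3 * 2 ^ l) ^ CARD('n)"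
proof -
  define A where "A i = {2 ^ l * (snd R $ i - 1) ..< 2 ^ l * (snd R $ i - 1) + 3 * 2 ^ l}" for i
  let ?S = "{m :: int ^ 'n. \<forall>i. m $ i \<in> A i}"
  have sub: "{Q. near_ancestor l Q R} \<subseteq> (\<lambda>m. (fst R + int l, m)) ` ?S"
  proof
    fix Q assume "Q \<in> {Q. near_ancestor l Q R}"
    then have Q: "fst R = fst Q - int l" "\<And>i. \<bar>snd Q $ i div 2 ^ l - snd R $ i\<bar> \<le> 1"
      by (auto simp: near_ancestor_def)
    have "snd Q $ i \<in> A i" for i
    proof -
      define d where "d = snd Q $ i div 2 ^ l"
      have d: "snd R $ i - 1 \<le> d" "d \<le> snd R $ i + 1" using Q(2) [of i] by (auto simp: d_def)
      have e: "snd Q $ i = 2 ^ l * d + snd Q $ i mod 2 ^ l" by (simp add: d_def)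
      have m: "0 \<le> snd Q $ i mod 2 ^ l" "snd Q $ i mod 2 ^ l < 2 ^ l" by auto
      have "2 ^ l * (snd R $ i - 1) \<le> 2 ^ l * d" "2 ^ l * d \<le> 2 ^ l * (snd R $ i + 1)"
        using d by (auto intro: mult_left_mono)
      moreover have "2 ^ l * (snd R $ i + 1) = 2 ^ l * (snd R $ i - 1) + 2 * 2 ^ l"
        by (simp add: algebra_simps)
      ultimately have "2 ^ l * (snd R $ i - 1) \<le> snd Q $ i" "snd Q $ i < 2 ^ l * (snd R $ i - 1) + 3 * 2 ^ l"
        using e m by linarith+
      then show ?thesis by (simp add: A_def)
    qed
    moreover have "Q = (fst R + int l, snd Q)" using Q(1) by (cases Q) auto
    ultimately show "Q \<in> (\<lambda>m. (fst R + int l, m)) ` ?S" by blast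
  qed
  have fin: "finite (A i)" for i by (simp add: A_def)
  note S = card_int_vec_box [of A, OF fin]
  show "finite {Q. near_ancestor l Q R}" using S(1) by (intro finite_subset [OF sub]) auto
  have "card {Q. near_ancestor l Q R} \<le> card ?S"
    using S(1) by (intro order_trans [OF card_mono [OF _ sub] card_image_le]) auto
  also have "\<dots> \<le> (\<Prod>i\<in>UNIV. card (A i))" by (rule S(2))
  also have "\<dots> = (3 * 2 ^ l) ^ CARD('n)" by (simp add: A_def nat_mult_distrib nat_power_eq)
  finally show "card {Q. near_ancestor l Q R} \<le> (3 * 2 ^ l) ^ CARD('n)" .
qed

text \<open>Three choices per coordinate, whatever \<open>l\<close> is; in the other direction the
  count grows like 2^{l n}. This asymmetry decides the weights in the coefficient estimate.\<close>

lemma card_near_ancestor_of: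
  fixes Q :: "int \<times> (int ^ 'n)"
  shows "finite {R. near_ancestor l Q R}" "card {R. near_ancestor l Q R} \<le> 3 ^ CARD('n)"
proof -
  define A where "A i = {snd Q $ i div 2 ^ l - 1 ..< snd Q $ i div 2 ^ l + 2}" for i
  let ?S = "{m :: int ^ 'n. \<forall>i. m $ i \<in> A i}"
  have sub: "{R. near_ancestor l Q R} \<subseteq> (\<lambda>m. (fst Q - int l, m)) ` ?S"
  proof
    fix R assume "R \<in> {R. near_ancestor l Q R}"
    then have R: "fst R = fst Q - int l" "\<And>i. \<bar>snd Q $ i div 2 ^ l - snd R $ i\<bar> \<le> 1"
      by (auto simp: near_ancestor_def)
    have "snd R $ i \<in> A i" for i
      using R(2) [of i] by (auto simp: A_def abs_le_iff)
    moreover have "R = (fst Q - int l, snd R)" using R(1) by (cases R) auto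
    ultimately show "R \<in> (\<lambda>m. (fst Q - int l, m)) ` ?S" by blast
  qed
  have fin: "finite (A i)" for i by (simp add: A_def)
  note S = card_int_vec_box [of A, OF fin]
  show "finite {R. near_ancestor l Q R}" using S(1) by (intro finite_subset [OF sub]) auto
  have "card {R. near_ancestor l Q R} \<le> card ?S"
    using S(1) by (intro order_trans [OF card_mono [OF _ sub] card_image_le]) auto
  also have "\<dots> \<le> (\<Prod>i\<in>UNIV. card (A i))" by (rule S(2))
  also have "\<dots> = 3 ^ CARD('n)" by (simp add: A_def)
  finally show "card {R. near_ancestor l Q R} \<le> 3 ^ CARD('n)" .
qed

lemma floor_scale:
  fixes y :: real
  shows "\<lfloor>2 powr real_of_int (j - int l) * y\<rfloor> = \<lfloor>2 powr real_of_int j * y\<rfloor> div 2 ^ l"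
proof -
  have "2 powr real_of_int (j - int l) * y = (2 powr real_of_int j * y) / real_of_int (2 ^ l)"
    by (simp add: powr_diff powr_realpow)
  then show ?thesis by (simp add: floor_divide_real_eq_div del: of_int_power)
qed

lemma near_ancestor_cube_at_iff:
  "near_ancestor l Q (cube_at (fst Q - int l) x) \<longleftrightarrow>
    (\<forall>i. \<bar>snd Q $ i div 2 ^ l - \<lfloor>2 powr real_of_int (fst Q) * x $ i\<rfloor> div 2 ^ l\<bar> \<le> 1)"
  unfolding near_ancestor_def cube_at_def using floor_scale [of "fst Q" l] by simp

lemma ex_near_ancestor:
  fixes x :: "real ^ 'n"
  shows "\<exists>l. near_ancestor l Q (cube_at (fst Q - int l) x)"
proof -
  define D where "D i = nat \<bar>snd Q $ i - \<lfloor>2 powr real_of_int (fst Q) * x $ i\<rfloor>\<bar>" for i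
  \<comment> \<open>Integers less than 2^l apart have quotients by 2^l differing by at most 1, and
    every distance is at most l < 2^l.\<close>
  define l where "l = Max (range D)"
  have "\<bar>snd Q $ i div 2 ^ l - \<lfloor>2 powr real_of_int (fst Q) * x $ i\<rfloor> div 2 ^ l\<bar> \<le> 1" for i
  proof -
    have "D i \<le> l" unfolding l_def by (intro Max_ge) auto
    moreover have "l < 2 ^ l" by simp
    ultimately have "D i < 2 ^ l" by linarith
    then have "int (D i) < 2 ^ l" by (metis of_nat_less_iff of_nat_numeral of_nat_power)
    then have d: "\<bar>snd Q $ i - \<lfloor>2 powr real_of_int (fst Q) * x $ i\<rfloor>\<bar> < 2 ^ l" by (simp add: D_def)
    have "a div 2 ^ l \<le> b div 2 ^ l + 1" if "a < b + 2 ^ l" for a b :: int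
    proof -
      have "a div 2 ^ l \<le> (b + 2 ^ l) div 2 ^ l" using that by (intro zdiv_mono1) auto
      then show ?thesis by simp
    qed
    from this [of "snd Q $ i" "\<lfloor>2 powr real_of_int (fst Q) * x $ i\<rfloor>"]
      this [of "\<lfloor>2 powr real_of_int (fst Q) * x $ i\<rfloor>" "snd Q $ i"] d
    show ?thesis by (simp add: abs_le_iff abs_less_iff)
  qed
  then show ?thesis using near_ancestor_cube_at_iff by blast
qed

text \<open>The least \<open>L\<close> for which the cube of generation \<open>fst Q - L\<close> at
  \<open>x\<close> neighbours the ancestor of \<open>Q\<close> is used. If L > 0, then one
  generation earlier the two cubes were separated in some coordinate, so a ball through
  \<open>x\<close> that meets \<open>Q\<close> is large compared with \<open>R\<close>.\<close>

lemma maximal_near_or_far: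
  fixes F :: "real ^ 'n \<Rightarrow> ennreal"
  assumes F: "\<And>y. y \<notin> dyadic_cube Q \<Longrightarrow> F y = 0"
  obtains l R where "x \<in> dyadic_cube R" "near_ancestor l Q R"
    "l = 0 \<or> maximal F x \<le> ennreal (4 ^ CARD('n) / ball_vol TYPE('n) / cube_vol R) * (\<integral>\<^sup>+y. F y \<partial>lebesgue)"
proof -
  define P where "P l = near_ancestor l Q (cube_at (fst Q - int l) x)" for l
  define L where "L = (LEAST l. P l)"
  have PL: "P L" and L: "\<And>l. l < L \<Longrightarrow> \<not> P l"
    unfolding L_def P_def using LeastI_ex [OF ex_near_ancestor] not_less_Least by blast+
  let ?R = "cube_at (fst Q - int L) x"
  let ?v = "ball_vol TYPE('n)"
  have v: "0 < ?v" by (rule ball_vol_pos)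
  have xR: "x \<in> dyadic_cube ?R" by (simp add: mem_dyadic_cube_cube_at cube_at_def)
  have "maximal F x \<le> ennreal (4 ^ CARD('n) / ?v / cube_vol ?R) * (\<integral>\<^sup>+y. F y \<partial>lebesgue)" if L0: "L \<noteq> 0"
  proof -
    obtain l where Ll: "L = Suc l" using L0 not0_implies_Suc by blast
    then have "\<not> P l" using L by simp
    then obtain i where i: "\<not> \<bar>snd Q $ i div 2 ^ l - \<lfloor>2 powr real_of_int (fst Q) * x $ i\<rfloor> div 2 ^ l\<bar> \<le> 1"
      unfolding P_def near_ancestor_cube_at_iff by blast
    define J where "J = fst Q - int l"
    \<comment> \<open>Half the side of a cube of generation \<open>J\<close>, the last separated
      one, hence a quarter of the side of \<open>?R\<close>; this is the origin of 4^n.\<close>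
    define a where "a = 2 powr (- real_of_int J) / (2::real)"
    have a: "0 < a" by (simp add: a_def)
    have vol: "cube_vol ?R = (4 * a) ^ CARD('n)"
    proof -
      have "4 * a = 2 powr (1 - real_of_int J)" by (simp add: a_def powr_diff powr_minus field_simps)
      then have "(4 * a) ^ CARD('n) = 2 powr ((1 - real_of_int J) * real CARD('n))"
        by (simp add: powr_powr flip: powr_realpow)
      also have "(1 - real_of_int J) * real CARD('n) = - (real_of_int (fst ?R) * real CARD('n))"
        by (simp add: cube_at_def J_def Ll algebra_simps)
      finally show ?thesis by (simp add: cube_vol_def)
    qed
    show ?thesis
    proof (rule maximal_leI)
      fix c :: "real ^ 'n" and \<rho> :: real
      assume \<rho>: "0 < \<rho>" "x \<in> ball c \<rho>"
      show "(\<integral>\<^sup>+ y \<in> ball c \<rho>. F y \<partial>lebesgue) / emeasure lebesgue (ball c \<rho>)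
        \<le> ennreal (4 ^ CARD('n) / ?v / cube_vol ?R) * (\<integral>\<^sup>+y. F y \<partial>lebesgue)"
      proof (cases "ball c \<rho> \<inter> dyadic_cube Q = {}")
        case True
        then have "F y * indicator (ball c \<rho>) y = 0" for y
        proof (cases "y \<in> ball c \<rho>")
          case in_ball: True
          with True have "y \<notin> dyadic_cube Q" by blast
          then show ?thesis by (simp add: F)
        qed (simp add: indicator_def)
        then have "(\<integral>\<^sup>+ y \<in> ball c \<rho>. F y \<partial>lebesgue) = 0"
          by (simp only: nn_integral_const mult_zero_left)
        then show ?thesis by simp
      next
        case False
        then obtain y where y: "y \<in> ball c \<rho>" "y \<in> dyadic_cube Q" by blast
        have "\<lfloor>2 powr real_of_int (fst Q) * y $ i\<rfloor> = snd Q $ i"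
          using y(2) mem_dyadic_cube_iff [of y "fst Q" "snd Q"] by simp
        \<comment> \<open>Floors at least 2 apart force the reals more than 1 apart, so
          \<open>x\<close> and \<open>y\<close> are more than 2a apart and the ball containing both
          has radius above a.\<close>
        then have "\<not> \<bar>\<lfloor>2 powr real_of_int J * y $ i\<rfloor> - \<lfloor>2 powr real_of_int J * x $ i\<rfloor>\<bar> \<le> 1"
          using i unfolding J_def floor_scale by simp
        then have "1 < \<bar>2 powr real_of_int J * y $ i - 2 powr real_of_int J * x $ i\<bar>"
          by linarith
        also have "\<dots> = 2 powr real_of_int J * \<bar>(y - x) $ i\<bar>"
          by (simp add: abs_mult flip: right_diff_distrib)
        also have "\<dots> \<le> 2 powr real_of_int J * norm (y - x)"
          by (intro mult_left_mono component_le_norm_cart) auto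
        also have "\<dots> < 2 powr real_of_int J * (2 * \<rho>)"
        proof -
          have "dist y x < 2 * \<rho>"
            using y(1) \<rho>(2) dist_triangle [of y x c] by (simp add: dist_commute)
          then show ?thesis by (simp add: dist_norm)
        qed
        finally have "a < \<rho>" by (simp add: a_def powr_minus field_simps)
        then have "?v * a ^ CARD('n) \<le> ?v * \<rho> ^ CARD('n)"
          using a v by (intro mult_left_mono power_mono) auto
        then have inv: "inverse (emeasure lebesgue (ball c \<rho>)) \<le> inverse (ennreal (?v * a ^ CARD('n)))"
          using \<rho> a v by (auto simp: emeasure_lborel_ball inverse_ennreal intro!: ennreal_leI le_imp_inverse_le)
        have "(\<integral>\<^sup>+ y \<in> ball c \<rho>. F y \<partial>lebesgue) * inverse (emeasure lebesgue (ball c \<rho>))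
            \<le> (\<integral>\<^sup>+y. F y \<partial>lebesgue) * inverse (ennreal (?v * a ^ CARD('n)))"
          by (intro mult_mono inv nn_integral_mono) (auto split: split_indicator)
        also have "inverse (ennreal (?v * a ^ CARD('n))) = ennreal (4 ^ CARD('n) / ?v / cube_vol ?R)"
          using a v unfolding vol by (subst inverse_ennreal) (auto simp: power_mult_distrib field_simps)
        finally show ?thesis by (simp add: divide_ennreal_def mult.commute)
      qed
    qed
  qed
  then have "L = 0 \<or> maximal F x \<le> ennreal (4 ^ CARD('n) / ?v / cube_vol ?R) * (\<integral>\<^sup>+y. F y \<partial>lebesgue)"
    by blast
  then show thesis
    using that [OF xR] PL unfolding P_def by blast
qed

section \<open>Spreading coefficients to ancestors\<close>

text \<open>Used with \<alpha> = n (1 - 1/t). The condition sits in an indicator, and the sum runs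
  over all pairs, so that Tonelli can reorder \<open>l\<close>, \<open>Q\<close> and
  \<open>R\<close> freely.\<close>

definition spread_coeff :: "real \<Rightarrow> (int \<times> (int ^ 'n) \<Rightarrow> ennreal) \<Rightarrow> int \<times> (int ^ 'n) \<Rightarrow> ennreal" where
  "spread_coeff \<alpha> w R = (\<integral>\<^sup>+(l, Q). indicator {(l, Q). near_ancestor l Q R} (l, Q) * ennreal (2 powr (- (real l * \<alpha>))) * w Q
     \<partial>count_space UNIV)"

lemma spread_coeff_ge:
  assumes "near_ancestor l Q R"
  shows "ennreal (2 powr (- (real l * \<alpha>))) * w Q \<le> spread_coeff \<alpha> w R"
  using nn_integral_ge_point [OF UNIV_I, where p = "\<lambda>(l, Q). indicator {(l, Q). near_ancestor l Q R} (l, Q) * ennreal (2 powr (- (real l * \<alpha>))) * w Q" and x = "(l, Q)"] assms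
  by (simp add: spread_coeff_def)

lemma nn_integral_powr_geometric:
  assumes "0 < \<epsilon>"
  shows "(\<integral>\<^sup>+l. ennreal (2 powr (- (real l * \<epsilon>))) \<partial>count_space UNIV) = ennreal (1 / (1 - 2 powr (- \<epsilon>)))"
proof -
  have "2 powr (- (real l * \<epsilon>)) = (2 powr (- \<epsilon>)) ^ l" for l
    by (simp add: powr_powr mult.commute flip: powr_realpow)
  moreover have "2 powr (- \<epsilon>) < 1"
    using assms powr_less_mono [of "- \<epsilon>" 0 2] by simp
  ultimately show ?thesis by (simp add: nn_integral_geometric)
qed

text \<open>There are at most 3^n 2^{l n} cubes for each \<open>l\<close>, which the weight beats by
  2^{-l \<epsilon>}. This is the total mass of the Jensen weights.\<close>

lemma sum_near_ancestor_of_le: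
  fixes R :: "int \<times> (int ^ 'n)"
  assumes "0 < \<epsilon>"
  shows "(\<integral>\<^sup>+(l, Q). indicator {(l, Q). near_ancestor l Q R} (l, Q) * ennreal (2 powr (- (real l * (real CARD('n) + \<epsilon>)))) \<partial>count_space UNIV)
    \<le> ennreal (3 ^ CARD('n) / (1 - 2 powr (- \<epsilon>)))"
proof -
  have lt: "2 powr (- \<epsilon>) < (1::real)"
    using assms powr_less_mono [of "- \<epsilon>" 0 2] by simp
  have "(\<integral>\<^sup>+(l, Q). indicator {(l, Q). near_ancestor l Q R} (l, Q) * ennreal (2 powr (- (real l * (real CARD('n) + \<epsilon>)))) \<partial>count_space UNIV)
    = (\<integral>\<^sup>+l. (\<integral>\<^sup>+Q. ennreal (2 powr (- (real l * (real CARD('n) + \<epsilon>)))) * indicator {Q. near_ancestor l Q R} Q \<partial>count_space UNIV) \<partial>count_space UNIV)"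
    by (subst nn_integral_fst_count_space [symmetric]) (auto intro!: nn_integral_cong split: split_indicator)
  also have "\<dots> = (\<integral>\<^sup>+l. ennreal (2 powr (- (real l * (real CARD('n) + \<epsilon>)))) * of_nat (card {Q. near_ancestor l Q R}) \<partial>count_space UNIV)"
    by (simp add: nn_integral_cmult_indicator finite_near_ancestor)
  also have "\<dots> \<le> (\<integral>\<^sup>+l. ennreal (3 ^ CARD('n)) * ennreal (2 powr (- (real l * \<epsilon>))) \<partial>count_space UNIV)"
  proof (intro nn_integral_mono)
    fix l
    have "real (card {Q. near_ancestor l Q R}) \<le> real ((3 * 2 ^ l) ^ CARD('n))"
      using card_near_ancestor [of l R] by (rule of_nat_mono)
    also have "\<dots> = 3 ^ CARD('n) * 2 powr (real l * real CARD('n))"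
      by (simp add: power_mult_distrib powr_powr flip: powr_realpow)
    finally have "2 powr (- (real l * (real CARD('n) + \<epsilon>))) * real (card {Q. near_ancestor l Q R})
       \<le> 2 powr (- (real l * (real CARD('n) + \<epsilon>))) * (3 ^ CARD('n) * 2 powr (real l * real CARD('n)))"
      by (rule mult_left_mono) simp
    also have "\<dots> = 3 ^ CARD('n) * (2 powr (- (real l * (real CARD('n) + \<epsilon>))) * 2 powr (real l * real CARD('n)))"
      by (simp only: mult_ac)
    also have "\<dots> = 3 ^ CARD('n) * 2 powr (- (real l * \<epsilon>))"
      by (simp add: algebra_simps flip: powr_add)
    finally have "ennreal (2 powr (- (real l * (real CARD('n) + \<epsilon>))) * real (card {Q. near_ancestor l Q R}))
       \<le> ennreal (3 ^ CARD('n) * 2 powr (- (real l * \<epsilon>)))"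
      by (rule ennreal_leI)
    then show "ennreal (2 powr (- (real l * (real CARD('n) + \<epsilon>)))) * of_nat (card {Q. near_ancestor l Q R})
      \<le> ennreal (3 ^ CARD('n)) * ennreal (2 powr (- (real l * \<epsilon>)))"
      by (simp only: ennreal_mult'' ennreal_of_nat_eq_real_of_nat of_nat_0_le_iff powr_ge_zero)
  qed
  also have "\<dots> = ennreal (3 ^ CARD('n)) * ennreal (1 / (1 - 2 powr (- \<epsilon>)))"
    by (subst nn_integral_cmult) (simp_all only: nn_integral_powr_geometric [OF assms], simp)
  also have "\<dots> = ennreal (3 ^ CARD('n) * (1 / (1 - 2 powr (- \<epsilon>))))"
    using lt by (intro ennreal_mult [symmetric]) auto
  finally show ?thesis by simp
qed

text \<open>The dual sum: for fixed \<open>Q\<close> there are only 3^n cubes per generation, so the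
  weight 2^{-l \<epsilon>} suffices and the same bound results.\<close>

lemma sum_ancestors_near_le:
  fixes Q :: "int \<times> (int ^ 'n)"
  assumes "0 < \<epsilon>"
  shows "(\<integral>\<^sup>+R. (\<integral>\<^sup>+l. indicator {l. near_ancestor l Q R} l * ennreal (2 powr (- (real l * \<epsilon>))) \<partial>count_space UNIV) \<partial>count_space UNIV)
    \<le> ennreal (3 ^ CARD('n) / (1 - 2 powr (- \<epsilon>)))"
proof -
  have lt: "2 powr (- \<epsilon>) < (1::real)"
    using assms powr_less_mono [of "- \<epsilon>" 0 2] by simp
  have "(\<integral>\<^sup>+R. (\<integral>\<^sup>+l. indicator {l. near_ancestor l Q R} l * ennreal (2 powr (- (real l * \<epsilon>))) \<partial>count_space UNIV) \<partial>count_space UNIV)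
    = (\<integral>\<^sup>+l. (\<integral>\<^sup>+R. indicator {l. near_ancestor l Q R} l * ennreal (2 powr (- (real l * \<epsilon>))) \<partial>count_space UNIV) \<partial>count_space UNIV)"
    by (rule nn_integral_count_space_nn_integral) auto
  also have "\<dots> = (\<integral>\<^sup>+l. (\<integral>\<^sup>+R. ennreal (2 powr (- (real l * \<epsilon>))) * indicator {R. near_ancestor l Q R} R \<partial>count_space UNIV) \<partial>count_space UNIV)"
    by (intro nn_integral_cong) (auto split: split_indicator)
  also have "\<dots> = (\<integral>\<^sup>+l. ennreal (2 powr (- (real l * \<epsilon>))) * of_nat (card {R. near_ancestor l Q R}) \<partial>count_space UNIV)"
    by (simp add: nn_integral_cmult_indicator card_near_ancestor_of)
  also have "\<dots> \<le> (\<integral>\<^sup>+l. ennreal (3 ^ CARD('n)) * ennreal (2 powr (- (real l * \<epsilon>))) \<partial>count_space UNIV)"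
  proof (intro nn_integral_mono)
    fix l
    have "real (card {R. near_ancestor l Q R}) \<le> real (3 ^ CARD('n))"
      using card_near_ancestor_of(2) [of l Q] by (rule of_nat_mono)
    then have "of_nat (card {R. near_ancestor l Q R}) \<le> ennreal (3 ^ CARD('n))"
      unfolding ennreal_of_nat_eq_real_of_nat by (intro ennreal_leI) simp
    then show "ennreal (2 powr (- (real l * \<epsilon>))) * of_nat (card {R. near_ancestor l Q R})
      \<le> ennreal (3 ^ CARD('n)) * ennreal (2 powr (- (real l * \<epsilon>)))"
      by (subst mult.commute) (rule mult_right_mono, auto)
  qed
  also have "\<dots> = ennreal (3 ^ CARD('n)) * ennreal (1 / (1 - 2 powr (- \<epsilon>)))"
    by (subst nn_integral_cmult) (simp_all only: nn_integral_powr_geometric [OF assms], simp)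
  also have "\<dots> = ennreal (3 ^ CARD('n) * (1 / (1 - 2 powr (- \<epsilon>))))"
    using lt by (intro ennreal_mult [symmetric]) auto
  finally show ?thesis by simp
qed

text \<open>The hypothesis r < t is exactly \<epsilon> > 0. Jensen over the pairs below
  \<open>R\<close> uses \<open>sum_near_ancestor_of_le\<close>; the subsequent sum over
  \<open>R\<close> uses \<open>sum_ancestors_near_le\<close>.\<close>

lemma spread_coeff_lr_bound:
  assumes t: "1 < t" and r: "1 \<le> r" "r < t"
  obtains C where "0 < C"
    "\<And>w :: int \<times> (int ^ 'n) \<Rightarrow> ennreal.
      (\<integral>\<^sup>+R. ennpowr (spread_coeff (real CARD('n) * (1 - 1 / t)) w R) r \<partial>count_space UNIV)
        \<le> ennreal C * (\<integral>\<^sup>+Q. ennpowr (w Q) r \<partial>count_space UNIV)"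
proof -
  define n where "n = real CARD('n)"
  define \<alpha> where "\<alpha> = n * (1 - 1 / t)"
  define \<epsilon> where "\<epsilon> = n * (1 / r - 1 / t)"
  define V where "V = 3 ^ CARD('n) / (1 - 2 powr (- \<epsilon>))"
  have n: "0 < n" by (simp add: n_def)
  have \<epsilon>: "0 < \<epsilon>" using n r t by (simp add: \<epsilon>_def frac_less2)
  have V: "0 < V"
    using \<epsilon> powr_less_mono [of "- \<epsilon>" 0 2] by (simp add: V_def)
  \<comment> \<open>The factor 2^{l \<beta>} is what remains of 2^{-l \<alpha>} after the Jensen
    weight is split off; \<beta> equals n/r, so its r-th power is 2^{l n}.\<close>
  define \<beta> where "\<beta> = n + \<epsilon> - \<alpha>"
  have \<beta>: "r * \<beta> = n" using r t by (simp add: \<beta>_def \<alpha>_def \<epsilon>_def field_simps)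
  show thesis
  proof (rule that)
    show "0 < V powr (r - 1) * V" using V by simp
    fix w :: "int \<times> (int ^ 'n) \<Rightarrow> ennreal"
    have "ennpowr (spread_coeff \<alpha> w R) r \<le> ennreal (V powr (r - 1)) *
        (\<integral>\<^sup>+Q. ennpowr (w Q) r * (\<integral>\<^sup>+l. indicator {l. near_ancestor l Q R} l * ennreal (2 powr (- (real l * \<epsilon>))) \<partial>count_space UNIV) \<partial>count_space UNIV)" for R
    proof -
      let ?v = "\<lambda>(l, Q). indicator {(l, Q). near_ancestor l Q R} (l, Q) * ennreal (2 powr (- (real l * (n + \<epsilon>))))"
      let ?f = "\<lambda>(l, Q). ennreal (2 powr (real l * \<beta>)) * w Q"
      have "spread_coeff \<alpha> w R = (\<integral>\<^sup>+x. ?v x * ?f x \<partial>count_space UNIV)"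
        unfolding spread_coeff_def
      proof (rule nn_integral_cong)
        fix x :: "nat \<times> int \<times> (int ^ 'n)"
        obtain l Q where x: "x = (l, Q)" by (cases x)
        have "2 powr (- (real l * \<alpha>)) = 2 powr (- (real l * (n + \<epsilon>))) * 2 powr (real l * \<beta>)"
          by (simp add: \<beta>_def algebra_simps flip: powr_add)
        then have "ennreal (2 powr (- (real l * \<alpha>))) = ennreal (2 powr (- (real l * (n + \<epsilon>)))) * ennreal (2 powr (real l * \<beta>))"
          by (simp add: ennreal_mult)
        then show "(case x of (l, Q) \<Rightarrow> indicator {(l, Q). near_ancestor l Q R} (l, Q) * ennreal (2 powr (- (real l * \<alpha>))) * w Q) = ?v x * ?f x"
          unfolding x by (simp only: prod.case mult.assoc)
      qed
      then have "ennpowr (spread_coeff \<alpha> w R) r \<le> ennreal (V powr (r - 1)) * (\<integral>\<^sup>+x. ?v x * ennpowr (?f x) r \<partial>count_space UNIV)"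
        using nn_integral_Jensen_powr [of ?v "count_space UNIV" ?f r V] r V sum_near_ancestor_of_le [OF \<epsilon>, of R]
        by (simp add: V_def n_def)
      also have "(\<integral>\<^sup>+x. ?v x * ennpowr (?f x) r \<partial>count_space UNIV)
          = (\<integral>\<^sup>+Q. \<integral>\<^sup>+l. ?v (l, Q) * ennpowr (?f (l, Q)) r \<partial>count_space UNIV \<partial>count_space UNIV)"
        by (rule nn_integral_snd_count_space [symmetric])
      also have "\<dots> = (\<integral>\<^sup>+Q. \<integral>\<^sup>+l. ennpowr (w Q) r * (indicator {l. near_ancestor l Q R} l * ennreal (2 powr (- (real l * \<epsilon>)))) \<partial>count_space UNIV \<partial>count_space UNIV)"
      proof (intro nn_integral_cong)
        fix Q :: "int \<times> (int ^ 'n)" and l :: nat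
        have f: "ennpowr (ennreal (2 powr (real l * \<beta>)) * w Q) r = ennreal (2 powr (real l * n)) * ennpowr (w Q) r"
          using \<beta> by (simp add: ennpowr_mult ennpowr_ennreal powr_powr mult.assoc mult.commute [of r])
        have e: "ennreal (2 powr (- (real l * (n + \<epsilon>)))) * ennreal (2 powr (real l * n)) = ennreal (2 powr (- (real l * \<epsilon>)))"
          by (simp add: algebra_simps flip: powr_add ennreal_mult)
        have i: "(indicator {(l, Q). near_ancestor l Q R} (l, Q) :: ennreal) = indicator {l. near_ancestor l Q R} l"
          by (simp add: indicator_def)
        have "?v (l, Q) * ennpowr (?f (l, Q)) r = ennpowr (w Q) r * (indicator {l. near_ancestor l Q R} l *
            (ennreal (2 powr (- (real l * (n + \<epsilon>)))) * ennreal (2 powr (real l * n))))"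
          unfolding prod.case f i by (simp only: mult_ac)
        then show "?v (l, Q) * ennpowr (?f (l, Q)) r = ennpowr (w Q) r * (indicator {l. near_ancestor l Q R} l * ennreal (2 powr (- (real l * \<epsilon>))))"
          unfolding e .
      qed
      also have "\<dots> = (\<integral>\<^sup>+Q. ennpowr (w Q) r * (\<integral>\<^sup>+l. indicator {l. near_ancestor l Q R} l * ennreal (2 powr (- (real l * \<epsilon>))) \<partial>count_space UNIV) \<partial>count_space UNIV)"
        by (intro nn_integral_cong nn_integral_cmult) simp
      finally show ?thesis .
    qed
    then have "(\<integral>\<^sup>+R. ennpowr (spread_coeff \<alpha> w R) r \<partial>count_space UNIV)
      \<le> (\<integral>\<^sup>+R. ennreal (V powr (r - 1)) *
        (\<integral>\<^sup>+Q. ennpowr (w Q) r * (\<integral>\<^sup>+l. indicator {l. near_ancestor l Q R} l * ennreal (2 powr (- (real l * \<epsilon>))) \<partial>count_space UNIV) \<partial>count_space UNIV) \<partial>count_space UNIV)"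
      by (intro nn_integral_mono)
    also have "\<dots> = ennreal (V powr (r - 1)) * (\<integral>\<^sup>+R.
        (\<integral>\<^sup>+Q. ennpowr (w Q) r * (\<integral>\<^sup>+l. indicator {l. near_ancestor l Q R} l * ennreal (2 powr (- (real l * \<epsilon>))) \<partial>count_space UNIV) \<partial>count_space UNIV) \<partial>count_space UNIV)"
      by (rule nn_integral_cmult) simp
    also have "(\<integral>\<^sup>+R.
        (\<integral>\<^sup>+Q. ennpowr (w Q) r * (\<integral>\<^sup>+l. indicator {l. near_ancestor l Q R} l * ennreal (2 powr (- (real l * \<epsilon>))) \<partial>count_space UNIV) \<partial>count_space UNIV) \<partial>count_space UNIV)
      = (\<integral>\<^sup>+Q. (\<integral>\<^sup>+R. ennpowr (w Q) r * (\<integral>\<^sup>+l. indicator {l. near_ancestor l Q R} l * ennreal (2 powr (- (real l * \<epsilon>))) \<partial>count_space UNIV) \<partial>count_space UNIV) \<partial>count_space UNIV)"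
      by (rule nn_integral_count_space_nn_integral) auto
    also have "\<dots> = (\<integral>\<^sup>+Q. ennpowr (w Q) r * (\<integral>\<^sup>+R. (\<integral>\<^sup>+l. indicator {l. near_ancestor l Q R} l * ennreal (2 powr (- (real l * \<epsilon>))) \<partial>count_space UNIV) \<partial>count_space UNIV) \<partial>count_space UNIV)"
      by (intro nn_integral_cong nn_integral_cmult) simp
    also have "\<dots> \<le> (\<integral>\<^sup>+Q. ennpowr (w Q) r * ennreal V \<partial>count_space UNIV)"
      unfolding V_def by (intro nn_integral_mono mult_left_mono sum_ancestors_near_le \<epsilon>) auto
    also have "\<dots> = (\<integral>\<^sup>+Q. ennpowr (w Q) r \<partial>count_space UNIV) * ennreal V"
      by (rule nn_integral_multc) simp
    finally have "(\<integral>\<^sup>+R. ennpowr (spread_coeff \<alpha> w R) r \<partial>count_space UNIV)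
      \<le> ennreal (V powr (r - 1)) * ((\<integral>\<^sup>+Q. ennpowr (w Q) r \<partial>count_space UNIV) * ennreal V)"
      by (simp add: mult_left_mono)
    also have "\<dots> = ennreal (V powr (r - 1) * V) * (\<integral>\<^sup>+Q. ennpowr (w Q) r \<partial>count_space UNIV)"
      using V by (subst ennreal_mult) (auto simp: mult_ac)
    finally show "(\<integral>\<^sup>+R. ennpowr (spread_coeff (real CARD('n) * (1 - 1 / t)) w R) r \<partial>count_space UNIV)
        \<le> ennreal (V powr (r - 1) * V) * (\<integral>\<^sup>+Q. ennpowr (w Q) r \<partial>count_space UNIV)"
      by (simp only: \<alpha>_def n_def)
  qed
qed

section \<open>Lorentz quasinorms of blocks\<close>

lemma ennpowr_less_top_iff: "ennpowr x a < top \<longleftrightarrow> x < top"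
  by (simp add: ennpowr_eq_top_iff flip: top.not_eq_extremum)

definition lorentz :: "'a measure \<Rightarrow> real \<Rightarrow> real \<Rightarrow> ('a \<Rightarrow> ennreal) \<Rightarrow> ennreal" where
  "lorentz M p q F = ennpowr (lorentz_int M p q F) (1 / q)"

lemma lorentz_norm_eq: "lorentz_norm p q f = lorentz lebesgue p q (\<lambda>x. ennreal (norm (f x)))"
proof -
  have "decr_rearr f u = rearr lebesgue (\<lambda>x. ennreal (norm (f x))) u" for u
    unfolding decr_rearr_def rearr_def distr_fun_def
    by (rule arg_cong [where f = Inf]) (auto simp: ennreal_less_iff)
  then show ?thesis by (simp add: lorentz_norm_def lorentz_def lorentz_int_def)
qed

lemma lorentz_mono:
  assumes "\<And>x. x \<in> space M \<Longrightarrow> F x \<le> G x" "0 < q"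
    and "F \<in> borel_measurable M" "G \<in> borel_measurable M"
  shows "lorentz M p q F \<le> lorentz M p q G"
  unfolding lorentz_def using assms by (intro ennpowr_mono lorentz_int_mono) auto

lemma lorentz_int_le_imp_lorentz_le:
  assumes "lorentz_int M p q F \<le> ennreal c * x" "0 \<le> c" "0 < q"
  shows "lorentz M p q F \<le> ennreal (c powr (1 / q)) * ennpowr x (1 / q)"
  using ennpowr_mono [OF assms(1), of "1 / q"] assms
  by (simp add: lorentz_def ennpowr_mult ennpowr_ennreal)

lemma lorentz_cmult_le:
  assumes "F \<in> borel_measurable M" "0 < q"
  shows "lorentz M p q (\<lambda>x. c * F x) \<le> c * lorentz M p q F"
proof -
  have "lorentz M p q (\<lambda>x. c * F x) \<le> ennpowr (ennpowr c q * lorentz_int M p q F) (1 / q)"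
    unfolding lorentz_def using assms by (intro ennpowr_mono lorentz_int_cmult_le) auto
  also have "\<dots> = c * lorentz M p q F"
    using assms by (simp add: lorentz_def ennpowr_mult ennpowr_ennpowr)
  finally show ?thesis .
qed

text \<open>The product combines the constant of \<open>lorentz_int_add_le\<close> after the outer
  root with that of the root of a sum. Adding 1 makes it at least 1, so its powers increase with the
  number of summands.\<close>

definition lorentz_quasi_const :: "real \<Rightarrow> real \<Rightarrow> real" where
  "lorentz_quasi_const p q = 1 + (2 powr q * 2 powr (q / p)) powr (1 / q) * 2 powr (1 / q)"

lemma lorentz_add_le:
  assumes "F \<in> borel_measurable M" "G \<in> borel_measurable M" and "0 < p" "0 < q"
  shows "lorentz M p q (\<lambda>x. F x + G x)
    \<le> ennreal (lorentz_quasi_const p q) * (lorentz M p q F + lorentz M p q G)"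
proof -
  let ?c = "(2 powr q * 2 powr (q / p)) powr (1 / q)"
  have "lorentz M p q (\<lambda>x. F x + G x) \<le> ennreal ?c * ennpowr (lorentz_int M p q F + lorentz_int M p q G) (1 / q)"
    using assms by (intro lorentz_int_le_imp_lorentz_le lorentz_int_add_le) auto
  also have "\<dots> \<le> ennreal ?c * (ennreal (2 powr (1 / q)) * (lorentz M p q F + lorentz M p q G))"
    unfolding lorentz_def using assms by (intro mult_left_mono ennpowr_add_le) auto
  also have "\<dots> = ennreal (?c * 2 powr (1 / q)) * (lorentz M p q F + lorentz M p q G)"
    by (subst ennreal_mult) (auto simp: mult.assoc)
  also have "\<dots> \<le> ennreal (lorentz_quasi_const p q) * (lorentz M p q F + lorentz M p q G)"
    unfolding lorentz_quasi_const_def by (intro mult_right_mono ennreal_leI) auto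
  finally show ?thesis .
qed

text \<open>The constant is exponential in the number of terms, which is harmless because it is
  applied only to the at most 3^n neighbours of a cube.\<close>

lemma lorentz_sum_le:
  assumes "finite I" "\<And>i. i \<in> I \<Longrightarrow> F i \<in> borel_measurable M" and "0 < p" "0 < q"
  shows "lorentz M p q (\<lambda>x. \<Sum>i\<in>I. F i x)
    \<le> ennreal (lorentz_quasi_const p q ^ card I) * (\<Sum>i\<in>I. lorentz M p q (F i))"
  using assms(1,2)
proof (induction I rule: finite_induct)
  case empty
  have "lorentz M p q (\<lambda>x. 0 * (0 :: ennreal)) \<le> 0 * lorentz M p q (\<lambda>x. 0)"
    using assms by (intro lorentz_cmult_le) auto
  then show ?case by simp
next
  case (insert i I)
  let ?K = "lorentz_quasi_const p q"
  have K: "1 \<le> ?K" by (simp add: lorentz_quasi_const_def)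
  have [measurable]: "(\<lambda>x. \<Sum>i\<in>I. F i x) \<in> borel_measurable M" "F i \<in> borel_measurable M"
    using insert by auto
  have "lorentz M p q (\<lambda>x. \<Sum>i\<in>insert i I. F i x) = lorentz M p q (\<lambda>x. F i x + (\<Sum>i\<in>I. F i x))"
    using insert by simp
  also have "\<dots> \<le> ennreal ?K * (lorentz M p q (F i) + lorentz M p q (\<lambda>x. \<Sum>i\<in>I. F i x))"
    using assms by (intro lorentz_add_le) auto
  also have "\<dots> \<le> ennreal ?K * (ennreal (?K ^ card I) * lorentz M p q (F i) + ennreal (?K ^ card I) * (\<Sum>i\<in>I. lorentz M p q (F i)))"
  proof (intro mult_left_mono add_mono)
    have "1 * lorentz M p q (F i) \<le> ennreal (?K ^ card I) * lorentz M p q (F i)"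
      using K by (intro mult_right_mono) (auto simp flip: ennreal_1 intro!: ennreal_leI)
    then show "lorentz M p q (F i) \<le> ennreal (?K ^ card I) * lorentz M p q (F i)" by simp
  qed (use insert in auto)
  also have "\<dots> = ennreal (?K ^ Suc (card I)) * (lorentz M p q (F i) + (\<Sum>i\<in>I. lorentz M p q (F i)))"
    using K by (simp add: ennreal_mult distrib_left mult.assoc del: ennreal_power)
  finally show ?case using insert by simp
qed

lemma lorentz_maximal_le:
  assumes "1 < p" "1 < q"
  obtains C where "0 < C"
    "\<And>F :: real ^ 'n \<Rightarrow> ennreal. F \<in> borel_measurable lebesgue \<Longrightarrow>
      lorentz lebesgue p q (maximal F) \<le> ennreal C * lorentz lebesgue p q F"
proof -
  obtain C where C: "0 < C" "\<And>F :: real ^ 'n \<Rightarrow> ennreal. F \<in> borel_measurable lebesgue \<Longrightarrow>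
      lorentz_int lebesgue p q (maximal F) \<le> ennreal C * lorentz_int lebesgue p q F"
    using lorentz_int_maximal_le [of p q] assms by auto
  show thesis
  proof (rule that)
    show "0 < C powr (1 / q)" using C by simp
    fix F :: "real ^ 'n \<Rightarrow> ennreal" assume "F \<in> borel_measurable lebesgue"
    then show "lorentz lebesgue p q (maximal F) \<le> ennreal (C powr (1 / q)) * lorentz lebesgue p q F"
      unfolding lorentz_def [of _ _ _ F] using C assms by (intro lorentz_int_le_imp_lorentz_le) auto
  qed
qed

lemma lorentz_le_indicator:
  assumes "F \<in> borel_measurable M" "A \<in> sets M"
    and "\<And>x. x \<in> space M \<Longrightarrow> F x \<le> c * indicator A x"
    and a: "0 < a" "emeasure M A \<le> ennreal a" and pq: "0 < p" "0 < q"
  shows "lorentz M p q F \<le> ennreal ((p / q) powr (1 / q) * a powr (1 / p)) * c"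
proof -
  have "lorentz_int M p q F \<le> ennpowr c q * ennreal (p / q * a powr (q / p))"
    by (rule lorentz_int_le_indicator) (use assms in auto)
  then have "lorentz_int M p q F \<le> ennreal (p / q * a powr (q / p)) * ennpowr c q"
    by (simp add: mult.commute)
  then have "lorentz M p q F \<le> ennreal ((p / q * a powr (q / p)) powr (1 / q)) * ennpowr (ennpowr c q) (1 / q)"
    using pq by (intro lorentz_int_le_imp_lorentz_le) auto
  then show ?thesis
    using pq a by (simp add: ennpowr_ennpowr powr_mult powr_powr powr_divide)
qed

lemma cube_vol_near_ancestor:
  fixes Q R :: "int \<times> (int ^ 'n)"
  assumes "near_ancestor l Q R"
  shows "cube_vol Q = cube_vol R * 2 powr (- (real l * real CARD('n)))"
proof -
  have "fst Q = fst R + int l" using assms by (simp add: near_ancestor_def)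
  then show ?thesis by (simp add: cube_vol_def algebra_simps flip: powr_add)
qed

text \<open>Here \<open>\<nu>\<close> is the coefficient in front of a block. The first bound gives
  the full L^1 norm of a block on \<open>Q\<close>; the second integrates a function normalised on
  \<open>R\<close> over another cube \<open>Q\<close>, for use when \<open>R\<close> is much
  larger.\<close>

lemma nn_integral_block_le:
  assumes p: "1 < p" and q: "0 < q" and t: "1 < t"
  obtains C where "0 < C"
    "\<And>(F :: real ^ 'n \<Rightarrow> ennreal) Q \<nu>. F \<in> borel_measurable lebesgue \<Longrightarrow>
      (\<And>x. x \<notin> dyadic_cube Q \<Longrightarrow> F x = 0) \<Longrightarrow>
      lorentz lebesgue p q F \<le> ennreal (cube_vol Q powr (1 / p - 1 / t)) * \<nu> \<Longrightarrow>
      (\<integral>\<^sup>+x. F x \<partial>lebesgue) \<le> ennreal (C * cube_vol Q powr (1 - 1 / t)) * \<nu>"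
    "\<And>(F :: real ^ 'n \<Rightarrow> ennreal) Q (R :: int \<times> (int ^ 'n)) \<nu>. F \<in> borel_measurable lebesgue \<Longrightarrow>
      lorentz lebesgue p q F \<le> ennreal (cube_vol R powr (1 / p - 1 / t)) * \<nu> \<Longrightarrow>
      (\<integral>\<^sup>+x \<in> dyadic_cube Q. F x \<partial>lebesgue)
        \<le> ennreal (C * cube_vol Q powr (1 - 1 / p) * cube_vol R powr (1 / p - 1 / t)) * \<nu>"
proof -
  obtain C where C: "0 < C"
    "\<And>(F :: real ^ 'n \<Rightarrow> ennreal) A a. F \<in> borel_measurable lebesgue \<Longrightarrow> A \<in> sets lebesgue \<Longrightarrow> 0 < a \<Longrightarrow> emeasure lebesgue A \<le> ennreal a \<Longrightarrow>
      (\<integral>\<^sup>+x. F x * indicator A x \<partial>lebesgue)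
        \<le> ennreal (C * a powr (1 - 1 / p)) * ennpowr (lorentz_int lebesgue p q F) (1 / q)"
    using nn_integral_le_lorentz_int [OF p q] by blast
  have 2: "(\<integral>\<^sup>+x \<in> dyadic_cube Q. F x \<partial>lebesgue)
        \<le> ennreal (C * cube_vol Q powr (1 - 1 / p) * cube_vol R powr (1 / p - 1 / t)) * \<nu>"
    if F: "F \<in> borel_measurable lebesgue" "lorentz lebesgue p q F \<le> ennreal (cube_vol R powr (1 / p - 1 / t)) * \<nu>"
    for F :: "real ^ 'n \<Rightarrow> ennreal" and Q and R :: "int \<times> (int ^ 'n)" and \<nu>
  proof -
    have "(\<integral>\<^sup>+x \<in> dyadic_cube Q. F x \<partial>lebesgue) \<le> ennreal (C * cube_vol Q powr (1 - 1 / p)) * lorentz lebesgue p q F"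
      unfolding lorentz_def
      using F cube_vol_pos [of Q] dyadic_cube_borel [of Q] emeasure_lborel_dyadic_cube [of Q] by (intro C(2)) auto
    also have "\<dots> \<le> ennreal (C * cube_vol Q powr (1 - 1 / p)) * (ennreal (cube_vol R powr (1 / p - 1 / t)) * \<nu>)"
      using F by (intro mult_left_mono) auto
    also have "\<dots> = ennreal (C * cube_vol Q powr (1 - 1 / p) * cube_vol R powr (1 / p - 1 / t)) * \<nu>"
      using C(1) by (subst (2) ennreal_mult) (auto simp: mult.assoc)
    finally show ?thesis .
  qed
  have 1: "(\<integral>\<^sup>+x. F x \<partial>lebesgue) \<le> ennreal (C * cube_vol Q powr (1 - 1 / t)) * \<nu>"
    if F: "F \<in> borel_measurable lebesgue" "\<And>x. x \<notin> dyadic_cube Q \<Longrightarrow> F x = 0"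
      "lorentz lebesgue p q F \<le> ennreal (cube_vol Q powr (1 / p - 1 / t)) * \<nu>"
    for F :: "real ^ 'n \<Rightarrow> ennreal" and Q \<nu>
  proof -
    have "(\<integral>\<^sup>+x. F x \<partial>lebesgue) = (\<integral>\<^sup>+x \<in> dyadic_cube Q. F x \<partial>lebesgue)"
      using F(2) by (intro nn_integral_cong) (auto split: split_indicator)
    also have "\<dots> \<le> ennreal (C * cube_vol Q powr (1 - 1 / p) * cube_vol Q powr (1 / p - 1 / t)) * \<nu>"
      using F by (intro 2)
    also have "C * cube_vol Q powr (1 - 1 / p) * cube_vol Q powr (1 / p - 1 / t) = C * cube_vol Q powr (1 - 1 / t)"
      by (simp add: mult.assoc flip: powr_add)
    finally show ?thesis .
  qed
  show thesis by (rule that [OF C(1) 1 2])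
qed

text \<open>Dyadic nesting: a cube of an earlier generation sharing a point with \<open>Q\<close> is
  its ancestor, in particular adjacent to it.\<close>

lemma near_ancestor_if_meets:
  assumes "x \<in> dyadic_cube Q" "x \<in> dyadic_cube R" "fst R = fst Q - int l"
  shows "near_ancestor l Q R" "snd R = (\<chi> i. snd Q $ i div 2 ^ l)"
proof -
  have Q: "Q = cube_at (fst Q) x" and R: "R = cube_at (fst Q - int l) x"
    using assms mem_dyadic_cube_cube_at by metis+
  have "snd R $ i = snd Q $ i div 2 ^ l" for i
  proof -
    have "snd Q $ i = \<lfloor>2 powr real_of_int (fst Q) * x $ i\<rfloor>"
      by (subst Q) (simp add: cube_at_def)
    moreover have "snd R $ i = \<lfloor>2 powr real_of_int (fst Q - int l) * x $ i\<rfloor>"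
      by (subst R) (simp add: cube_at_def)
    ultimately show ?thesis by (simp only: floor_scale)
  qed
  then show "near_ancestor l Q R" "snd R = (\<chi> i. snd Q $ i div 2 ^ l)"
    using assms(3) by (auto simp: near_ancestor_def vec_eq_iff)
qed

text \<open>One term of a finite l^r sum. This later permits real coefficients.\<close>

lemma spread_coeff_finite:
  fixes w :: "int \<times> (int ^ 'n) \<Rightarrow> ennreal"
  assumes t: "1 < t" and r: "1 \<le> r" "r < t"
    and w: "(\<integral>\<^sup>+Q. ennpowr (w Q) r \<partial>count_space UNIV) < top"
  shows "spread_coeff (real CARD('n) * (1 - 1 / t)) w R < top"
proof -
  let ?s = "spread_coeff (real CARD('n) * (1 - 1 / t)) w"
  obtain C where C: "0 < C" "(\<integral>\<^sup>+R. ennpowr (?s R) r \<partial>count_space UNIV)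
        \<le> ennreal C * (\<integral>\<^sup>+Q. ennpowr (w Q) r \<partial>count_space UNIV)"
    using spread_coeff_lr_bound [OF t r] by blast
  have "ennpowr (?s R) r \<le> (\<integral>\<^sup>+R. ennpowr (?s R) r \<partial>count_space UNIV)"
    by (rule nn_integral_ge_point [OF UNIV_I])
  also have "\<dots> < top"
    using C(2) w by (auto simp: ennreal_mult_less_top intro: le_less_trans)
  finally show ?thesis
    by (simp add: ennpowr_less_top_iff)
qed

text \<open>Small cubes meeting the unit cube \<open>R0\<close> are controlled by \<^const>\<open>spread_coeff\<close> at \<open>R0\<close>; of the
  large cubes only the ancestors of \<open>R0\<close> meet it.\<close>

lemma block_sum_locally_integrable:
  fixes H :: "int \<times> (int ^ 'n) \<Rightarrow> real ^ 'n \<Rightarrow> ennreal"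
  assumes p: "1 < p" and q: "0 < q" and t: "1 < t" "t \<le> p" and r: "1 \<le> r" "r < t" "r = 1 \<or> t < p"
    and [measurable]: "\<And>R. H R \<in> borel_measurable lebesgue"
    and supp: "\<And>R x. x \<notin> dyadic_cube R \<Longrightarrow> H R x = 0"
    and H: "\<And>R. lorentz lebesgue p q (H R) \<le> ennreal (cube_vol R powr (1 / p - 1 / t)) * \<nu> R"
    and \<nu>: "(\<integral>\<^sup>+R. ennpowr (\<nu> R) r \<partial>count_space UNIV) < top"
    and R0: "fst R0 = 0"
  shows "(\<integral>\<^sup>+R. (\<integral>\<^sup>+x \<in> dyadic_cube R0. H R x \<partial>lebesgue) \<partial>count_space UNIV) < top"
proof -
  define n where "n = real CARD('n)"
  define \<alpha> where "\<alpha> = n * (1 - 1 / t)"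
  define \<gamma> where "\<gamma> = n * (1 / t - 1 / p)"
  have n: "0 < n" by (simp add: n_def)
  obtain C where C: "0 < C"
    "\<And>(F :: real ^ 'n \<Rightarrow> ennreal) Q \<nu>. F \<in> borel_measurable lebesgue \<Longrightarrow>
      (\<And>x. x \<notin> dyadic_cube Q \<Longrightarrow> F x = 0) \<Longrightarrow>
      lorentz lebesgue p q F \<le> ennreal (cube_vol Q powr (1 / p - 1 / t)) * \<nu> \<Longrightarrow>
      (\<integral>\<^sup>+x. F x \<partial>lebesgue) \<le> ennreal (C * cube_vol Q powr (1 - 1 / t)) * \<nu>"
    "\<And>(F :: real ^ 'n \<Rightarrow> ennreal) Q (R :: int \<times> (int ^ 'n)) \<nu>. F \<in> borel_measurable lebesgue \<Longrightarrow>
      lorentz lebesgue p q F \<le> ennreal (cube_vol R powr (1 / p - 1 / t)) * \<nu> \<Longrightarrow>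
      (\<integral>\<^sup>+x \<in> dyadic_cube Q. F x \<partial>lebesgue)
        \<le> ennreal (C * cube_vol Q powr (1 - 1 / p) * cube_vol R powr (1 / p - 1 / t)) * \<nu>"
    using nn_integral_block_le [OF p q t(1)] by blast
  define anc :: "nat \<Rightarrow> int \<times> (int ^ 'n)" where "anc k = (- int k, (\<chi> i. snd R0 $ i div 2 ^ k))" for k
  let ?S = "\<lambda>R l. indicator {l. near_ancestor l R R0} l * ennreal (2 powr (- (real l * \<alpha>))) * \<nu> R"
  let ?B = "\<lambda>R k. indicator {k. R = anc k} k * ennreal (2 powr (- (real k * \<gamma>))) * \<nu> R"
  let ?s = "\<lambda>R. \<integral>\<^sup>+l. ?S R l \<partial>count_space UNIV"
  let ?b = "\<lambda>R. \<integral>\<^sup>+k. ?B R k \<partial>count_space UNIV"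
  have vol0: "cube_vol R0 = 1" using R0 by (simp add: cube_vol_def)
  have "(\<integral>\<^sup>+x \<in> dyadic_cube R0. H R x \<partial>lebesgue) \<le> ennreal C * (?s R + ?b R)" for R
  proof (cases "dyadic_cube R \<inter> dyadic_cube R0 = {}")
    case True
    have "H R x * indicator (dyadic_cube R0) x = 0" for x
    proof (cases "x \<in> dyadic_cube R0")
      case inR0: True
      with True have "x \<notin> dyadic_cube R" by blast
      then show ?thesis by (simp add: supp)
    qed simp
    then have "(\<integral>\<^sup>+x \<in> dyadic_cube R0. H R x \<partial>lebesgue) = 0"
      by (simp only: nn_integral_const mult_zero_left)
    then show ?thesis by (simp only: zero_le)
  next
    case False
    then obtain x where x: "x \<in> dyadic_cube R" "x \<in> dyadic_cube R0" by blast
    show ?thesis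
    proof (cases "0 \<le> fst R")
      case True
      \<comment> \<open>Cubes of side at most 1: the L^1 norm |R|^(1 - 1/t) is 2^{-l \<alpha>},
        precisely the weight that \<open>spread_coeff\<close> attaches to \<open>R\<close> below
        \<open>R0\<close>.\<close>
      define l where "l = nat (fst R)"
      have near: "near_ancestor l R R0"
        using near_ancestor_if_meets(1) [OF x] True R0 by (simp add: l_def)
      have "cube_vol R powr (1 - 1 / t) = 2 powr (- (real l * \<alpha>))"
        unfolding cube_vol_near_ancestor [OF near] vol0
        by (simp add: powr_powr \<alpha>_def n_def mult.assoc)
      then have "(\<integral>\<^sup>+x. H R x \<partial>lebesgue) \<le> ennreal (C * 2 powr (- (real l * \<alpha>))) * \<nu> R"
        using C(2) [of "H R" R "\<nu> R"] supp H by simp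
      also have "\<dots> = ennreal C * (ennreal (2 powr (- (real l * \<alpha>))) * \<nu> R)"
        using C(1) by (simp add: ennreal_mult mult.assoc)
      also have "ennreal (2 powr (- (real l * \<alpha>))) * \<nu> R = ?S R l" using near by simp
      also have "ennreal C * ?S R l \<le> ennreal C * (?s R + ?b R)"
        by (intro mult_left_mono add_increasing2 nn_integral_ge_point [OF UNIV_I]) auto
      finally show ?thesis
        by (rule order_trans [rotated]) (auto intro!: nn_integral_mono split: split_indicator)
    next
      case False
      \<comment> \<open>Cubes of side above 1: \<open>R\<close> must be the k-th ancestor of
        \<open>R0\<close>, and its normalisation |R|^(1/p - 1/t) is 2^{-k \<gamma>}.\<close>
      define k where "k = nat (- fst R)"
      have fstR: "fst R = fst R0 - int k" using False R0 by (simp add: k_def)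
      then have anc: "R = anc k"
        using near_ancestor_if_meets(2) [OF x(2,1) fstR] R0 by (cases R) (simp add: anc_def)
      have "cube_vol R powr (1 / p - 1 / t) = 2 powr (- (real k * \<gamma>))"
        using fstR R0 by (simp add: cube_vol_def powr_powr \<gamma>_def n_def algebra_simps)
      then have "(\<integral>\<^sup>+x \<in> dyadic_cube R0. H R x \<partial>lebesgue) \<le> ennreal (C * 2 powr (- (real k * \<gamma>))) * \<nu> R"
        using C(3) [of "H R" R "\<nu> R" R0] H [of R] vol0 by simp
      also have "\<dots> = ennreal C * (ennreal (2 powr (- (real k * \<gamma>))) * \<nu> R)"
        using C(1) by (simp add: ennreal_mult mult.assoc)
      also have "ennreal (2 powr (- (real k * \<gamma>))) * \<nu> R = ?B R k" using anc by simp
      also have "ennreal C * ?B R k \<le> ennreal C * (?s R + ?b R)"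
        by (intro mult_left_mono add_increasing nn_integral_ge_point [OF UNIV_I]) auto
      finally show ?thesis .
    qed
  qed
  then have "(\<integral>\<^sup>+R. (\<integral>\<^sup>+x \<in> dyadic_cube R0. H R x \<partial>lebesgue) \<partial>count_space UNIV)
      \<le> (\<integral>\<^sup>+R. ennreal C * (?s R + ?b R) \<partial>count_space UNIV)"
    by (intro nn_integral_mono)
  also have "\<dots> = ennreal C * ((\<integral>\<^sup>+R. ?s R \<partial>count_space UNIV) + (\<integral>\<^sup>+R. ?b R \<partial>count_space UNIV))"
    by (simp add: nn_integral_cmult nn_integral_add)
  also have "\<dots> < top"
  proof -
    have "(\<integral>\<^sup>+R. ?s R \<partial>count_space UNIV) = spread_coeff \<alpha> \<nu> R0"
      unfolding spread_coeff_def
      by (subst nn_integral_snd_count_space [symmetric]) (simp add: indicator_def)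
    also have "\<dots> < top"
      unfolding \<alpha>_def n_def by (rule spread_coeff_finite [OF t(1) r(1,2) \<nu>])
    finally have s: "(\<integral>\<^sup>+R. ?s R \<partial>count_space UNIV) < top" .
    \<comment> \<open>For r = 1 the exponent \<gamma> may be 0, but the coefficients are summable.
      For t < p one has \<gamma> > 0 and a geometric series, so boundedness of the coefficients by
      their l^r norm is enough.\<close>
    have "(\<integral>\<^sup>+R. ?b R \<partial>count_space UNIV) < top"
      using r(3)
    proof
      assume r1: "r = 1"
      have \<gamma>: "0 \<le> \<gamma>" using n t by (simp add: \<gamma>_def frac_le)
      have "?b R \<le> \<nu> R" for R
      proof -
        have "?b R \<le> (\<integral>\<^sup>+k. \<nu> R * indicator {nat (- fst R)} k \<partial>count_space UNIV)"
        proof (intro nn_integral_mono)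
          fix k
          have "2 powr (- (real k * \<gamma>)) \<le> (1::real)" using \<gamma> powr_mono [of "- (real k * \<gamma>)" 0 2] by simp
          then have "ennreal (2 powr (- (real k * \<gamma>))) * \<nu> R \<le> 1 * \<nu> R"
            by (intro mult_right_mono) auto
          then show "?B R k \<le> \<nu> R * indicator {nat (- fst R)} k"
            by (auto simp: anc_def split: split_indicator)
        qed
        also have "\<dots> = \<nu> R" by (simp add: nn_integral_cmult_indicator)
        finally show ?thesis .
      qed
      then have "(\<integral>\<^sup>+R. ?b R \<partial>count_space UNIV) \<le> (\<integral>\<^sup>+R. \<nu> R \<partial>count_space UNIV)"
        by (rule nn_integral_mono)
      also have "\<dots> < top" using \<nu> r1 by simp
      finally show ?thesis .
    next
      assume tp: "t < p"
      then have \<gamma>: "0 < \<gamma>" using n t p by (simp add: \<gamma>_def frac_less2)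
      define N where "N = ennpowr (\<integral>\<^sup>+R. ennpowr (\<nu> R) r \<partial>count_space UNIV) (1 / r)"
      have N: "\<nu> R \<le> N" for R
        unfolding N_def using r by (intro ennpowr_root_le nn_integral_ge_point [OF UNIV_I]) auto
      have Nfin: "N < top" using \<nu> by (simp add: N_def ennpowr_less_top_iff)
      have "(\<integral>\<^sup>+R. ?b R \<partial>count_space UNIV) = (\<integral>\<^sup>+k. (\<integral>\<^sup>+R. ?B R k \<partial>count_space UNIV) \<partial>count_space UNIV)"
        by (rule nn_integral_count_space_nn_integral) auto
      also have "\<dots> \<le> (\<integral>\<^sup>+k. ennreal (2 powr (- (real k * \<gamma>))) * N \<partial>count_space UNIV)"
      proof (intro nn_integral_mono)
        fix k
        have "(\<integral>\<^sup>+R. ?B R k \<partial>count_space UNIV)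
            \<le> (\<integral>\<^sup>+R. (ennreal (2 powr (- (real k * \<gamma>))) * N) * indicator {anc k} R \<partial>count_space UNIV)"
        proof (intro nn_integral_mono)
          fix R
          have "ennreal (2 powr (- (real k * \<gamma>))) * \<nu> R \<le> ennreal (2 powr (- (real k * \<gamma>))) * N"
            by (intro mult_left_mono N) simp
          then show "?B R k \<le> (ennreal (2 powr (- (real k * \<gamma>))) * N) * indicator {anc k} R"
            by (cases "R = anc k") auto
        qed
        also have "\<dots> = ennreal (2 powr (- (real k * \<gamma>))) * N"
          by (simp add: nn_integral_cmult_indicator)
        finally show "(\<integral>\<^sup>+R. ?B R k \<partial>count_space UNIV) \<le> ennreal (2 powr (- (real k * \<gamma>))) * N" .
      qed
      also have "\<dots> = (\<integral>\<^sup>+k. ennreal (2 powr (- (real k * \<gamma>))) \<partial>count_space UNIV) * N"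
        by (rule nn_integral_multc) simp
      also have "\<dots> < top"
        using Nfin \<gamma> by (simp add: nn_integral_powr_geometric ennreal_mult_less_top)
      finally show ?thesis .
    qed
    with s show ?thesis by (simp add: ennreal_mult_less_top)
  qed
  finally show ?thesis .
qed

section \<open>Majorising the maximal function by blocks\<close>

lemma compact_subset_unit_cubes:
  fixes K :: "(real ^ 'n) set"
  assumes "compact K"
  obtains S :: "(int \<times> (int ^ 'n)) set"
  where "finite S" "\<And>R. R \<in> S \<Longrightarrow> fst R = 0" "K \<subseteq> (\<Union>R\<in>S. dyadic_cube R)"
proof -
  obtain B where B: "\<And>x. x \<in> K \<Longrightarrow> norm x \<le> B"
    using compact_imp_bounded [OF assms] by (auto simp: bounded_iff)
  define S where "S = Pair (0 :: int) ` {m :: int ^ 'n. \<forall>i. m $ i \<in> {\<lfloor>- B\<rfloor>..\<lfloor>B\<rfloor>}}"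
  show thesis
  proof (rule that)
    show "finite S" unfolding S_def by (intro finite_imageI card_int_vec_box(1)) auto
    show "\<And>R. R \<in> S \<Longrightarrow> fst R = 0" by (auto simp: S_def)
    show "K \<subseteq> (\<Union>R\<in>S. dyadic_cube R)"
    proof
      fix x assume "x \<in> K"
      then have "\<bar>x $ i\<bar> \<le> B" for i using B component_le_norm_cart [of x i] by force
      then have "\<lfloor>x $ i\<rfloor> \<in> {\<lfloor>- B\<rfloor>..\<lfloor>B\<rfloor>}" for i
        by (auto simp: abs_le_iff intro!: floor_mono) (metis minus_le_iff)
      then have "cube_at 0 x \<in> S" by (auto simp: cube_at_def S_def)
      moreover have "x \<in> dyadic_cube (cube_at 0 x)"
        by (simp add: mem_dyadic_cube_cube_at cube_at_def)
      ultimately show "x \<in> (\<Union>R\<in>S. dyadic_cube R)" by blast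
    qed
  qed
qed

text \<open>On each ball the integral of |f| is at most that of the remainder plus the full sum of
  the integrals of the |g i|; the remainder disappears in the limit along the net.\<close>

lemma maximal_le_sum:
  fixes f :: "real ^ 'n \<Rightarrow> complex" and g :: "'i::countable \<Rightarrow> real ^ 'n \<Rightarrow> complex"
  assumes [measurable]: "f \<in> borel_measurable lebesgue" "\<And>i. g i \<in> borel_measurable lebesgue"
    and "sums_L1loc g f"
  shows "maximal (\<lambda>y. ennreal (norm (f y))) x \<le> (\<integral>\<^sup>+i. maximal (\<lambda>y. ennreal (norm (g i y))) x \<partial>count_space UNIV)"
proof (rule maximal_leI)
  fix c :: "real ^ 'n" and \<rho> :: real assume \<rho>: "0 < \<rho>" "x \<in> ball c \<rho>"
  let ?B = "ball c \<rho>"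
  have [measurable]: "?B \<in> sets lebesgue" by simp
  let ?S = "\<integral>\<^sup>+i. (\<integral>\<^sup>+y \<in> ?B. ennreal (norm (g i y)) \<partial>lebesgue) \<partial>count_space UNIV"
  \<comment> \<open>The closed ball, because \<open>sums_L1loc\<close> gives convergence on compact
    sets.\<close>
  let ?X = "\<lambda>A. \<integral>\<^sup>+y \<in> cball c \<rho>. ennreal (norm (f y - (\<Sum>i\<in>A. g i y))) \<partial>lebesgue"
  have le: "(\<integral>\<^sup>+y \<in> ?B. ennreal (norm (f y)) \<partial>lebesgue) \<le> ?X A + ?S" if "finite A" for A
  proof -
    have "(\<integral>\<^sup>+y \<in> ?B. ennreal (norm (f y)) \<partial>lebesgue)
        \<le> (\<integral>\<^sup>+y. ennreal (norm (f y - (\<Sum>i\<in>A. g i y))) * indicator ?B y + (\<Sum>i\<in>A. ennreal (norm (g i y)) * indicator ?B y) \<partial>lebesgue)"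
    proof (intro nn_integral_mono)
      fix y
      have "norm (f y) \<le> norm (f y - (\<Sum>i\<in>A. g i y)) + norm (\<Sum>i\<in>A. g i y)"
        by (metis diff_add_cancel norm_triangle_ineq)
      also have "\<dots> \<le> norm (f y - (\<Sum>i\<in>A. g i y)) + (\<Sum>i\<in>A. norm (g i y))"
        by (intro add_left_mono norm_sum)
      finally have "ennreal (norm (f y)) \<le> ennreal (norm (f y - (\<Sum>i\<in>A. g i y)) + (\<Sum>i\<in>A. norm (g i y)))"
        by (rule ennreal_leI)
      also have "\<dots> = ennreal (norm (f y - (\<Sum>i\<in>A. g i y))) + (\<Sum>i\<in>A. ennreal (norm (g i y)))"
        by (subst ennreal_plus) (auto intro: sum_nonneg simp: sum_ennreal)
      finally show "ennreal (norm (f y)) * indicator ?B y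
          \<le> ennreal (norm (f y - (\<Sum>i\<in>A. g i y))) * indicator ?B y + (\<Sum>i\<in>A. ennreal (norm (g i y)) * indicator ?B y)"
        by (auto split: split_indicator)
    qed
    also have "\<dots> = (\<integral>\<^sup>+y \<in> ?B. ennreal (norm (f y - (\<Sum>i\<in>A. g i y))) \<partial>lebesgue)
        + (\<Sum>i\<in>A. \<integral>\<^sup>+y \<in> ?B. ennreal (norm (g i y)) \<partial>lebesgue)"
      by (subst nn_integral_add) (auto simp: nn_integral_sum)
    also have "\<dots> \<le> ?X A + ?S"
      using that by (intro add_mono nn_integral_count_space_sum_le nn_integral_mono) (auto split: split_indicator)
    finally show ?thesis .
  qed
  have "(?X \<longlongrightarrow> 0) (finite_subsets_at_top UNIV)"
    using assms(3) compact_cball [of c \<rho>] unfolding sums_L1loc_def by blast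
  then have "((\<lambda>A. ?X A + ?S) \<longlongrightarrow> 0 + ?S) (finite_subsets_at_top UNIV)"
    by (intro tendsto_add tendsto_const)
  moreover have "\<forall>\<^sub>F A in finite_subsets_at_top UNIV. (\<integral>\<^sup>+y \<in> ?B. ennreal (norm (f y)) \<partial>lebesgue) \<le> ?X A + ?S"
    by (rule eventually_finite_subsets_at_top_weakI) (use le in auto)
  ultimately have "(\<integral>\<^sup>+y \<in> ?B. ennreal (norm (f y)) \<partial>lebesgue) \<le> 0 + ?S"
    by (rule tendsto_lowerbound) simp
  then have "(\<integral>\<^sup>+y \<in> ?B. ennreal (norm (f y)) \<partial>lebesgue) / emeasure lebesgue ?B \<le> ?S / emeasure lebesgue ?B"
    by (intro divide_right_mono_ennreal) simp
  also have "\<dots> = (\<integral>\<^sup>+i. (\<integral>\<^sup>+y \<in> ?B. ennreal (norm (g i y)) \<partial>lebesgue) / emeasure lebesgue ?B \<partial>count_space UNIV)"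
    by (rule nn_integral_divide [symmetric]) simp
  also have "\<dots> \<le> (\<integral>\<^sup>+i. maximal (\<lambda>y. ennreal (norm (g i y))) x \<partial>count_space UNIV)"
    using \<rho> by (intro nn_integral_mono maximal_ge)
  finally show "(\<integral>\<^sup>+y \<in> ?B. ennreal (norm (f y)) \<partial>lebesgue) / emeasure lebesgue ?B
      \<le> (\<integral>\<^sup>+i. maximal (\<lambda>y. ennreal (norm (g i y))) x \<partial>count_space UNIV)" .
qed

lemma maximal_cmult_le:
  fixes F :: "real ^ 'n \<Rightarrow> ennreal"
  assumes "F \<in> borel_measurable lebesgue"
  shows "maximal (\<lambda>y. c * F y) x \<le> c * maximal F x"
proof (rule maximal_leI)
  fix a :: "real ^ 'n" and \<rho> :: real assume \<rho>: "0 < \<rho>" "x \<in> ball a \<rho>"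
  have "(\<integral>\<^sup>+y \<in> ball a \<rho>. c * F y \<partial>lebesgue) = c * (\<integral>\<^sup>+y \<in> ball a \<rho>. F y \<partial>lebesgue)"
    unfolding mult.assoc using assms by (intro nn_integral_cmult borel_measurable_times_ennreal borel_measurable_indicator) auto
  then have "(\<integral>\<^sup>+y \<in> ball a \<rho>. c * F y \<partial>lebesgue) / emeasure lebesgue (ball a \<rho>)
      = c * ((\<integral>\<^sup>+y \<in> ball a \<rho>. F y \<partial>lebesgue) / emeasure lebesgue (ball a \<rho>))"
    by (simp only: ennreal_times_divide)
  also have "\<dots> \<le> c * maximal F x"
    using \<rho> by (intro mult_left_mono maximal_ge) auto
  finally show "(\<integral>\<^sup>+y \<in> ball a \<rho>. c * F y \<partial>lebesgue) / emeasure lebesgue (ball a \<rho>) \<le> c * maximal F x" .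
qed

text \<open>Outside the neighbours of its cube the maximal function of a block decays like the
  reciprocal volume, so it is a sum of multiples of indicators of neighbours of ancestors.\<close>

lemma maximal_majorant:
  assumes p: "1 < p" and q: "1 < q" and t: "1 < t"
  obtains K where "0 < K"
    "\<And>(F :: int \<times> (int ^ 'n) \<Rightarrow> real ^ 'n \<Rightarrow> ennreal)
        (w :: int \<times> (int ^ 'n) \<Rightarrow> ennreal).
      (\<And>Q. F Q \<in> borel_measurable lebesgue) \<Longrightarrow>
      (\<And>Q x. x \<notin> dyadic_cube Q \<Longrightarrow> F Q x = 0) \<Longrightarrow>
      (\<And>Q. lorentz lebesgue p q (F Q) \<le> ennreal (cube_vol Q powr (1 / p - 1 / t))) \<Longrightarrow>
      \<exists>H. (\<forall>R. H R \<in> borel_measurable lebesgue) \<and> (\<forall>R x. x \<notin> dyadic_cube R \<longrightarrow> H R x = 0) \<and>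
        (\<forall>R. lorentz lebesgue p q (H R) \<le> ennreal (cube_vol R powr (1 / p - 1 / t)) *
          (ennreal K * spread_coeff (real CARD('n) * (1 - 1 / t)) w R)) \<and>
        (\<forall>R x. spread_coeff (real CARD('n) * (1 - 1 / t)) w R = 0 \<longrightarrow> H R x = 0) \<and>
        (\<forall>x. (\<integral>\<^sup>+Q. w Q * maximal (F Q) x \<partial>count_space UNIV) \<le> (\<integral>\<^sup>+R. H R x \<partial>count_space UNIV))"
proof -
  define n where "n = real CARD('n)"
  define \<alpha> where "\<alpha> = n * (1 - 1 / t)"
  have q0: "0 < q" using q by simp
  obtain C1 where C1: "0 < C1"
    "\<And>(F :: real ^ 'n \<Rightarrow> ennreal) Q \<nu>. F \<in> borel_measurable lebesgue \<Longrightarrow>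
      (\<And>x. x \<notin> dyadic_cube Q \<Longrightarrow> F x = 0) \<Longrightarrow>
      lorentz lebesgue p q F \<le> ennreal (cube_vol Q powr (1 / p - 1 / t)) * \<nu> \<Longrightarrow>
      (\<integral>\<^sup>+x. F x \<partial>lebesgue) \<le> ennreal (C1 * cube_vol Q powr (1 - 1 / t)) * \<nu>"
    "\<And>(F :: real ^ 'n \<Rightarrow> ennreal) Q (R :: int \<times> (int ^ 'n)) \<nu>. F \<in> borel_measurable lebesgue \<Longrightarrow>
      lorentz lebesgue p q F \<le> ennreal (cube_vol R powr (1 / p - 1 / t)) * \<nu> \<Longrightarrow>
      (\<integral>\<^sup>+x \<in> dyadic_cube Q. F x \<partial>lebesgue)
        \<le> ennreal (C1 * cube_vol Q powr (1 - 1 / p) * cube_vol R powr (1 / p - 1 / t)) * \<nu>"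
    using nn_integral_block_le [OF p q0 t] by blast
  obtain C2 where C2: "0 < C2"
    "\<And>F :: real ^ 'n \<Rightarrow> ennreal. F \<in> borel_measurable lebesgue \<Longrightarrow>
      lorentz lebesgue p q (maximal F) \<le> ennreal C2 * lorentz lebesgue p q F"
    using lorentz_maximal_le [OF p q] by blast
  \<comment> \<open>The decay constant of \<open>maximal_near_or_far\<close> times the L^1 bound of
    a block.\<close>
  define A where "A = 4 ^ CARD('n) / ball_vol TYPE('n) * C1"
  have A: "0 < A" using C1 ball_vol_pos [where 'n = 'n] by (simp add: A_def)
  define k where "k = lorentz_quasi_const p q"
  have k: "1 \<le> k" by (simp add: k_def lorentz_quasi_const_def)
  define N :: nat where "N = 3 ^ CARD('n)"
  define K1 where "K1 = k ^ N * (N * C2)"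
  define K2 where "K2 = (p / q) powr (1 / q) * A"
  define K where "K = k * (K1 + K2)"
  have K12: "0 \<le> K1" "0 < K2" using k C2 A p q by (auto simp: K1_def K2_def)
  show thesis
  proof (rule that)
    show "0 < K" using K12 k by (simp add: K_def)
    fix F :: "int \<times> (int ^ 'n) \<Rightarrow> real ^ 'n \<Rightarrow> ennreal"
      and w :: "int \<times> (int ^ 'n) \<Rightarrow> ennreal"
    assume Fm [measurable]: "\<And>Q. F Q \<in> borel_measurable lebesgue"
      and F0: "\<And>Q x. x \<notin> dyadic_cube Q \<Longrightarrow> F Q x = 0"
      and FL: "\<And>Q. lorentz lebesgue p q (F Q) \<le> ennreal (cube_vol Q powr (1 / p - 1 / t))"
    define s where "s = spread_coeff \<alpha> w"
    define N0 where "N0 R = {Q. near_ancestor 0 Q R}" for R :: "int \<times> (int ^ 'n)"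
    have finN0: "finite (N0 R)" for R unfolding N0_def by (rule finite_near_ancestor)
    have cardN0: "card (N0 R) \<le> N" for R
      using card_near_ancestor [of 0 R] by (simp add: N0_def N_def)
    \<comment> \<open>The height of the far part per unit coefficient: on \<open>R\<close> the power
      |R|^(-1/t) has Lorentz norm comparable to |R|^(1/p - 1/t), the block normalisation.\<close>
    define far where "far R = ennreal (A * cube_vol R powr (- (1 / t)))" for R :: "int \<times> (int ^ 'n)"
    define H where "H R x = indicator (dyadic_cube R) x * ((\<Sum>Q\<in>N0 R. w Q * maximal (F Q) x) + far R * s R)" for R x
    have Hm [measurable]: "H R \<in> borel_measurable lebesgue" for R
      unfolding H_def by measurable
    \<comment> \<open>The terms l = 0 are included in \<open>spread_coeff\<close>, so the single
      coefficient \<open>s R\<close> controls the near part as well as the far part.\<close>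
    have ws: "w Q \<le> s R" if "Q \<in> N0 R" for Q R
      using spread_coeff_ge [of 0 Q R \<alpha> w] that by (simp add: N0_def s_def)
    have HL: "lorentz lebesgue p q (H R) \<le> ennreal (cube_vol R powr (1 / p - 1 / t)) * (ennreal K * s R)" for R
    proof -
      let ?v = "cube_vol R powr (1 / p - 1 / t)"
      let ?X = "\<lambda>x. \<Sum>Q\<in>N0 R. w Q * maximal (F Q) x" and ?Y = "\<lambda>x. (far R * s R) * indicator (dyadic_cube R) x"
      have "lorentz lebesgue p q (H R) \<le> lorentz lebesgue p q (\<lambda>x. ?X x + ?Y x)"
        using q by (intro lorentz_mono) (auto simp: H_def split: split_indicator)
      also have "\<dots> \<le> ennreal k * (lorentz lebesgue p q ?X + lorentz lebesgue p q ?Y)"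
        unfolding k_def using p q by (intro lorentz_add_le) auto
      also have "lorentz lebesgue p q ?X \<le> ennreal (k ^ N) * (\<Sum>Q\<in>N0 R. ennreal C2 * (ennreal ?v * s R))"
      proof -
        have "lorentz lebesgue p q ?X \<le> ennreal (k ^ card (N0 R)) * (\<Sum>Q\<in>N0 R. lorentz lebesgue p q (\<lambda>x. w Q * maximal (F Q) x))"
          unfolding k_def using p q finN0 by (intro lorentz_sum_le) auto
        also have "\<dots> \<le> ennreal (k ^ N) * (\<Sum>Q\<in>N0 R. ennreal C2 * (ennreal ?v * s R))"
        proof (intro mult_mono sum_mono)
          show "ennreal (k ^ card (N0 R)) \<le> ennreal (k ^ N)"
            using cardN0 k by (intro ennreal_leI power_increasing)
          fix Q assume Q: "Q \<in> N0 R"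
          have "lorentz lebesgue p q (\<lambda>x. w Q * maximal (F Q) x) \<le> w Q * lorentz lebesgue p q (maximal (F Q))"
            using q by (intro lorentz_cmult_le) auto
          also have "\<dots> \<le> s R * (ennreal C2 * ennreal ?v)"
          proof (intro mult_mono)
            have "cube_vol Q = cube_vol R"
              using cube_vol_near_ancestor [of 0 Q R] Q by (simp add: N0_def)
            then show "lorentz lebesgue p q (maximal (F Q)) \<le> ennreal C2 * ennreal ?v"
              using FL [of Q] by (intro order_trans [OF C2(2) [OF Fm]] mult_left_mono) auto
          qed (use ws Q in auto)
          finally show "lorentz lebesgue p q (\<lambda>x. w Q * maximal (F Q) x) \<le> ennreal C2 * (ennreal ?v * s R)"
            by (simp only: mult_ac)
        qed auto
        finally show ?thesis .
      qed
      also have "(\<Sum>Q\<in>N0 R. ennreal C2 * (ennreal ?v * s R)) \<le> ennreal N * (ennreal C2 * (ennreal ?v * s R))"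
        using cardN0 [of R] unfolding sum_constant
        by (intro mult_right_mono) (auto simp: ennreal_of_nat_eq_real_of_nat intro!: ennreal_leI)
      also have "lorentz lebesgue p q ?Y \<le> ennreal K2 * (ennreal ?v * s R)"
      proof -
        have "lorentz lebesgue p q ?Y \<le> ennreal ((p / q) powr (1 / q) * cube_vol R powr (1 / p)) * (far R * s R)"
          using p q cube_vol_pos [of R] emeasure_lborel_dyadic_cube [of R] dyadic_cube_borel [of R]
          by (intro lorentz_le_indicator [where A = "dyadic_cube R"]) auto
        also have "\<dots> = ennreal ((p / q) powr (1 / q) * cube_vol R powr (1 / p) * (A * cube_vol R powr (- (1 / t)))) * s R"
          unfolding far_def using A by (subst (3) ennreal_mult) (auto simp: mult.assoc)
        also have "(p / q) powr (1 / q) * cube_vol R powr (1 / p) * (A * cube_vol R powr (- (1 / t)))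
            = K2 * (cube_vol R powr (1 / p) * cube_vol R powr (- (1 / t)))"
          by (simp only: K2_def mult_ac)
        also have "cube_vol R powr (1 / p) * cube_vol R powr (- (1 / t)) = ?v"
          by (simp flip: powr_add)
        finally show ?thesis using K12 by (simp add: ennreal_mult mult.assoc)
      qed
      finally have "lorentz lebesgue p q (H R) \<le> ennreal k * (ennreal (k ^ N) * (ennreal N * (ennreal C2 * (ennreal ?v * s R))) + ennreal K2 * (ennreal ?v * s R))"
        by (simp add: mult_left_mono add_mono)
      also have "ennreal (k ^ N) * (ennreal N * (ennreal C2 * (ennreal ?v * s R))) = ennreal K1 * (ennreal ?v * s R)"
        using k C2(1) by (simp add: K1_def ennreal_mult mult.assoc del: ennreal_power)
      also have "ennreal k * (ennreal K1 * (ennreal ?v * s R) + ennreal K2 * (ennreal ?v * s R)) = ennreal k * ((ennreal K1 + ennreal K2) * (ennreal ?v * s R))"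
        by (simp only: distrib_right)
      also have "\<dots> = ennreal ?v * (ennreal K * s R)"
      proof -
        have e: "ennreal K = ennreal k * (ennreal K1 + ennreal K2)"
          unfolding K_def using K12 k by (subst ennreal_mult) (auto simp: ennreal_plus)
        show ?thesis unfolding e by (simp only: mult_ac)
      qed
      finally show ?thesis .
    qed
    \<comment> \<open>Needed later, when the pieces are divided by their coefficients to become
      blocks.\<close>
    have s0: "H R x = 0" if "s R = 0" for R x
    proof -
      have "w Q = 0" if "Q \<in> N0 R" for Q
        using ws [OF that] \<open>s R = 0\<close> by simp
      then show ?thesis using that by (simp add: H_def)
    qed
    have bound: "(\<integral>\<^sup>+Q. w Q * maximal (F Q) x \<partial>count_space UNIV) \<le> (\<integral>\<^sup>+R. H R x \<partial>count_space UNIV)" for x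
    proof -
      define u where "u Q R l = indicator {l. near_ancestor l Q R} l * ennreal (2 powr (- (real l * \<alpha>))) * w Q"
        for Q R :: "int \<times> (int ^ 'n)" and l
      \<comment> \<open>The share of \<open>Q\<close> in \<open>H R x\<close>. For each
        \<open>Q\<close> a single \<open>R\<close> containing \<open>x\<close> already dominates;
        summing over all \<open>R\<close> avoids a choice and lets Tonelli regroup the shares by
        \<open>R\<close>.\<close>
      define h where "h Q R = indicator (dyadic_cube R) x *
          (w Q * maximal (F Q) x * indicator (N0 R) Q + far R * (\<integral>\<^sup>+l. u Q R l \<partial>count_space UNIV))" for Q R
      have "w Q * maximal (F Q) x \<le> (\<integral>\<^sup>+R. h Q R \<partial>count_space UNIV)" for Q
      proof -
        obtain l R where R: "x \<in> dyadic_cube R" "near_ancestor l Q R"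
          "l = 0 \<or> maximal (F Q) x \<le> ennreal (4 ^ CARD('n) / ball_vol TYPE('n) / cube_vol R) * (\<integral>\<^sup>+y. F Q y \<partial>lebesgue)"
          using maximal_near_or_far [of Q "F Q" x] F0 by blast
        have "w Q * maximal (F Q) x \<le> h Q R"
        proof (cases "l = 0")
          case True
          then show ?thesis using R by (simp add: h_def N0_def)
        next
          case False
          have vR: "0 < cube_vol R" by (rule cube_vol_pos)
          have "maximal (F Q) x \<le> ennreal (4 ^ CARD('n) / ball_vol TYPE('n) / cube_vol R) * (\<integral>\<^sup>+y. F Q y \<partial>lebesgue)"
            using R(3) False by blast
          also have "\<dots> \<le> ennreal (4 ^ CARD('n) / ball_vol TYPE('n) / cube_vol R) * ennreal (C1 * cube_vol Q powr (1 - 1 / t))"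
            using C1(2) [of "F Q" Q 1] F0 FL [of Q] by (intro mult_left_mono) auto
          also have "\<dots> = ennreal (4 ^ CARD('n) / ball_vol TYPE('n) / cube_vol R * (C1 * cube_vol Q powr (1 - 1 / t)))"
            using C1(1) vR ball_vol_pos [where 'n = 'n] by (intro ennreal_mult [symmetric]) auto
          also have "4 ^ CARD('n) / ball_vol TYPE('n) / cube_vol R * (C1 * cube_vol Q powr (1 - 1 / t))
              = A * cube_vol R powr (- (1 / t)) * 2 powr (- (real l * \<alpha>))"
          proof -
            have "cube_vol Q powr (1 - 1 / t) = cube_vol R powr (1 - 1 / t) * 2 powr (- (real l * \<alpha>))"
              unfolding cube_vol_near_ancestor [OF R(2)] using vR
              by (simp add: powr_mult powr_powr \<alpha>_def n_def mult.assoc)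
            moreover have "cube_vol R powr (1 - 1 / t) = cube_vol R * cube_vol R powr (- (1 / t))"
              using vR by (simp add: powr_diff powr_minus inverse_eq_divide)
            ultimately show ?thesis using vR by (simp add: A_def)
          qed
          finally have "maximal (F Q) x \<le> far R * ennreal (2 powr (- (real l * \<alpha>)))"
            using A by (simp add: far_def ennreal_mult)
          then have "w Q * maximal (F Q) x \<le> w Q * (far R * ennreal (2 powr (- (real l * \<alpha>))))"
            by (rule mult_left_mono) simp
          also have "\<dots> = far R * u Q R l"
            using R(2) by (simp add: u_def mult_ac)
          also have "\<dots> \<le> far R * (\<integral>\<^sup>+l. u Q R l \<partial>count_space UNIV)"
            by (intro mult_left_mono nn_integral_ge_point [OF UNIV_I]) auto
          also have "\<dots> \<le> h Q R" using R(1) by (simp add: h_def)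
          finally show ?thesis .
        qed
        also have "\<dots> \<le> (\<integral>\<^sup>+R. h Q R \<partial>count_space UNIV)" by (rule nn_integral_ge_point [OF UNIV_I])
        finally show ?thesis .
      qed
      then have "(\<integral>\<^sup>+Q. w Q * maximal (F Q) x \<partial>count_space UNIV)
          \<le> (\<integral>\<^sup>+Q. (\<integral>\<^sup>+R. h Q R \<partial>count_space UNIV) \<partial>count_space UNIV)"
        by (intro nn_integral_mono)
      also have "\<dots> = (\<integral>\<^sup>+R. (\<integral>\<^sup>+Q. h Q R \<partial>count_space UNIV) \<partial>count_space UNIV)"
        by (rule nn_integral_count_space_nn_integral) auto
      also have "\<dots> = (\<integral>\<^sup>+R. H R x \<partial>count_space UNIV)"
      proof (rule nn_integral_cong)
        fix R
        have "(\<integral>\<^sup>+Q. w Q * maximal (F Q) x * indicator (N0 R) Q \<partial>count_space UNIV) = (\<Sum>Q\<in>N0 R. w Q * maximal (F Q) x)"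
          using finN0 by (subst nn_integral_count_space_indicator [symmetric]) (auto simp: nn_integral_count_space_finite)
        moreover have "(\<integral>\<^sup>+Q. (\<integral>\<^sup>+l. u Q R l \<partial>count_space UNIV) \<partial>count_space UNIV) = s R"
          unfolding s_def spread_coeff_def u_def
          by (subst nn_integral_snd_count_space [symmetric]) (simp add: indicator_def)
        ultimately show "(\<integral>\<^sup>+Q. h Q R \<partial>count_space UNIV) = H R x"
          unfolding h_def H_def by (simp add: nn_integral_cmult nn_integral_add)
      qed
      finally show ?thesis .
    qed
    show "\<exists>H. (\<forall>R. H R \<in> borel_measurable lebesgue) \<and> (\<forall>R x. x \<notin> dyadic_cube R \<longrightarrow> H R x = 0) \<and>
        (\<forall>R. lorentz lebesgue p q (H R) \<le> ennreal (cube_vol R powr (1 / p - 1 / t)) *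
          (ennreal K * spread_coeff (real CARD('n) * (1 - 1 / t)) w R)) \<and>
        (\<forall>R x. spread_coeff (real CARD('n) * (1 - 1 / t)) w R = 0 \<longrightarrow> H R x = 0) \<and>
        (\<forall>x. (\<integral>\<^sup>+Q. w Q * maximal (F Q) x \<partial>count_space UNIV) \<le> (\<integral>\<^sup>+R. H R x \<partial>count_space UNIV))"
      using HL s0 bound unfolding s_def \<alpha>_def n_def
      by (intro exI [of _ H] conjI allI impI) (auto simp: H_def)
  qed
qed

section \<open>From a majorant to a block representation\<close>

lemma borel_measurable_nn_integral_count_space:
  fixes f :: "'i::countable \<Rightarrow> 'a \<Rightarrow> ennreal"
  assumes [measurable]: "\<And>i. f i \<in> borel_measurable M"
  shows "(\<lambda>x. \<integral>\<^sup>+i. f i x \<partial>count_space UNIV) \<in> borel_measurable M"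
proof -
  interpret sigma_finite_measure "count_space (UNIV :: 'i set)"
    by (rule sigma_finite_measure_count_space)
  have "(\<lambda>z. f (snd z) (fst z)) \<in> borel_measurable (M \<Otimes>\<^sub>M count_space UNIV)"
    by (rule measurable_compose_countable' [where g = snd and I = UNIV]) auto
  then show ?thesis
    by (intro borel_measurable_nn_integral) (simp add: case_prod_beta')
qed

text \<open>Given \<open>T \<le> G = (\<Sum>R. H R)\<close>, the pieces of \<open>T\<close> are \<open>(T / G) * H R\<close>.\<close>

lemma block_repr_of_majorant:
  fixes H :: "int \<times> (int ^ 'n) \<Rightarrow> real ^ 'n \<Rightarrow> ennreal" and s :: "int \<times> (int ^ 'n) \<Rightarrow> real"
  assumes p: "1 < p" and q: "0 < q" and t: "1 < t" "t \<le> p" and r: "1 \<le> r" "r < t" "r = 1 \<or> t < p"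
    and Tm [measurable]: "T \<in> borel_measurable lebesgue"
    and Hm [measurable]: "\<And>R. H R \<in> borel_measurable lebesgue"
    and supp: "\<And>R x. x \<notin> dyadic_cube R \<Longrightarrow> H R x = 0"
    and s: "\<And>R. 0 \<le> s R" "\<And>R x. s R = 0 \<Longrightarrow> H R x = 0"
    and H: "\<And>R. lorentz lebesgue p q (H R) \<le> ennreal (cube_vol R powr (1 / p - 1 / t)) * ennreal (s R)"
    and fin: "(\<integral>\<^sup>+R. ennreal (s R powr r) \<partial>count_space UNIV) < top"
    and T: "\<And>x. T x \<le> (\<integral>\<^sup>+R. H R x \<partial>count_space UNIV)"
  shows "AE x in lebesgue. T x < top"
    and "\<exists>b. block_repr p q t r (\<lambda>x. complex_of_real (enn2real (T x))) (\<lambda>R. complex_of_real (s R)) b"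
proof -
  define G where "G x = (\<integral>\<^sup>+R. H R x \<partial>count_space UNIV)" for x
  have [measurable]: "G \<in> borel_measurable lebesgue"
    unfolding G_def by (rule borel_measurable_nn_integral_count_space) (rule Hm)
  have loc0: "(\<integral>\<^sup>+R. (\<integral>\<^sup>+x \<in> dyadic_cube R0. H R x \<partial>lebesgue) \<partial>count_space UNIV) < top" if "fst R0 = 0" for R0
  proof (rule block_sum_locally_integrable [OF p q t r Hm supp H _ that])
    show "(\<integral>\<^sup>+R. ennpowr (ennreal (s R)) r \<partial>count_space UNIV) < top"
      using fin s by (simp add: ennpowr_ennreal)
  qed
  have G0: "(\<integral>\<^sup>+x \<in> dyadic_cube R0. G x \<partial>lebesgue) < top" if "fst R0 = 0" for R0
  proof -
    have "(\<integral>\<^sup>+x \<in> dyadic_cube R0. G x \<partial>lebesgue)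
        = (\<integral>\<^sup>+x. (\<integral>\<^sup>+R. H R x * indicator (dyadic_cube R0) x \<partial>count_space UNIV) \<partial>lebesgue)"
      unfolding G_def by (intro nn_integral_cong nn_integral_multc [symmetric]) simp
    also have "\<dots> = (\<integral>\<^sup>+R. (\<integral>\<^sup>+x \<in> dyadic_cube R0. H R x \<partial>lebesgue) \<partial>count_space UNIV)"
      by (rule nn_integral_count_space_nn_integral) auto
    finally show ?thesis using loc0 [OF that] by simp
  qed
  have AE_G: "AE x in lebesgue. G x < top"
  proof -
    \<comment> \<open>Integrability on a unit cube gives finiteness almost everywhere there, and
      countably many unit cubes cover the space.\<close>
    have "AE x in lebesgue. x \<in> dyadic_cube (0, m) \<longrightarrow> G x < top" for m
    proof -
      have "AE x in lebesgue. G x * indicator (dyadic_cube (0, m)) x \<noteq> \<infinity>"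
        by (rule nn_integral_PInf_AE) (use G0 [of "(0, m)"] in auto)
      then show ?thesis
        by (rule eventually_mono) (auto simp: less_top)
    qed
    then have "AE x in lebesgue. \<forall>m. x \<in> dyadic_cube (0, m) \<longrightarrow> G x < top"
      unfolding AE_all_countable by blast
    then show ?thesis
    proof (rule eventually_mono)
      fix x :: "real ^ 'n"
      assume "\<forall>m. x \<in> dyadic_cube (0, m) \<longrightarrow> G x < top"
      moreover have "x \<in> dyadic_cube (0, snd (cube_at 0 x))"
        by (simp add: mem_dyadic_cube_cube_at cube_at_def)
      ultimately show "G x < top" by blast
    qed
  qed
  have TG: "T x \<le> G x" for x using T by (simp add: G_def)
  show "AE x in lebesgue. T x < top"
    using AE_G by (rule eventually_mono) (rule le_less_trans [OF TG])
  \<comment> \<open>Where \<open>G x\<close> is 0 or infinite the \<open>ennreal\<close> quotient is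
    0, so \<theta> \<le> 1 holds at every point.\<close>
  define \<theta> where "\<theta> x = T x / G x" for x
  have \<theta>m [measurable]: "\<theta> \<in> borel_measurable lebesgue" unfolding \<theta>_def by measurable
  have \<theta>1: "\<theta> x \<le> 1" for x
  proof -
    have "\<theta> x \<le> G x / G x" unfolding \<theta>_def by (intro divide_right_mono_ennreal TG)
    also have "\<dots> \<le> 1" by (cases "G x = 0 \<or> G x = top") (auto simp: ennreal_divide_self less_top)
    finally show ?thesis .
  qed
  define g where "g R x = enn2real (\<theta> x * H R x)" for R x
  have gm [measurable]: "g R \<in> borel_measurable lebesgue" for R unfolding g_def by measurable
  have gle: "ennreal (g R x) \<le> H R x" for R x
  proof -
    have "ennreal (g R x) \<le> \<theta> x * H R x" unfolding g_def by (simp add: ennreal_enn2real_if)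
    also have "\<dots> \<le> 1 * H R x" by (intro mult_right_mono \<theta>1) simp
    finally show ?thesis by simp
  qed
  \<comment> \<open>If \<open>s R\<close> is 0 then \<open>H R\<close>, and with it
    \<open>g R\<close>, vanishes, so coefficient times block recovers \<open>g R\<close> in every
    case.\<close>
  define b where "b R x = complex_of_real (if s R = 0 then 0 else g R x / s R)" for R x
  have sb: "complex_of_real (s R) * b R x = complex_of_real (g R x)" for R x
    using s(2) [of R x] by (auto simp: b_def g_def)
  have block: "is_block p q t (dyadic_cube R) (b R)" for R
    unfolding is_block_def
  proof (intro conjI allI impI)
    show bm [measurable]: "b R \<in> borel_measurable lebesgue"
      unfolding b_def by measurable
    show "b R x = 0" if "x \<notin> dyadic_cube R" for x
      using supp [OF that] by (simp add: b_def g_def)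
    have "lorentz lebesgue p q (\<lambda>x. ennreal (norm (b R x))) \<le> lorentz lebesgue p q (\<lambda>x. ennreal (1 / s R) * H R x)"
    proof (rule lorentz_mono)
      fix x
      have "norm (b R x) = 1 / s R * g R x"
        using s(1) [of R] by (auto simp: b_def g_def)
      then have "ennreal (norm (b R x)) = ennreal (1 / s R) * ennreal (g R x)"
        using s(1) [of R] unfolding g_def by (metis ennreal_mult divide_nonneg_nonneg enn2real_nonneg zero_le_one)
      then show "ennreal (norm (b R x)) \<le> ennreal (1 / s R) * H R x"
        using gle [of R x] by (simp add: mult_left_mono)
    qed (use q in auto)
    also have "\<dots> \<le> ennreal (1 / s R) * lorentz lebesgue p q (H R)"
      using q by (intro lorentz_cmult_le) auto
    also have "\<dots> \<le> ennreal (1 / s R) * (ennreal (cube_vol R powr (1 / p - 1 / t)) * ennreal (s R))"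
      by (intro mult_left_mono H) simp
    also have "\<dots> = ennreal (1 / s R * (cube_vol R powr (1 / p - 1 / t) * s R))"
      using s(1) [of R] by (metis ennreal_mult divide_nonneg_nonneg mult_nonneg_nonneg powr_ge_zero zero_le_one)
    also have "\<dots> \<le> ennreal (cube_vol R powr (1 / p - 1 / t))"
      by (intro ennreal_leI) (cases "s R = 0"; simp)
    finally show "lorentz_norm p q (b R) \<le> ennreal (measure lebesgue (dyadic_cube R) powr (1 / p - 1 / t))"
      by (simp add: lorentz_norm_eq measure_dyadic_cube)
  qed
  have ptw: "ennreal (norm (complex_of_real (enn2real (T x)) - (\<Sum>R\<in>A. complex_of_real (s R) * b R x)))
      \<le> (\<integral>\<^sup>+R. H R x * indicator (- A) R \<partial>count_space UNIV)" if Gx: "G x < top" and A: "finite A" for x A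
  proof -
    have HG: "H R x \<le> G x" for R unfolding G_def by (rule nn_integral_ge_point [OF UNIV_I])
    have HR: "\<theta> x * H R x < top" for R
    proof -
      have "\<theta> x * H R x \<le> 1 * G x" by (intro mult_mono \<theta>1 HG) auto
      then show ?thesis using Gx by (simp add: le_less_trans)
    qed
    have TxG: "T x = \<theta> x * G x"
    proof (cases "G x = 0")
      case True
      then show ?thesis using TG [of x] by simp
    next
      case False
      then show ?thesis
        using Gx unfolding \<theta>_def by (subst ennreal_divide_times) (simp add: ennreal_mult_divide_eq)
    qed
    \<comment> \<open>All pieces are nonnegative, so the remainder after \<open>A\<close> is exactly
      this sum, and \<theta> \<le> 1 bounds it by the tail of the majorant.\<close>
    let ?tail = "\<integral>\<^sup>+R. \<theta> x * H R x * indicator (- A) R \<partial>count_space UNIV"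
    have "T x = (\<integral>\<^sup>+R. \<theta> x * H R x \<partial>count_space UNIV)"
      unfolding TxG G_def by (rule nn_integral_cmult [symmetric]) simp
    also have "\<dots> = (\<integral>\<^sup>+R. \<theta> x * H R x * indicator A R + \<theta> x * H R x * indicator (- A) R \<partial>count_space UNIV)"
      by (intro nn_integral_cong) (auto split: split_indicator)
    also have "\<dots> = (\<integral>\<^sup>+R. \<theta> x * H R x * indicator A R \<partial>count_space UNIV) + ?tail"
      by (rule nn_integral_add) auto
    also have "(\<integral>\<^sup>+R. \<theta> x * H R x * indicator A R \<partial>count_space UNIV) = (\<Sum>R\<in>A. \<theta> x * H R x)"
      using A by (subst nn_integral_count_space_indicator [symmetric]) (auto simp: nn_integral_count_space_finite)
    also have "\<dots> = (\<Sum>R\<in>A. ennreal (g R x))"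
      using HR by (intro sum.cong refl) (simp add: g_def)
    also have "\<dots> = ennreal (\<Sum>R\<in>A. g R x)" by (rule sum_ennreal) (simp add: g_def)
    finally have Tx: "T x = ennreal (\<Sum>R\<in>A. g R x) + ?tail" .
    have "T x < top" using TG [of x] Gx by (rule le_less_trans)
    with Tx have "?tail < top" by auto
    then obtain d where d: "?tail = ennreal d" "0 \<le> d" by (cases ?tail) auto
    have g0: "0 \<le> (\<Sum>R\<in>A. g R x)" by (intro sum_nonneg) (simp add: g_def)
    have "T x = ennreal ((\<Sum>R\<in>A. g R x) + d)" unfolding Tx d using g0 d(2) by (simp add: ennreal_plus)
    then have "enn2real (T x) = (\<Sum>R\<in>A. g R x) + d"
      using g0 d(2) by (simp only: enn2real_ennreal add_nonneg_nonneg)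
    then have "complex_of_real (enn2real (T x)) - (\<Sum>R\<in>A. complex_of_real (s R) * b R x) = complex_of_real d"
      by (simp add: sb)
    then have "ennreal (norm (complex_of_real (enn2real (T x)) - (\<Sum>R\<in>A. complex_of_real (s R) * b R x))) = ?tail"
      using d by simp
    also have "\<dots> \<le> (\<integral>\<^sup>+R. H R x * indicator (- A) R \<partial>count_space UNIV)"
    proof (intro nn_integral_mono)
      fix R
      have "\<theta> x * H R x \<le> 1 * H R x" by (intro mult_right_mono \<theta>1) simp
      then show "\<theta> x * H R x * indicator (- A) R \<le> H R x * indicator (- A) R"
        by (intro mult_right_mono) auto
    qed
    finally show ?thesis .
  qed
  have sums: "sums_L1loc (\<lambda>R x. complex_of_real (s R) * b R x) (\<lambda>x. complex_of_real (enn2real (T x)))"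
    unfolding sums_L1loc_def
  proof (intro allI impI)
    fix K :: "(real ^ 'n) set" assume K: "compact K"
    have [measurable]: "K \<in> sets lebesgue" using compact_imp_closed [OF K] borel_closed by simp
    define a where "a R = (\<integral>\<^sup>+x \<in> K. H R x \<partial>lebesgue)" for R
    obtain S :: "(int \<times> (int ^ 'n)) set" where S: "finite S" "\<And>R. R \<in> S \<Longrightarrow> fst R = 0" "K \<subseteq> (\<Union>R\<in>S. dyadic_cube R)"
      using compact_subset_unit_cubes [OF K] by blast
    \<comment> \<open>Finitely many unit cubes cover \<open>K\<close>, so the majorants converge
      absolutely in L^1(K) and their tails tend to 0.\<close>
    have "(\<integral>\<^sup>+R. a R \<partial>count_space UNIV) \<le> (\<integral>\<^sup>+R. (\<Sum>R0\<in>S. \<integral>\<^sup>+x \<in> dyadic_cube R0. H R x \<partial>lebesgue) \<partial>count_space UNIV)"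
    proof (intro nn_integral_mono)
      fix R
      have "a R \<le> (\<integral>\<^sup>+x. (\<Sum>R0\<in>S. H R x * indicator (dyadic_cube R0) x) \<partial>lebesgue)"
        unfolding a_def
      proof (intro nn_integral_mono)
        fix x
        show "H R x * indicator K x \<le> (\<Sum>R0\<in>S. H R x * indicator (dyadic_cube R0) x)"
        proof (cases "x \<in> K")
          case True
          then obtain R0 where R0: "R0 \<in> S" "x \<in> dyadic_cube R0" using S(3) by blast
          then have "H R x * indicator K x = H R x * indicator (dyadic_cube R0) x" using True by simp
          also have "\<dots> \<le> (\<Sum>R0\<in>S. H R x * indicator (dyadic_cube R0) x)"
            by (rule member_le_sum [OF R0(1) _ S(1)]) simp
          finally show ?thesis .
        qed simp
      qed
      also have "\<dots> = (\<Sum>R0\<in>S. \<integral>\<^sup>+x \<in> dyadic_cube R0. H R x \<partial>lebesgue)"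
        by (rule nn_integral_sum) simp
      finally show "a R \<le> (\<Sum>R0\<in>S. \<integral>\<^sup>+x \<in> dyadic_cube R0. H R x \<partial>lebesgue)" .
    qed
    also have "\<dots> = (\<Sum>R0\<in>S. \<integral>\<^sup>+R. (\<integral>\<^sup>+x \<in> dyadic_cube R0. H R x \<partial>lebesgue) \<partial>count_space UNIV)"
      by (rule nn_integral_sum) simp
    also have "\<dots> < top" using S loc0 by (simp add: ennreal_sum_less_top)
    finally have tail: "((\<lambda>A. \<integral>\<^sup>+R. a R * indicator (- A) R \<partial>count_space UNIV) \<longlongrightarrow> 0) (finite_subsets_at_top UNIV)"
      by (rule nn_integral_count_space_tail_tendsto_0)
    have le_tail: "\<forall>\<^sub>F A in finite_subsets_at_top UNIV.
        (\<integral>\<^sup>+x \<in> K. ennreal (norm (complex_of_real (enn2real (T x)) - (\<Sum>R\<in>A. complex_of_real (s R) * b R x))) \<partial>lebesgue)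
        \<le> (\<integral>\<^sup>+R. a R * indicator (- A) R \<partial>count_space UNIV)"
    proof (rule eventually_finite_subsets_at_top_weakI)
      fix A :: "(int \<times> (int ^ 'n)) set" assume A: "finite A"
      have "(\<integral>\<^sup>+x \<in> K. ennreal (norm (complex_of_real (enn2real (T x)) - (\<Sum>R\<in>A. complex_of_real (s R) * b R x))) \<partial>lebesgue)
        \<le> (\<integral>\<^sup>+x. (\<integral>\<^sup>+R. H R x * indicator K x * indicator (- A) R \<partial>count_space UNIV) \<partial>lebesgue)"
      proof (rule nn_integral_mono_AE, rule eventually_mono [OF AE_G])
        fix x assume "G x < top"
        then show "ennreal (norm (complex_of_real (enn2real (T x)) - (\<Sum>R\<in>A. complex_of_real (s R) * b R x))) * indicator K x
          \<le> (\<integral>\<^sup>+R. H R x * indicator K x * indicator (- A) R \<partial>count_space UNIV)"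
          using ptw [OF _ A, of x] by (cases "x \<in> K") auto
      qed
      also have "\<dots> = (\<integral>\<^sup>+R. (\<integral>\<^sup>+x. H R x * indicator K x * indicator (- A) R \<partial>lebesgue) \<partial>count_space UNIV)"
        by (rule nn_integral_count_space_nn_integral) auto
      also have "\<dots> = (\<integral>\<^sup>+R. a R * indicator (- A) R \<partial>count_space UNIV)"
        unfolding a_def by (intro nn_integral_cong nn_integral_multc) auto
      finally show "(\<integral>\<^sup>+x \<in> K. ennreal (norm (complex_of_real (enn2real (T x)) - (\<Sum>R\<in>A. complex_of_real (s R) * b R x))) \<partial>lebesgue)
        \<le> (\<integral>\<^sup>+R. a R * indicator (- A) R \<partial>count_space UNIV)" .
    qed
    show "((\<lambda>A. \<integral>\<^sup>+x \<in> K. ennreal (norm (complex_of_real (enn2real (T x)) - (\<Sum>R\<in>A. complex_of_real (s R) * b R x))) \<partial>lebesgue)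
        \<longlongrightarrow> 0) (finite_subsets_at_top UNIV)"
      by (rule tendsto_sandwich [OF always_eventually le_tail tendsto_const tail]) simp
  qed
  have "in_lp r (\<lambda>R. complex_of_real (s R))"
    unfolding in_lp_def using fin s by (intro summable_on_of_nn_integral) auto
  with block sums
  show "\<exists>b. block_repr p q t r (\<lambda>x. complex_of_real (enn2real (T x))) (\<lambda>R. complex_of_real (s R)) b"
    unfolding block_repr_def by blast
qed

section \<open>Coefficient bounds and the passage to the block norm\<close>

lemma lp_norm_eq:
  fixes c :: "'i::countable \<Rightarrow> complex"
  assumes "in_lp r c"
  shows "(\<integral>\<^sup>+i. ennreal (norm (c i) powr r) \<partial>count_space UNIV) = ennreal (\<Sum>\<^sub>\<infinity>i. norm (c i) powr r)"
  using assms ennreal_infsum_eq_nn_integral [of "\<lambda>i. norm (c i) powr r"] by (simp add: in_lp_def)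

text \<open>The bound is proved for each representation of \<open>f\<close> separately, with
  \<open>D\<close> independent of it; the infimum is left to the theorem.\<close>

lemma HL_maximal_block_repr:
  assumes q: "1 < q" and t: "1 < t" "t \<le> p" and r: "1 \<le> r" "r < t" "r = 1 \<or> t < p"
  obtains D where "0 < D"
    "\<And>(f :: real ^ 'n \<Rightarrow> complex) c b. f \<in> borel_measurable lebesgue \<Longrightarrow> block_repr p q t r f c b \<Longrightarrow>
      (AE x in lebesgue. HL_maximal f x < \<infinity>) \<and>
      (\<exists>c' b'. block_repr p q t r (\<lambda>x. complex_of_real (enn2real (HL_maximal f x))) c' b' \<and>
        lp_norm r c' \<le> D * lp_norm r c)"
proof -
  have p: "1 < p" using t by simp
  have q0: "0 < q" using q by simp
  let ?s = "spread_coeff (real CARD('n) * (1 - 1 / t)) :: (int \<times> (int ^ 'n) \<Rightarrow> ennreal) \<Rightarrow> int \<times> (int ^ 'n) \<Rightarrow> ennreal"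
  obtain C where C: "0 < C" "\<And>w. (\<integral>\<^sup>+R. ennpowr (?s w R) r \<partial>count_space UNIV)
        \<le> ennreal C * (\<integral>\<^sup>+Q. ennpowr (w Q) r \<partial>count_space UNIV)"
    using spread_coeff_lr_bound [OF t(1) r(1,2), where 'n = 'n] by blast
  obtain K where K: "0 < K"
    "\<And>(F :: int \<times> (int ^ 'n) \<Rightarrow> real ^ 'n \<Rightarrow> ennreal) w.
      (\<And>Q. F Q \<in> borel_measurable lebesgue) \<Longrightarrow>
      (\<And>Q x. x \<notin> dyadic_cube Q \<Longrightarrow> F Q x = 0) \<Longrightarrow>
      (\<And>Q. lorentz lebesgue p q (F Q) \<le> ennreal (cube_vol Q powr (1 / p - 1 / t))) \<Longrightarrow>
      \<exists>H. (\<forall>R. H R \<in> borel_measurable lebesgue) \<and> (\<forall>R x. x \<notin> dyadic_cube R \<longrightarrow> H R x = 0) \<and>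
        (\<forall>R. lorentz lebesgue p q (H R) \<le> ennreal (cube_vol R powr (1 / p - 1 / t)) * (ennreal K * ?s w R)) \<and>
        (\<forall>R x. ?s w R = 0 \<longrightarrow> H R x = 0) \<and>
        (\<forall>x. (\<integral>\<^sup>+Q. w Q * maximal (F Q) x \<partial>count_space UNIV) \<le> (\<integral>\<^sup>+R. H R x \<partial>count_space UNIV))"
    using maximal_majorant [OF p q t(1), where 'n = 'n] by blast
  \<comment> \<open>\<open>K\<close> scales every coefficient and so contributes K^r to the sum of
    r-th powers; \<open>C\<close> is the spreading bound; the norm takes the r-th root.\<close>
  define D where "D = (K powr r * C) powr (1 / r)"
  show thesis
  proof (rule that)
    show "0 < D" using K(1) C(1) by (simp add: D_def)
    fix f :: "real ^ 'n \<Rightarrow> complex" and c b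
    assume fm [measurable]: "f \<in> borel_measurable lebesgue" and repr: "block_repr p q t r f c b"
    define w where "w Q = ennreal (norm (c Q))" for Q
    define F where "F Q x = ennreal (norm (b Q x))" for Q x
    have bm [measurable]: "b Q \<in> borel_measurable lebesgue" for Q
      using repr unfolding block_repr_def is_block_def by blast
    have F: "F Q \<in> borel_measurable lebesgue" "x \<notin> dyadic_cube Q \<Longrightarrow> F Q x = 0"
        "lorentz lebesgue p q (F Q) \<le> ennreal (cube_vol Q powr (1 / p - 1 / t))" for Q x
    proof -
      have "is_block p q t (dyadic_cube Q) (b Q)" using repr unfolding block_repr_def by blast
      moreover have "F Q = (\<lambda>x. ennreal (norm (b Q x)))" by (simp add: F_def fun_eq_iff)
      ultimately show "F Q \<in> borel_measurable lebesgue" "x \<notin> dyadic_cube Q \<Longrightarrow> F Q x = 0"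
        "lorentz lebesgue p q (F Q) \<le> ennreal (cube_vol Q powr (1 / p - 1 / t))"
        by (auto simp: is_block_def lorentz_norm_eq measure_dyadic_cube)
    qed
    obtain H where H: "\<And>R. H R \<in> borel_measurable lebesgue" "\<And>R x. x \<notin> dyadic_cube R \<Longrightarrow> H R x = 0"
        "\<And>R. lorentz lebesgue p q (H R) \<le> ennreal (cube_vol R powr (1 / p - 1 / t)) * (ennreal K * ?s w R)"
        "\<And>R x. ?s w R = 0 \<Longrightarrow> H R x = 0"
        "\<And>x. (\<integral>\<^sup>+Q. w Q * maximal (F Q) x \<partial>count_space UNIV) \<le> (\<integral>\<^sup>+R. H R x \<partial>count_space UNIV)"
      using K(2) [of F w, OF F] by blast
    have in_c: "in_lp r c" using repr by (simp add: block_repr_def)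
    have wsum: "(\<integral>\<^sup>+Q. ennpowr (w Q) r \<partial>count_space UNIV) = ennreal (\<Sum>\<^sub>\<infinity>Q. norm (c Q) powr r)"
      using lp_norm_eq [OF in_c] by (simp add: w_def ennpowr_ennreal)
    have sfin: "?s w R < top" for R
      by (rule spread_coeff_finite [OF t(1) r(1,2)]) (simp add: wsum)
    \<comment> \<open>The spread coefficients are finite by \<open>sfin\<close>, so
      \<open>enn2real\<close> loses nothing, and \<sigma> vanishes only where they do.\<close>
    define \<sigma> where "\<sigma> R = K * enn2real (?s w R)" for R
    have \<sigma>: "ennreal (\<sigma> R) = ennreal K * ?s w R" for R
      using K(1) sfin [of R] by (simp add: \<sigma>_def ennreal_mult)
    have \<sigma>0: "0 \<le> \<sigma> R" for R using K(1) by (simp add: \<sigma>_def)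
    have \<sigma>sum: "(\<integral>\<^sup>+R. ennreal (\<sigma> R powr r) \<partial>count_space UNIV) \<le> ennreal (K powr r * C * (\<Sum>\<^sub>\<infinity>Q. norm (c Q) powr r))"
    proof -
      have "(\<integral>\<^sup>+R. ennreal (\<sigma> R powr r) \<partial>count_space UNIV) = (\<integral>\<^sup>+R. ennreal (K powr r) * ennpowr (?s w R) r \<partial>count_space UNIV)"
      proof (rule nn_integral_cong)
        fix R
        have "ennreal (\<sigma> R powr r) = ennpowr (ennreal (\<sigma> R)) r" using \<sigma>0 by (simp add: ennpowr_ennreal)
        also have "\<dots> = ennreal (K powr r) * ennpowr (?s w R) r"
          unfolding \<sigma> using K(1) by (simp add: ennpowr_mult ennpowr_ennreal)
        finally show "ennreal (\<sigma> R powr r) = ennreal (K powr r) * ennpowr (?s w R) r" .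
      qed
      also have "\<dots> = ennreal (K powr r) * (\<integral>\<^sup>+R. ennpowr (?s w R) r \<partial>count_space UNIV)"
        by (rule nn_integral_cmult) simp
      also have "\<dots> \<le> ennreal (K powr r) * (ennreal C * ennreal (\<Sum>\<^sub>\<infinity>Q. norm (c Q) powr r))"
        using C(2) [of w] unfolding wsum by (rule mult_left_mono) simp
      also have "\<dots> = ennreal (K powr r * C * (\<Sum>\<^sub>\<infinity>Q. norm (c Q) powr r))"
        using C(1) infsum_nonneg [of UNIV "\<lambda>Q. norm (c Q) powr r"] by (simp add: ennreal_mult mult.assoc)
      finally show ?thesis .
    qed
    have Mle: "maximal (\<lambda>y. ennreal (norm (f y))) x \<le> (\<integral>\<^sup>+R. H R x \<partial>count_space UNIV)" for x
    proof -
      have "maximal (\<lambda>y. ennreal (norm (f y))) x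
          \<le> (\<integral>\<^sup>+Q. maximal (\<lambda>y. ennreal (norm (c Q * b Q y))) x \<partial>count_space UNIV)"
        using repr by (intro maximal_le_sum) (auto simp: block_repr_def)
      also have "\<dots> \<le> (\<integral>\<^sup>+Q. w Q * maximal (F Q) x \<partial>count_space UNIV)"
      proof (intro nn_integral_mono)
        fix Q
        have "(\<lambda>y. ennreal (norm (c Q * b Q y))) = (\<lambda>y. w Q * F Q y)"
          by (simp add: w_def F_def norm_mult ennreal_mult)
        then show "maximal (\<lambda>y. ennreal (norm (c Q * b Q y))) x \<le> w Q * maximal (F Q) x"
          using maximal_cmult_le [OF F(1), of "w Q" Q x] by simp
      qed
      also note H(5)
      finally show ?thesis .
    qed
    have fin: "(\<integral>\<^sup>+R. ennreal (\<sigma> R powr r) \<partial>count_space UNIV) < top"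
      using \<sigma>sum by (rule le_less_trans) simp
    have \<sigma>H: "H R x = 0" if "\<sigma> R = 0" for R x
    proof -
      have "enn2real (?s w R) = 0" using that K(1) by (simp add: \<sigma>_def)
      then have "?s w R = 0" using sfin [of R] unfolding enn2real_eq_0_iff by auto
      then show ?thesis by (rule H(4))
    qed
    have HL: "lorentz lebesgue p q (H R) \<le> ennreal (cube_vol R powr (1 / p - 1 / t)) * ennreal (\<sigma> R)" for R
      using H(3) [of R] by (simp only: \<sigma>)
    note maj = block_repr_of_majorant [OF p q0 t r measurable_maximal H(1,2) \<sigma>0 \<sigma>H HL fin Mle]
    obtain b' where b': "block_repr p q t r (\<lambda>x. complex_of_real (enn2real (HL_maximal f x))) (\<lambda>R. complex_of_real (\<sigma> R)) b'"
      using maj(2) unfolding HL_maximal_eq by blast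
    have "ennreal (\<Sum>\<^sub>\<infinity>R. norm (complex_of_real (\<sigma> R)) powr r) \<le> ennreal (K powr r * C * (\<Sum>\<^sub>\<infinity>Q. norm (c Q) powr r))"
      using \<sigma>sum lp_norm_eq [of r "\<lambda>R. complex_of_real (\<sigma> R)"] b' \<sigma>0 by (simp add: block_repr_def)
    then have "(\<Sum>\<^sub>\<infinity>R. norm (complex_of_real (\<sigma> R)) powr r) \<le> K powr r * C * (\<Sum>\<^sub>\<infinity>Q. norm (c Q) powr r)"
      using C(1) by (subst (asm) ennreal_le_iff) (auto intro!: mult_nonneg_nonneg infsum_nonneg)
    then have "lp_norm r (\<lambda>R. complex_of_real (\<sigma> R)) \<le> (K powr r * C * (\<Sum>\<^sub>\<infinity>Q. norm (c Q) powr r)) powr (1 / r)"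
      unfolding lp_norm_def using r by (intro powr_mono2) (auto intro: infsum_nonneg)
    also have "\<dots> = D * lp_norm r c"
      unfolding lp_norm_def D_def using C(1) by (intro powr_mult)
    finally have "lp_norm r (\<lambda>R. complex_of_real (\<sigma> R)) \<le> D * lp_norm r c" .
    moreover have "AE x in lebesgue. HL_maximal f x < \<infinity>"
      using maj(1) unfolding HL_maximal_eq by simp
    ultimately show "(AE x in lebesgue. HL_maximal f x < \<infinity>) \<and>
      (\<exists>c' b'. block_repr p q t r (\<lambda>x. complex_of_real (enn2real (HL_maximal f x))) c' b' \<and>
        lp_norm r c' \<le> D * lp_norm r c)"
      using b' by blast
  qed
qed

theorem theorem4p8:
  fixes p' q' t' r' :: real
  assumes "1 < q'"
    and "(1 < r' \<and> r' < t' \<and> t' < p') \<or> (1 = r' \<and> r' < t' \<and> t' \<le> p')"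
  shows "bounded_on_block_space p' q' t' r'
           (HL_maximal :: (real ^ 'n \<Rightarrow> complex) \<Rightarrow> real ^ 'n \<Rightarrow> ennreal)"
proof -
  have exps: "1 < t'" "t' \<le> p'" "1 \<le> r'" "r' < t'" "r' = 1 \<or> t' < p'" using assms(2) by auto
  obtain D where D: "0 < D"
    "\<And>(f :: real ^ 'n \<Rightarrow> complex) c b. f \<in> borel_measurable lebesgue \<Longrightarrow> block_repr p' q' t' r' f c b \<Longrightarrow>
      (AE x in lebesgue. HL_maximal f x < \<infinity>) \<and>
      (\<exists>c' b'. block_repr p' q' t' r' (\<lambda>x. complex_of_real (enn2real (HL_maximal f x))) c' b' \<and>
        lp_norm r' c' \<le> D * lp_norm r' c)"
    using HL_maximal_block_repr [OF assms(1) exps, where 'n = 'n] by blast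
  show ?thesis
    unfolding bounded_on_block_space_def
  proof (intro exI ballI conjI)
    fix f :: "real ^ 'n \<Rightarrow> complex" assume f: "f \<in> block_space p' q' t' r'"
    let ?M = "\<lambda>x. complex_of_real (enn2real (HL_maximal f x))"
    let ?S = "\<lambda>g :: real ^ 'n \<Rightarrow> complex. {lp_norm r' c | c. \<exists>b. block_repr p' q' t' r' g c b}"
    from f have fm: "f \<in> borel_measurable lebesgue" and ne: "?S f \<noteq> {}"
      by (auto simp: block_space_def)
    from f obtain c b where cb: "block_repr p' q' t' r' f c b" by (auto simp: block_space_def)
    show "AE x in lebesgue. HL_maximal f x < \<infinity>" using D(2) [OF fm cb] by blast
    have "?M \<in> borel_measurable lebesgue"
      unfolding HL_maximal_eq
      by (intro borel_measurable_of_real measurable_compose [OF measurable_maximal]) simp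
    then show "?M \<in> block_space p' q' t' r'"
      using D(2) [OF fm cb] unfolding block_space_def by blast
    \<comment> \<open>A real \<open>Inf\<close> is a lower bound only for sets bounded below; 0
      serves because \<open>lp_norm\<close> is a value of \<open>powr\<close>.\<close>
    have bdd: "bdd_below (?S ?M)"
      by (rule bdd_belowI [of _ 0]) (auto simp: lp_norm_def)
    \<comment> \<open>The infimum defining the norm of \<open>f\<close> need not be attained;
      dividing by \<open>D\<close> turns the claim into a lower bound for every representation of
      \<open>f\<close>.\<close>
    have "block_norm p' q' t' r' ?M / D \<le> block_norm p' q' t' r' f"
      unfolding block_norm_def [of _ _ _ _ f]
    proof (rule cInf_greatest [OF ne])
      fix y assume "y \<in> ?S f"
      then obtain c b where y: "y = lp_norm r' c" and cb: "block_repr p' q' t' r' f c b" by blast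
      obtain c' b' where c': "block_repr p' q' t' r' ?M c' b'" "lp_norm r' c' \<le> D * lp_norm r' c"
        using D(2) [OF fm cb] by blast
      have "block_norm p' q' t' r' ?M \<le> lp_norm r' c'"
        unfolding block_norm_def using c'(1) by (intro cInf_lower bdd) blast
      also note c'(2)
      finally show "block_norm p' q' t' r' ?M / D \<le> y"
        using D(1) by (simp add: y field_simps)
    qed
    then show "block_norm p' q' t' r' ?M \<le> D * block_norm p' q' t' r' f"
      using D(1) by (simp add: field_simps)
  qed
qed

end
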